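(* (Quasiconvexity in the interior.) Suppose that $\mathbf{n}\in\mathcal{A}\cap W^{1,\infty}(\Omega,M)$ is a strong local minimizer of $I$. Then for a.e. $x\in\Omega$, $$F\big(x,\mathbf{n}(x),\nabla\mathbf{n}(x)\big)\leqslant\frac{1}{|D|}\int_D F\big(x,\mathbf{n}(x),\nabla\mathbf{n}(x)+\nabla P(\mathbf{n}(x))\nabla\boldsymbol{\phi}(y)\big)\,dy$$ for any nonempty open and bounded $D\subset\mathbb{R}^d$ and any $\boldsymbol{\phi}\in W^{1,\infty}_0(D,\mathbb{R}^k)$.
   Context: $\Omega\subset\mathbb{R}^d$ is a bounded Lipschitz domain whose boundary has two disjoint, relatively open, measurable components $\partial\Omega_1,\partial\Omega_2$ with $\partial\Omega=\overline{\partial\Omega_1}\cup\overline{\partial\Omega_2}$. $M\subset\mathbb{R}^k$ is a closed, bounded manifold of class $C^4$. There is an open set $U\supset M$ on which the nearest point projection $P:U\to M$ is uniquely defined and of class $C^3$; $\nabla P$ denotes its $k\times k$ derivative matrix, and $\nabla P(\mathbf{n}(x))\nabla\boldsymbol{\phi}(y)$ is a matrix product. For $1\leqslant p\leqslant\infty$, $W^{1,p}(\Omega,M)=\{\mathbf{n}\in W^{1,p}(\Omega,\mathbb{R}^k): \mathbf{n}(x)\in M\text{ a.e.}\}$. Given $\mathbf{n}_0\in W^{1,1}(\Omega,M)$, the admissible set is $\mathcal{A}=\{\mathbf{n}\in W^{1,1}(\Omega,M):\mathbf{n}=\mathbf{n}_0\text{ on }\partial\Omega_1\}$. The functional is $I(\mathbf{n})=\int_\Omega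 F(x,\mathbf{n}(x),\nabla\mathbf{n}(x))\,dx$, where for this result the Lagrangian is only assumed to satisfy $F\in C(\overline{\Omega}\times M\times\mathbb{R}^{k\times d})$ (no differentiability). $\mathbf{n}\in\mathcal{A}$ is a strong local minimizer of $I$ if there is $\epsilon>0$ such that $I(\mathbf{m})\geqslant I(\mathbf{n})$ for all $\mathbf{m}\in\mathcal{A}$ with $\|\mathbf{n}-\mathbf{m}\|_\infty<\epsilon$. $|D|$ denotes Lebesgue measure. *)

theory Defs
  imports "HOL-Analysis.Analysis" "HOL-Probability.Essential_Supremum"
begin

section \<open>Functions of class $C^r$\<close>

text \<open>Intended for open \<open>S\<close> only. All directional derivatives are required to be of class
  $C^{r}$, which in finite dimension is the same as the Frechet derivative being of class $C^{r}$.\<close>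

primrec Ck_on ::
  "nat \<Rightarrow> 'a::euclidean_space set \<Rightarrow> ('a \<Rightarrow> 'b::euclidean_space) \<Rightarrow> bool" where
  "Ck_on 0 S f \<longleftrightarrow> continuous_on S f"
| "Ck_on (Suc r) S f \<longleftrightarrow>
     f differentiable_on S \<and> (\<forall>v. Ck_on r S (\<lambda>x. frechet_derivative f (at x) v))"

definition test_function ::
  "'a::euclidean_space set \<Rightarrow> ('a \<Rightarrow> 'b::euclidean_space) \<Rightarrow> bool" where
  "test_function \<Omega> \<psi> \<longleftrightarrow>
     (\<forall>r. Ck_on r UNIV \<psi>) \<and> compact (closure {x. \<psi> x \<noteq> 0}) \<and> closure {x. \<psi> x \<noteq> 0} \<subseteq> \<Omega>"

text \<open>The derivative as a Jacobian matrix; row \<open>i\<close> is the gradient of component \<open>i\<close>.\<close>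

definition jacobian_matrix :: "(real^'d \<Rightarrow> real^'k) \<Rightarrow> real^'d \<Rightarrow> real^'d^'k" where
  "jacobian_matrix f x = matrix (frechet_derivative f (at x))"

section \<open>Embedded submanifolds and the nearest point projection\<close>

text \<open>Submanifolds (without boundary) of constant dimension, given by slice charts.\<close>

definition Ck_submanifold :: "nat \<Rightarrow> 'a::euclidean_space set \<Rightarrow> bool" where
  "Ck_submanifold r M \<longleftrightarrow>
     (\<exists>m. \<forall>p\<in>M. \<exists>V W \<psi> \<psi>' L.
        p \<in> V \<and> open V \<and> open W \<and> homeomorphism V W \<psi> \<psi>' \<and>
        Ck_on r V \<psi> \<and> Ck_on r W \<psi>' \<and>
        subspace (L :: 'a set) \<and> dim L = m \<and> \<psi> ` (M \<inter> V) = L \<inter> W)"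

definition nearest_point_projection ::
  "'a::euclidean_space set \<Rightarrow> 'a set \<Rightarrow> ('a \<Rightarrow> 'a) \<Rightarrow> bool" where
  "nearest_point_projection U M P \<longleftrightarrow>
     (\<forall>y\<in>U. P y \<in> M \<and> dist y (P y) = infdist y M \<and>
        (\<forall>z\<in>M. dist y z = infdist y M \<longrightarrow> z = P y))"

section \<open>Lipschitz domains\<close>

text \<open>Near each boundary point the domain is the strict epigraph, in direction \<open>e\<close>, of a Lipschitz
  function on the hyperplane orthogonal to \<open>e\<close>; this is the usual definition with the rotated
  coordinate system replaced by its last axis \<open>e\<close>.\<close>

definition lipschitz_domain :: "'a::euclidean_space set \<Rightarrow> bool" where
  "lipschitz_domain \<Omega> \<longleftrightarrow>
     open \<Omega> \<and> connected \<Omega> \<and> \<Omega> \<noteq> {} \<and>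
     (\<forall>x0\<in>frontier \<Omega>. \<exists>r>0. \<exists>e \<gamma> C.
        norm e = 1 \<and> C-lipschitz_on {y. y \<bullet> e = 0} \<gamma> \<and>
        \<Omega> \<inter> ball x0 r = {x \<in> ball x0 r. \<gamma> (x - (x \<bullet> e) *\<^sub>R e) < x \<bullet> e})"

section \<open>Hausdorff measure\<close>

text \<open>Normalised to agree with Lebesgue measure. The empty set is singled out because
  \<open>0 ^ 0 = 1\<close>, the convention needed for nonempty sets of diameter 0 when \<open>s = 0\<close>.\<close>

definition hausdorff_size :: "nat \<Rightarrow> 'a::metric_space set \<Rightarrow> ennreal" where
  "hausdorff_size s C =
     (if C = {} then 0 else ennreal (unit_ball_vol (real s) * (diameter C / 2) ^ s))"

definition hausdorff_outer :: "nat \<Rightarrow> 'a::metric_space set \<Rightarrow> ennreal" where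
  "hausdorff_outer s A =
     (SUP \<delta>\<in>{0<..}. INF C\<in>{C :: nat \<Rightarrow> 'a set.
          A \<subseteq> (\<Union>j. C j) \<and> (\<forall>j. bounded (C j) \<and> diameter (C j) \<le> \<delta>)}.
        (\<Sum>j. hausdorff_size s (C j)))"

definition hausdorff_measure :: "nat \<Rightarrow> 'a::metric_space measure" where
  "hausdorff_measure s = measure_of UNIV (sets borel) (hausdorff_outer s)"

section \<open>Lebesgue and Sobolev spaces\<close>

definition Linf_norm ::
  "'a::euclidean_space set \<Rightarrow> ('a \<Rightarrow> 'b::euclidean_space) \<Rightarrow> ereal" where
  "Linf_norm \<Omega> u = esssup (lebesgue_on \<Omega>) (\<lambda>x. ereal (norm (u x)))"

definition Lp ::
  "ereal \<Rightarrow> 'a::euclidean_space set \<Rightarrow> ('a \<Rightarrow> 'b::euclidean_space) set" where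
  "Lp p \<Omega> = {u \<in> borel_measurable (lebesgue_on \<Omega>).
     if p = \<infinity> then Linf_norm \<Omega> u < \<infinity>
     else integrable (lebesgue_on \<Omega>) (\<lambda>x. norm (u x) powr real_of_ereal p)}"

definition locally_integrable ::
  "'a::euclidean_space set \<Rightarrow> ('a \<Rightarrow> 'b::euclidean_space) \<Rightarrow> bool" where
  "locally_integrable \<Omega> u \<longleftrightarrow> (\<forall>K. compact K \<and> K \<subseteq> \<Omega> \<longrightarrow> integrable (lebesgue_on K) u)"

definition has_weak_grad ::
  "(real^'d) set \<Rightarrow> (real^'d \<Rightarrow> real^'k) \<Rightarrow> (real^'d \<Rightarrow> real^'d^'k) \<Rightarrow> bool" where
  "has_weak_grad \<Omega> u G \<longleftrightarrow>
     locally_integrable \<Omega> u \<and> locally_integrable \<Omega> G \<and>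
     (\<forall>\<psi> :: real^'d \<Rightarrow> real. test_function \<Omega> \<psi> \<longrightarrow>
        (\<forall>i j. (LINT x|lebesgue_on \<Omega>. u x $ i * frechet_derivative \<psi> (at x) (axis j 1))
             = - (LINT x|lebesgue_on \<Omega>. G x $ i $ j * \<psi> x)))"

text \<open>Weak gradients are unique almost everywhere; \<open>weak_grad\<close> selects a representative.\<close>

definition weak_grad ::
  "(real^'d) set \<Rightarrow> (real^'d \<Rightarrow> real^'k) \<Rightarrow> real^'d \<Rightarrow> real^'d^'k" where
  "weak_grad \<Omega> u = (SOME G. has_weak_grad \<Omega> u G)"

definition W1p :: "ereal \<Rightarrow> (real^'d) set \<Rightarrow> (real^'d \<Rightarrow> real^'k) set" where
  "W1p p \<Omega> = {u \<in> Lp p \<Omega>. \<exists>G. has_weak_grad \<Omega> u G \<and> G \<in> Lp p \<Omega>}"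

definition W1p_into ::
  "ereal \<Rightarrow> (real^'d) set \<Rightarrow> (real^'k) set \<Rightarrow> (real^'d \<Rightarrow> real^'k) set" where
  "W1p_into p \<Omega> M = {u \<in> W1p p \<Omega>. AE x in lebesgue_on \<Omega>. u x \<in> M}"

definition W11_norm :: "(real^'d) set \<Rightarrow> (real^'d \<Rightarrow> real^'k) \<Rightarrow> real" where
  "W11_norm \<Omega> u =
     (LINT x|lebesgue_on \<Omega>. norm (u x)) + (LINT x|lebesgue_on \<Omega>. norm (weak_grad \<Omega> u x))"

definition W11_zero :: "(real^'d) set \<Rightarrow> (real^'d \<Rightarrow> real^'k) set" where
  "W11_zero \<Omega> = {u \<in> W1p 1 \<Omega>.
     \<exists>\<psi> :: nat \<Rightarrow> real^'d \<Rightarrow> real^'k. (\<forall>j. test_function \<Omega> (\<psi> j)) \<and>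
       (\<lambda>j. W11_norm \<Omega> (\<lambda>x. u x - \<psi> j x)) \<longlonglongrightarrow> 0}"

text \<open>The usual convention in the calculus of variations: \<open>W1inf_zero\<close> is the intersection of
  $W^{1,\infty}$ with $W^{1,1}_0$, and not the norm closure of the test functions, which would only
  contain $C^1$ functions.\<close>

definition W1inf_zero :: "(real^'d) set \<Rightarrow> (real^'d \<Rightarrow> real^'k) set" where
  "W1inf_zero \<Omega> = W1p \<infinity> \<Omega> \<inter> W11_zero \<Omega>"

section \<open>Boundary traces\<close>

text \<open>The graph of the trace operator from $W^{1,1}$ to $L^1$ of the boundary: it is the continuous
  extension of the restriction to the boundary of functions that are continuous up to the
  boundary.\<close>

definition has_trace ::
  "(real^'d) set \<Rightarrow> (real^'d \<Rightarrow> real^'k) \<Rightarrow> (real^'d \<Rightarrow> real^'k) \<Rightarrow> bool" where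
  "has_trace \<Omega> u g \<longleftrightarrow>
     u \<in> W1p 1 \<Omega> \<and>
     integrable (restrict_space (hausdorff_measure (CARD('d) - 1)) (frontier \<Omega>)) g \<and>
     (\<exists>v :: nat \<Rightarrow> real^'d \<Rightarrow> real^'k.
        (\<forall>j. v j \<in> W1p 1 \<Omega> \<and> continuous_on (closure \<Omega>) (v j)) \<and>
        (\<lambda>j. W11_norm \<Omega> (\<lambda>x. v j x - u x)) \<longlonglongrightarrow> 0 \<and>
        (\<lambda>j. \<integral>\<^sup>+x. ennreal (norm (v j x - g x))
           \<partial>(restrict_space (hausdorff_measure (CARD('d) - 1)) (frontier \<Omega>))) \<longlonglongrightarrow> 0)"

definition traces_agree_on ::
  "(real^'d) set \<Rightarrow> (real^'d) set \<Rightarrow> (real^'d \<Rightarrow> real^'k) \<Rightarrow> (real^'d \<Rightarrow> real^'k) \<Rightarrow> bool" where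
  "traces_agree_on \<Omega> \<Gamma> u v \<longleftrightarrow>
     (\<exists>g h. has_trace \<Omega> u g \<and> has_trace \<Omega> v h \<and>
        (AE x in restrict_space (hausdorff_measure (CARD('d) - 1)) \<Gamma>. g x = h x))"

section \<open>The variational problem\<close>

definition admissible ::
  "(real^'d) set \<Rightarrow> (real^'d) set \<Rightarrow> (real^'k) set \<Rightarrow> (real^'d \<Rightarrow> real^'k)
     \<Rightarrow> (real^'d \<Rightarrow> real^'k) set" where
  "admissible \<Omega> \<Gamma> M n0 = {n \<in> W1p_into 1 \<Omega> M. traces_agree_on \<Omega> \<Gamma> n n0}"

text \<open>The integral as an extended real, since for a merely continuous integrand it need not be
  finite on the admissible set. If neither the positive nor the negative part is integrable, the
  value is \<open>\<infinity>\<close> (as \<open>\<infinity> - \<infinity> = \<infinity>\<close> for \<open>ereal\<close>), so that a competitor whose energy is undefined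
  puts no constraint on a minimizer.\<close>

definition energy ::
  "(real^'d \<Rightarrow> real^'k \<Rightarrow> real^'d^'k \<Rightarrow> real) \<Rightarrow> (real^'d) set \<Rightarrow> (real^'d \<Rightarrow> real^'k) \<Rightarrow> ereal" where
  "energy F \<Omega> n =
     enn2ereal (\<integral>\<^sup>+x. ennreal (F x (n x) (weak_grad \<Omega> n x)) \<partial>lebesgue_on \<Omega>) -
     enn2ereal (\<integral>\<^sup>+x. ennreal (- F x (n x) (weak_grad \<Omega> n x)) \<partial>lebesgue_on \<Omega>)"

definition strong_local_minimizer ::
  "(real^'d \<Rightarrow> real^'k \<Rightarrow> real^'d^'k \<Rightarrow> real) \<Rightarrow> (real^'d) set \<Rightarrow> (real^'d \<Rightarrow> real^'k) set
     \<Rightarrow> (real^'d \<Rightarrow> real^'k) \<Rightarrow> bool" where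
  "strong_local_minimizer F \<Omega> \<A> n \<longleftrightarrow>
     n \<in> \<A> \<and>
     (\<exists>\<epsilon>>0. \<forall>m\<in>\<A>. Linf_norm \<Omega> (\<lambda>x. n x - m x) < ereal \<epsilon> \<longrightarrow> energy F \<Omega> m \<ge> energy F \<Omega> n)"

end

theory Submission
  imports Defs "HOL-Probability.Probability_Measure"
begin

text \<open>
  The theorem is proved by blow-up. Around a point \<open>a\<close> the minimizer \<open>n\<close> is perturbed by
  \<open>\<phi>\<^sub>e x = e *\<^sub>R \<phi> ((x - a) / e)\<close> and projected back to the manifold, \<open>m = P \<circ> (n + \<phi>\<^sub>e)\<close>. The values of
  \<open>m\<close> and \<open>n\<close> differ by at most a multiple of \<open>e\<close>, and they agree outside of \<open>a + e D\<close>, so \<open>m\<close> is admissible and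
  competes with \<open>n\<close>, which is a strong local minimizer (\<open>projected_competitor\<close>). The chain rule gives
  the gradient of \<open>m\<close> as \<open>\<nabla>P (n + \<phi>\<^sub>e) ** (\<nabla>n + \<nabla>\<phi>\<^sub>e)\<close>. Comparing the energies on \<open>a + e D\<close> and substituting
  \<open>x = a + e y\<close> leads to an inequality between integrals over \<open>D\<close> (\<open>rescaled_energy_inequality\<close>). If
  \<open>n (a + e y)\<close> and \<open>\<nabla>n (a + e y)\<close> converge to \<open>n a\<close> and \<open>\<nabla>n a\<close> for almost every \<open>y\<close>, then in the limit the
  gradient on the right-hand side is \<open>\<nabla>P (n a) ** (\<nabla>n a + \<nabla>\<phi> y)\<close> (\<open>blow_up_limit\<close>). Finally
  \<open>\<nabla>P (n) ** \<nabla>n = \<nabla>n\<close>, which is the chain rule for \<open>P \<circ> n = n\<close> (\<open>projection_jacobian_weak_grad\<close>).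

  Three tools carry the argument. The first is continuity of translations in $L^1$. Averaged over a
  finite measure of directions it shows that along a suitable sequence of scales the blow-ups converge
  at almost every point (\<open>shift_AE_subsequence\<close>); the sequence only depends on a ball that contains \<open>D\<close>,
  so the exceptional null set does not depend on \<open>D\<close> and \<open>\<phi>\<close>. It also shows that mollifications
  converge in $L^1$, which yields the fundamental lemma of the calculus of variations, hence
  uniqueness of weak gradients, and which yields approximations of \<open>m - n\<close> that are continuous and
  vanish near the boundary, hence the invariance of traces (\<open>has_trace_add_compact_support\<close>).

  The second is the description of bounded weak gradients by difference quotients. A weak gradient
  satisfies the fundamental theorem of calculus along almost every segment in a coordinate direction
  (\<open>weak_deriv_line_FTC\<close>), so the difference quotients are averages of the gradient, which are bounded and
  converge almost everywhere along a sequence of increments; conversely, such convergence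
  determines the weak gradient, since a translation moves difference quotients to the test function.
  The chain rule (\<open>weak_chain_rule\<close>) and the extension by zero (\<open>weak_grad_zero_extension\<close>) become
  pointwise statements in this way.

  The third is that elements of \<open>W1inf_zero D\<close>, being limits of test functions, extend by zero to
  the whole space with their weak gradients (\<open>W1inf_zero_extension\<close>), so that they may be rescaled and
  added to \<open>n\<close>.
\<close>

section \<open>Smooth bump functions and test functions\<close>

text \<open>The derivatives of \<open>exp (- 1 / t)\<close>, extended by \<open>0\<close> to \<open>t \<le> 0\<close>, are linear
  combinations of these functions, so smoothness needs no formula for higher derivatives.\<close>

definition flat_exp :: "nat \<Rightarrow> real \<Rightarrow> real" where
  "flat_exp m t = (if t \<le> 0 then 0 else exp (- inverse t) * inverse t ^ m)"

lemma flat_exp_tendsto_0: "(flat_exp m \<longlongrightarrow> 0) (at 0)"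
proof -
  have "((\<lambda>x. x ^ m / exp x) \<longlongrightarrow> 0) (at_top :: real filter)"
    by (rule tendsto_power_div_exp_0)
  then have "((\<lambda>t. inverse t ^ m / exp (inverse t)) \<longlongrightarrow> (0::real)) (at_right 0)"
    by (rule filterlim_compose[OF _ filterlim_inverse_at_top_right])
  then have R: "(flat_exp m \<longlongrightarrow> 0) (at_right 0)"
    by (rule Lim_transform_eventually)
      (auto simp: flat_exp_def eventually_at_filter exp_minus divide_simps)
  have L: "(flat_exp m \<longlongrightarrow> 0) (at_left 0)"
    by (rule Lim_transform_eventually[OF tendsto_const]) (auto simp: flat_exp_def eventually_at_filter)
  show ?thesis using L R by (simp add: filterlim_split_at)
qed

text \<open>Away from \<open>0\<close> this is the product rule; at \<open>0\<close> the difference quotient of \<open>flat_exp m\<close>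
  is \<open>flat_exp (m + 1)\<close>, which tends to \<open>0\<close> because the exponential beats every power.\<close>

lemma flat_exp_deriv:
  "(flat_exp m has_real_derivative (flat_exp (m + 2) t - real m * flat_exp (m + 1) t)) (at t)"
proof -
  consider "t < 0" | "t = 0" | "t > 0" by linarith
  then show ?thesis
  proof cases
    case 1
    have "((\<lambda>_. 0) has_real_derivative 0) (at t)" by simp
    then have "(flat_exp m has_real_derivative 0) (at t)"
      by (rule has_field_derivative_transform_within_open[where S = "{..<0}"])
        (use 1 in \<open>auto simp: flat_exp_def\<close>)
    with 1 show ?thesis by (simp add: flat_exp_def)
  next
    case 2
    have "((\<lambda>h. (flat_exp m (0 + h) - flat_exp m 0) / h) \<longlongrightarrow> 0) (at 0)"
      by (rule Lim_transform_eventually[OF flat_exp_tendsto_0[of "m + 1"]])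
        (auto simp: flat_exp_def eventually_at_filter divide_inverse)
    with 2 show ?thesis by (simp add: DERIV_def flat_exp_def)
  next
    case 3
    have "((\<lambda>t. exp (- inverse t) * inverse t ^ m) has_real_derivative
        (flat_exp (m + 2) t - real m * flat_exp (m + 1) t)) (at t)"
      using 3 by (auto intro!: derivative_eq_intros simp: flat_exp_def power2_eq_square)
        (cases m; simp add: field_simps)
    then show ?thesis
      by (rule has_field_derivative_transform_within_open[where S = "{0<..}"])
        (use 3 in \<open>auto simp: flat_exp_def\<close>)
  qed
qed

text \<open>An algebra of functions that is closed under directional derivatives. Membership therefore
  gives \<open>Ck_on r\<close> for all \<open>r\<close> at once, by induction on \<open>r\<close> and without any chain rule for \<open>Ck_on\<close>.\<close>

inductive bump_algebra :: "('a::euclidean_space \<Rightarrow> real) \<Rightarrow> bool" where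
  const: "bump_algebra (\<lambda>_. c)"
| linear: "bump_algebra (\<lambda>x. x \<bullet> v)"
| flat: "bump_algebra (\<lambda>x. flat_exp m (1 - x \<bullet> x))"
| add: "bump_algebra f \<Longrightarrow> bump_algebra g \<Longrightarrow> bump_algebra (\<lambda>x. f x + g x)"
| mult: "bump_algebra f \<Longrightarrow> bump_algebra g \<Longrightarrow> bump_algebra (\<lambda>x. f x * g x)"

lemma bump_algebra_derivative:
  "bump_algebra f \<Longrightarrow>
     \<exists>f'. (\<forall>x. (f has_derivative f' x) (at x)) \<and> (\<forall>v. bump_algebra (\<lambda>x. f' x v))"
proof (induction rule: bump_algebra.induct)
  case (const c)
  show ?case by (rule exI[of _ "\<lambda>x v. 0"]) (auto intro: bump_algebra.const)
next
  case (linear v)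
  show ?case
    by (rule exI[of _ "\<lambda>x w. w \<bullet> v"]) (auto intro!: bump_algebra.const derivative_eq_intros)
next
  case (flat m)
  let ?d = "\<lambda>t. flat_exp (m + 2) t + (- real m) * flat_exp (m + 1) t"
  have "((\<lambda>x. flat_exp m (1 - x \<bullet> x)) has_derivative
      (\<lambda>v. ((-2) * (x \<bullet> v)) * ?d (1 - x \<bullet> x))) (at x)" for x :: 'a
  proof -
    have "((\<lambda>x. 1 - x \<bullet> x) has_derivative (\<lambda>v. (-2) * (x \<bullet> v))) (at x)"
      by (auto intro!: derivative_eq_intros simp: inner_commute algebra_simps)
    from DERIV_compose_FDERIV[OF flat_exp_deriv this, of m] show ?thesis by simp
  qed
  moreover have "bump_algebra (\<lambda>x. ((-2) * (x \<bullet> v)) * ?d (1 - x \<bullet> x))" for v :: 'a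
    by (intro bump_algebra.mult bump_algebra.add bump_algebra.const bump_algebra.linear
      bump_algebra.flat)
  ultimately show ?case by (intro exI conjI allI)
next
  case (add f g)
  then obtain f' g' where
    "\<And>x. (f has_derivative f' x) (at x)" "\<And>v. bump_algebra (\<lambda>x. f' x v)"
    "\<And>x. (g has_derivative g' x) (at x)" "\<And>v. bump_algebra (\<lambda>x. g' x v)" by blast
  then show ?case
    by (intro exI[of _ "\<lambda>x v. f' x v + g' x v"])
      (auto intro!: derivative_eq_intros bump_algebra.add)
next
  case (mult f g)
  then obtain f' g' where
    "\<And>x. (f has_derivative f' x) (at x)" "\<And>v. bump_algebra (\<lambda>x. f' x v)"
    "\<And>x. (g has_derivative g' x) (at x)" "\<And>v. bump_algebra (\<lambda>x. g' x v)" by blast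
  then show ?case using mult.hyps
    by (intro exI[of _ "\<lambda>x v. f x * g' x v + f' x v * g x"])
      (auto intro!: derivative_eq_intros bump_algebra.add bump_algebra.mult)
qed

lemma bump_algebra_Ck: "bump_algebra f \<Longrightarrow> Ck_on r UNIV f"
proof (induction r arbitrary: f)
  case 0
  from bump_algebra_derivative[OF 0] show ?case
    by (auto simp: continuous_on_eq_continuous_at intro: has_derivative_continuous)
next
  case (Suc r)
  from bump_algebra_derivative[OF Suc.prems] obtain f' where
    f': "\<And>x. (f has_derivative f' x) (at x)" "\<And>v. bump_algebra (\<lambda>x. f' x v)" by blast
  then have "frechet_derivative f (at x) = f' x" for x
    by (simp add: frechet_derivative_at[symmetric])
  with f' Suc.IH show ?case
    by (auto simp: differentiable_on_def differentiable_def intro: has_derivative_at_withinI)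
qed

definition bump :: "'a::euclidean_space \<Rightarrow> real" where
  "bump x = flat_exp 0 (1 - x \<bullet> x)"

lemma bump_nonneg: "bump x \<ge> 0"
  by (simp add: bump_def flat_exp_def)

lemma bump_pos_iff: "bump x > 0 \<longleftrightarrow> norm x < 1"
  using abs_square_less_1[of "norm x"] by (auto simp: bump_def flat_exp_def dot_square_norm)

lemma bump_support: "{x. bump x \<noteq> 0} = ball 0 1"
proof -
  have "bump x \<noteq> 0 \<longleftrightarrow> x \<in> ball 0 1" for x :: 'a
    using bump_nonneg[of x] bump_pos_iff[of x] by auto
  then show ?thesis by blast
qed

lemma test_function_bump: "cball 0 1 \<subseteq> W \<Longrightarrow> test_function W bump"
  unfolding test_function_def bump_support
  by (auto simp: bump_def[abs_def] intro!: bump_algebra_Ck bump_algebra.flat)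

lemma Ck_on_affine:
  fixes f :: "'a::euclidean_space \<Rightarrow> 'b::euclidean_space"
  shows "Ck_on r UNIV f \<Longrightarrow> Ck_on r UNIV (\<lambda>x. f (a + c *\<^sub>R x))"
proof (induction r arbitrary: f)
  case 0
  then show ?case by (auto intro!: continuous_intros intro: continuous_on_compose2[of UNIV f])
next
  case (Suc r)
  have D: "(f has_derivative frechet_derivative f (at x)) (at x)" for x
    using Suc.prems by (auto simp: differentiable_on_def frechet_derivative_works)
  have D': "((\<lambda>x. f (a + c *\<^sub>R x)) has_derivative
      (\<lambda>v. frechet_derivative f (at (a + c *\<^sub>R x)) (c *\<^sub>R v))) (at x)" for x
    by (rule has_derivative_compose[OF _ D]) (auto intro!: derivative_eq_intros)
  have E: "frechet_derivative (\<lambda>x. f (a + c *\<^sub>R x)) (at x) v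
      = frechet_derivative f (at (a + c *\<^sub>R x)) (c *\<^sub>R v)" for x v
    by (simp add: frechet_derivative_at[OF D', symmetric])
  have "Ck_on r UNIV (\<lambda>x. frechet_derivative f (at x) (c *\<^sub>R v))" for v
    using Suc.prems by simp
  from Suc.IH[OF this] show ?case using D'
    unfolding Ck_on.simps E
    by (auto simp: differentiable_on_def differentiable_def intro: has_derivative_at_withinI)
qed

text \<open>The condition on \<open>V\<close> is stated through points rather than through the preimage of \<open>W\<close>, because
  the supports are shifted along segments later and only this inclusion is then at hand.\<close>

lemma test_function_affine:
  assumes \<eta>: "test_function W \<eta>" and c: "c \<noteq> 0"
    and sub: "\<And>y. a + c *\<^sub>R y \<in> W \<Longrightarrow> y \<in> V"
  shows "test_function V (\<lambda>y. \<eta> (a + c *\<^sub>R y))"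
proof -
  let ?g = "\<lambda>z. (1 / c) *\<^sub>R (z - a)"
  let ?K = "closure {x. \<eta> x \<noteq> 0}"
  have K: "compact (?g ` ?K)"
    using \<eta> by (intro compact_continuous_image continuous_intros) (auto simp: test_function_def)
  have "{y. \<eta> (a + c *\<^sub>R y) \<noteq> 0} \<subseteq> ?g ` ?K"
  proof safe
    fix y assume "\<eta> (a + c *\<^sub>R y) \<noteq> 0"
    then have "a + c *\<^sub>R y \<in> ?K" using closure_subset[of "{x. \<eta> x \<noteq> 0}"] by blast
    moreover have "y = ?g (a + c *\<^sub>R y)" using c by simp
    ultimately show "y \<in> ?g ` ?K" by blast
  qed
  then have *: "closure {y. \<eta> (a + c *\<^sub>R y) \<noteq> 0} \<subseteq> ?g ` ?K"
    by (intro closure_minimal compact_imp_closed K)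
  moreover have "?g ` ?K \<subseteq> V"
  proof safe
    fix z assume "z \<in> ?K"
    then have "z \<in> W" using \<eta> by (auto simp: test_function_def)
    then show "?g z \<in> V" using c by (intro sub) simp
  qed
  moreover have "compact (closure {y. \<eta> (a + c *\<^sub>R y) \<noteq> 0})"
    using * K compact_Int_closed[OF K closed_closure] by (metis inf.absorb_iff2)
  ultimately show ?thesis
    using \<eta> Ck_on_affine[of _ \<eta> a c] unfolding test_function_def by blast
qed

lemma test_function_has_derivative:
  "test_function W \<eta> \<Longrightarrow> (\<eta> has_derivative frechet_derivative \<eta> (at x)) (at x)"
  using Ck_on.simps(2)[of 0 UNIV \<eta>]
  by (auto simp: test_function_def differentiable_on_def frechet_derivative_works simp del: Ck_on.simps)

lemma test_function_continuous: "test_function W \<eta> \<Longrightarrow> continuous_on UNIV \<eta>"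
  using Ck_on.simps(1)[of UNIV \<eta>] by (auto simp: test_function_def simp del: Ck_on.simps)

lemma test_function_continuous_derivative:
  "test_function W \<eta> \<Longrightarrow> continuous_on UNIV (\<lambda>x. frechet_derivative \<eta> (at x) v)"
  using Ck_on.simps(2)[of 0 UNIV \<eta>] Ck_on.simps(1)[of UNIV]
  by (auto simp: test_function_def simp del: Ck_on.simps)

lemma test_function_mono: "test_function V \<eta> \<Longrightarrow> V \<subseteq> W \<Longrightarrow> test_function W \<eta>"
  by (auto simp: test_function_def)

text \<open>The derivative vanishes off the same compact set, because the complement of the closed
  support is open.\<close>

lemma test_function_compact_support:
  assumes "test_function W \<eta>"
  obtains K where "compact K" "K \<subseteq> W" "\<And>x. x \<notin> K \<Longrightarrow> \<eta> x = 0"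
    "\<And>x v. x \<notin> K \<Longrightarrow> frechet_derivative \<eta> (at x) v = 0"
proof
  let ?K = "closure {x. \<eta> x \<noteq> 0}"
  show "compact ?K" "?K \<subseteq> W" using assms by (auto simp: test_function_def)
  show Z: "\<eta> x = 0" if "x \<notin> ?K" for x
    using that closure_subset[of "{x. \<eta> x \<noteq> 0}"] by blast
  show "frechet_derivative \<eta> (at x) v = 0" if "x \<notin> ?K" for x v
  proof -
    have "((\<lambda>_. 0) has_derivative (\<lambda>_. 0)) (at x)" by simp
    then have "(\<eta> has_derivative (\<lambda>_. 0)) (at x)"
    proof (rule has_derivative_transform_within_open)
      show "open (- ?K)" "x \<in> - ?K" using that by auto
      show "0 = \<eta> y" if "y \<in> - ?K" for y using Z[of y] that by simp
    qed
    from frechet_derivative_at[OF this] show ?thesis by metis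
  qed
qed

lemma bounded_continuous_compact_support:
  fixes f :: "'a::euclidean_space \<Rightarrow> 'b::euclidean_space"
  assumes "continuous_on UNIV f" "compact K" "\<And>x. x \<notin> K \<Longrightarrow> f x = 0"
  obtains B where "B \<ge> 0" "\<And>x. norm (f x) \<le> B"
proof -
  have "bounded (f ` K)"
    using assms by (intro compact_imp_bounded compact_continuous_image) (auto intro: continuous_on_subset)
  then obtain B where "B > 0" "\<And>x. x \<in> K \<Longrightarrow> norm (f x) \<le> B" by (auto simp: bounded_pos)
  then have "norm (f x) \<le> B" for x
    using assms(3)[of x] by (cases "x \<in> K") auto
  with \<open>B > 0\<close> that[of B] show ?thesis by simp
qed

lemma integrable_continuous_compact_support:
  fixes f :: "'a::euclidean_space \<Rightarrow> 'b::euclidean_space"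
  assumes "continuous_on UNIV f" "compact K" "\<And>x. x \<notin> K \<Longrightarrow> f x = 0"
  shows "integrable lborel f"
proof -
  have "integrable lborel (\<lambda>x. indicator K x *\<^sub>R f x)"
    using assms by (intro borel_integrable_compact) (auto intro: continuous_on_subset)
  moreover have "indicator K x *\<^sub>R f x = f x" for x using assms(3)[of x] by (auto simp: indicator_def)
  ultimately show ?thesis by simp
qed

section \<open>Continuity of translations in the mean\<close>

lemma integral_lborel_shift:
  fixes f :: "'a::euclidean_space \<Rightarrow> 'b::{banach, second_countable_topology}"
  assumes "f \<in> borel_measurable borel"
  shows "(LINT x|lborel. f (x + v)) = (LINT x|lborel. f x)"
proof -
  have "(LINT x|lborel. f x) = (LINT x|distr lborel borel ((+) v). f x)"
    by (simp add: lborel_distr_plus)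
  also have "\<dots> = (LINT x|lborel. f (v + x))"
    using assms by (subst integral_distr) auto
  finally show ?thesis by (simp add: add.commute)
qed

lemma integrable_lborel_shift:
  fixes f :: "'a::euclidean_space \<Rightarrow> 'b::{banach, second_countable_topology}"
  assumes "integrable lborel f"
  shows "integrable lborel (\<lambda>x. f (x + v))"
proof -
  have "integrable (distr lborel borel ((+) v)) f"
    using assms by (simp add: lborel_distr_plus)
  then have "integrable lborel (\<lambda>x. f (v + x))"
    using assms by (subst (asm) integrable_distr_eq) auto
  then show ?thesis by (simp add: add.commute)
qed

lemma integrable_shift_diff:
  fixes f :: "'a::euclidean_space \<Rightarrow> 'b::{banach, second_countable_topology}"
  assumes "integrable lborel f"
  shows "integrable lborel (\<lambda>x. norm (f (x + v) - f x))"
  by (intro integrable_norm Bochner_Integration.integrable_diff integrable_lborel_shift assms)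

text \<open>The $L^1$ modulus of continuity of translations.\<close>

definition shift_osc :: "('a::euclidean_space \<Rightarrow> 'b::{banach, second_countable_topology}) \<Rightarrow> 'a \<Rightarrow> real" where
  "shift_osc g v = (LINT x|lborel. norm (g (x + v) - g x))"

lemma shift_osc_nonneg: "shift_osc g v \<ge> 0"
  by (simp add: shift_osc_def)

lemma shift_osc_bound:
  assumes "integrable lborel g"
  shows "shift_osc g v \<le> 2 * (LINT x|lborel. norm (g x))"
proof -
  have [measurable]: "g \<in> borel_measurable borel" using borel_measurable_integrable[OF assms] by simp
  have "shift_osc g v \<le> (LINT x|lborel. norm (g (x + v)) + norm (g x))"
    unfolding shift_osc_def
    using assms by (intro integral_mono) (auto intro!: integrable_lborel_shift norm_triangle_ineq4)
  also have "\<dots> = 2 * (LINT x|lborel. norm (g x))"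
    using assms by (simp add: integrable_lborel_shift integral_lborel_shift[of "\<lambda>x. norm (g x)"])
  finally show ?thesis .
qed

lemma shift_osc_triangle:
  assumes f: "integrable lborel f" and g: "integrable lborel g"
  shows "shift_osc f v \<le> shift_osc g v + 2 * (LINT x|lborel. norm (f x - g x))"
proof -
  have I: "integrable lborel (\<lambda>x. norm (g (x + v) - g x))"
    "integrable lborel (\<lambda>x. norm (f (x + v) - f x))"
    "integrable lborel (\<lambda>x. norm ((f (x + v) - g (x + v)) - (f x - g x)))"
    using integrable_shift_diff[OF f] integrable_shift_diff[OF g]
      integrable_shift_diff[OF Bochner_Integration.integrable_diff[OF f g]] by auto
  have "shift_osc f v \<le> (LINT x|lborel. norm (g (x + v) - g x) + norm ((f (x + v) - g (x + v)) - (f x - g x)))"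
    unfolding shift_osc_def
  proof (intro integral_mono)
    fix x
    have "f (x + v) - f x = (g (x + v) - g x) + ((f (x + v) - g (x + v)) - (f x - g x))" by simp
    then show "norm (f (x + v) - f x) \<le> norm (g (x + v) - g x) + norm ((f (x + v) - g (x + v)) - (f x - g x))"
      by (metis norm_triangle_ineq)
  qed (use I in auto)
  also have "\<dots> = shift_osc g v + shift_osc (\<lambda>x. f x - g x) v"
    unfolding shift_osc_def using I by (intro Bochner_Integration.integral_add) auto
  also have "shift_osc (\<lambda>x. f x - g x) v \<le> 2 * (LINT x|lborel. norm (f x - g x))"
    using f g by (intro shift_osc_bound) auto
  finally show ?thesis by simp
qed

text \<open>Continuity of translations passes to $L^1$ limits, since translations do not change the
  $L^1$ norm.\<close>

lemma shift_osc_tendsto_approx: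
  assumes f: "integrable lborel f"
    and approx: "\<And>e. e > 0 \<Longrightarrow> \<exists>g. integrable lborel g \<and> (\<lambda>k. shift_osc g (v k)) \<longlonglongrightarrow> 0
      \<and> (LINT x|lborel. norm (f x - g x)) < e"
  shows "(\<lambda>k. shift_osc f (v k)) \<longlonglongrightarrow> 0"
proof (rule LIMSEQ_I)
  fix e :: real assume e: "e > 0"
  from approx[of "e / 4"] e obtain g where g: "integrable lborel g" "(\<lambda>k. shift_osc g (v k)) \<longlonglongrightarrow> 0"
    "(LINT x|lborel. norm (f x - g x)) < e / 4" by auto
  from LIMSEQ_D[OF g(2), of "e / 2"] e obtain N where N: "\<And>k. k \<ge> N \<Longrightarrow> shift_osc g (v k) < e / 2"
    using shift_osc_nonneg[of g] by auto
  have "norm (shift_osc f (v k) - 0) < e" if "k \<ge> N" for k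
    using shift_osc_triangle[OF f g(1), of "v k"] N[OF that] g(3) shift_osc_nonneg[of f "v k"] by simp
  then show "\<exists>N. \<forall>k\<ge>N. norm (shift_osc f (v k) - 0) < e" by blast
qed

text \<open>For an open set a point \<open>x\<close> of the set stays inside after small shifts, so that dominated
  convergence applies to \<open>indicator W x * (1 - indicator W (x + v))\<close>; by translation invariance the
  two halves of the symmetric difference have the same measure.\<close>

lemma shift_osc_open:
  fixes W :: "'a::euclidean_space set" and c :: "'b::{banach, second_countable_topology}"
  assumes W: "open W" "emeasure lborel W < \<infinity>" and v: "v \<longlonglongrightarrow> 0"
  shows "(\<lambda>k. shift_osc (\<lambda>x. indicator W x *\<^sub>R c) (v k)) \<longlonglongrightarrow> 0"
proof -
  let ?i = "indicator W :: 'a \<Rightarrow> real"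
  have [measurable]: "W \<in> sets borel" using W by simp
  have I: "integrable lborel ?i" using W by simp
  have I2: "integrable lborel (\<lambda>x. ?i x * ?i (x + w))" for w
    by (rule Bochner_Integration.integrable_bound[OF I]) (auto simp: indicator_def)
  have "shift_osc (\<lambda>x. indicator W x *\<^sub>R c) w = 2 * norm c * (LINT x|lborel. ?i x - ?i x * ?i (x + w))" for w
  proof -
    have "shift_osc (\<lambda>x. indicator W x *\<^sub>R c) w
        = (LINT x|lborel. norm c * ((?i (x + w) + ?i x) - 2 * (?i x * ?i (x + w))))"
      unfolding shift_osc_def by (intro Bochner_Integration.integral_cong) (auto simp: indicator_def)
    also have "\<dots> = norm c * ((LINT x|lborel. ?i (x + w)) + (LINT x|lborel. ?i x) - 2 * (LINT x|lborel. ?i x * ?i (x + w)))"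
      using I I2[of w] by (simp add: integrable_lborel_shift)
    also have "\<dots> = 2 * norm c * (LINT x|lborel. ?i x - ?i x * ?i (x + w))"
      using I I2[of w] by (simp add: integral_lborel_shift[of ?i] algebra_simps)
    finally show ?thesis .
  qed
  moreover have "(\<lambda>k. LINT x|lborel. ?i x - ?i x * ?i (x + v k)) \<longlonglongrightarrow> (LINT x::'a|lborel. (0::real))"
  proof (rule integral_dominated_convergence[where w = ?i])
    show "AE x in lborel. (\<lambda>k. ?i x - ?i x * ?i (x + v k)) \<longlonglongrightarrow> 0"
    proof (intro AE_I2)
      fix x
      show "(\<lambda>k. ?i x - ?i x * ?i (x + v k)) \<longlonglongrightarrow> 0"
      proof (cases "x \<in> W")
        case True
        have "(\<lambda>k. x + v k) \<longlonglongrightarrow> x" using tendsto_add[OF tendsto_const v, of x] by simp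
        from topological_tendstoD[OF this W(1) True]
        have "eventually (\<lambda>k. 0 = ?i x - ?i x * ?i (x + v k)) sequentially"
          by eventually_elim (use True in auto)
        from Lim_transform_eventually[OF tendsto_const this] show ?thesis .
      qed auto
    qed
  qed (use I in \<open>auto simp: indicator_def\<close>)
  ultimately show ?thesis
    by (auto intro!: tendsto_mult_right_zero)
qed

text \<open>Continuity of translations in $L^1$. Indicators are reduced to open sets by outer
  regularity, and general functions to simple ones.\<close>

lemma shift_osc_tendsto_0:
  fixes g :: "'a::euclidean_space \<Rightarrow> 'b::{banach, second_countable_topology}"
  assumes g: "integrable lborel g" and v: "v \<longlonglongrightarrow> 0"
  shows "(\<lambda>k. shift_osc g (v k)) \<longlonglongrightarrow> 0"
  using g
proof (induction rule: integrable_induct)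
  case (base A c)
  show ?case
  proof (rule shift_osc_tendsto_approx)
    show "integrable lborel (\<lambda>x. indicator A x *\<^sub>R c)" using base by simp
    fix e :: real assume e: "e > 0"
    \<comment> \<open>The summand \<open>1\<close> avoids a case distinction on \<open>c = 0\<close>.\<close>
    define \<delta> where "\<delta> = e / (norm c + 1)"
    have \<delta>: "\<delta> > 0" using e by (simp add: \<delta>_def add_nonneg_pos)
    obtain W where W: "open W" "A \<subseteq> W" "emeasure lborel (W - A) < \<delta>"
      using outer_regular_lborel[of A \<delta>] base \<delta> by auto
    have [measurable]: "W \<in> sets borel" "A \<in> sets borel" using W base by auto
    have fin: "emeasure lborel W < \<infinity>"
    proof -
      have "emeasure lborel W \<le> emeasure lborel A + emeasure lborel (W - A)"
        using emeasure_subadditive[of A lborel "W - A"] W(2) by (simp add: Un_absorb1)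
      also have "\<dots> < \<infinity>" using base W(3) by (auto simp: less_top intro: order.strict_trans)
      finally show ?thesis .
    qed
    have "(LINT x|lborel. norm (indicator A x *\<^sub>R c - indicator W x *\<^sub>R c)) = (LINT x|lborel. norm c * indicator (W - A) x)"
      using W(2) by (intro Bochner_Integration.integral_cong) (auto simp: indicator_def)
    also have "\<dots> = norm c * measure lborel (W - A)" by simp
    also have "\<dots> \<le> norm c * \<delta>"
      using W(3) \<delta> by (intro mult_left_mono) (auto simp: measure_def enn2real_leI)
    also have "\<dots> < e" using e norm_ge_zero[of c] by (simp add: \<delta>_def pos_divide_less_eq algebra_simps del: norm_ge_zero)
    finally have L: "(LINT x|lborel. norm (indicator A x *\<^sub>R c - indicator W x *\<^sub>R c)) < e" .
    have "integrable lborel (\<lambda>x. indicator W x *\<^sub>R c)" using fin by simp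
    with L shift_osc_open[OF W(1) fin v, of c]
    show "\<exists>g. integrable lborel g \<and> (\<lambda>k. shift_osc g (v k)) \<longlonglongrightarrow> 0
        \<and> (LINT x|lborel. norm (indicator A x *\<^sub>R c - g x)) < e" by blast
  qed
next
  case (add f g)
  have A: "(\<lambda>k. shift_osc f (v k) + shift_osc g (v k)) \<longlonglongrightarrow> 0"
    using tendsto_add[OF add.IH] by simp
  have B: "norm (shift_osc (\<lambda>x. f x + g x) w) \<le> shift_osc f w + shift_osc g w" for w
  proof -
    have "shift_osc (\<lambda>x. f x + g x) w \<le> (LINT x|lborel. norm (f (x + w) - f x) + norm (g (x + w) - g x))"
      unfolding shift_osc_def
      using integrable_shift_diff[OF add.hyps(1)] integrable_shift_diff[OF add.hyps(2)]
        integrable_shift_diff[OF Bochner_Integration.integrable_add[OF add.hyps]]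
      by (intro integral_mono) (auto intro!: norm_diff_triangle_ineq)
    also have "\<dots> = shift_osc f w + shift_osc g w"
      unfolding shift_osc_def
      by (intro Bochner_Integration.integral_add integrable_shift_diff add.hyps)
    finally show ?thesis using shift_osc_nonneg[of "\<lambda>x. f x + g x" w] by simp
  qed
  from B A show ?case
    by (rule Lim_null_comparison[OF always_eventually[OF allI]])
next
  case (lim f s)
  show ?case
  proof (rule shift_osc_tendsto_approx[OF lim.hyps(4)])
    fix e :: real assume e: "e > 0"
    have [measurable]: "f \<in> borel_measurable borel" "\<And>i. s i \<in> borel_measurable borel"
      using borel_measurable_integrable[OF lim.hyps(4)] borel_measurable_integrable[OF lim.hyps(1)]
      by simp_all
    have "(\<lambda>i. LINT x|lborel. norm (f x - s i x)) \<longlonglongrightarrow> (LINT x::'a|lborel. 0)"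
    proof (rule integral_dominated_convergence[where w = "\<lambda>x. 3 * norm (f x)"])
      show "AE x in lborel. (\<lambda>i. norm (f x - s i x)) \<longlonglongrightarrow> 0"
      proof (intro AE_I2)
        fix x
        from tendsto_diff[OF tendsto_const[of "f x"] lim.hyps(2)[of x]]
        show "(\<lambda>i. norm (f x - s i x)) \<longlonglongrightarrow> 0" by (intro tendsto_norm_zero) simp
      qed
      show "AE x in lborel. norm (norm (f x - s i x)) \<le> 3 * norm (f x)" for i
      proof (intro AE_I2)
        fix x
        show "norm (norm (f x - s i x)) \<le> 3 * norm (f x)"
          using norm_triangle_ineq4[of "f x" "s i x"] lim.hyps(3)[of x i] by simp
      qed
    qed (use lim.hyps in auto)
    then have "(\<lambda>i. LINT x|lborel. norm (f x - s i x)) \<longlonglongrightarrow> 0" by simp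
    from order_tendstoD(2)[OF this e] obtain i where "(LINT x|lborel. norm (f x - s i x)) < e"
      by (auto simp: eventually_sequentially)
    with lim.hyps(1) lim.IH
    show "\<exists>g. integrable lborel g \<and> (\<lambda>k. shift_osc g (v k)) \<longlonglongrightarrow> 0
        \<and> (LINT x|lborel. norm (f x - g x)) < e" by blast
  qed
qed

text \<open>A finite measure \<open>N\<close> and a map \<open>s\<close> on its space prescribe a whole family of directions at
  once. Three choices are used: \<open>N\<close> on the unit interval with \<open>s t = t *\<^sub>R v\<close> (difference
  quotients), \<open>N\<close> with a smooth density (mollification), and \<open>N\<close> on a ball (blow-up).\<close>

lemma averaged_shift:
  fixes g :: "'a::euclidean_space \<Rightarrow> 'b::{banach, second_countable_topology}"
  assumes g: "integrable lborel g" and N: "finite_measure N"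
    and s[measurable]: "s \<in> borel_measurable N" and h: "h \<longlonglongrightarrow> 0"
  shows "integrable (N \<Otimes>\<^sub>M lborel) (\<lambda>(t, x). g (x + h k *\<^sub>R s t) - g x)"
    and "(\<lambda>k. LINT p|(N \<Otimes>\<^sub>M lborel). norm (case p of (t, x) \<Rightarrow> g (x + h k *\<^sub>R s t) - g x)) \<longlonglongrightarrow> 0"
proof -
  interpret N: finite_measure N by fact
  interpret P: pair_sigma_finite N lborel ..
  have [measurable]: "g \<in> borel_measurable borel" using borel_measurable_integrable[OF g] by simp
  let ?f = "\<lambda>k (t, x). g (x + h k *\<^sub>R s t) - g x"
  have M[measurable]: "?f k \<in> borel_measurable (N \<Otimes>\<^sub>M lborel)" for k by measurable
  have osc: "(LINT x|lborel. norm (?f k (t, x))) = shift_osc g (h k *\<^sub>R s t)" for k t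
    by (simp add: shift_osc_def)
  have Mosc: "(\<lambda>t. shift_osc g (h k *\<^sub>R s t)) \<in> borel_measurable N" for k
    unfolding osc[symmetric] by measurable
  have Iosc: "integrable N (\<lambda>t. shift_osc g (h k *\<^sub>R s t))" for k
    using Mosc shift_osc_bound[OF g] shift_osc_nonneg[of g]
    by (intro N.integrable_const_bound[where B = "2 * (LINT x|lborel. norm (g x))"]) auto
  have I: "integrable (N \<Otimes>\<^sub>M lborel) (?f k)" for k
    by (rule P.Fubini_integrable[OF M])
      (use Iosc g osc in \<open>auto intro!: integrable_lborel_shift\<close>)
  then show "integrable (N \<Otimes>\<^sub>M lborel) (?f k)" .
  have "(LINT p|(N \<Otimes>\<^sub>M lborel). norm (?f k p)) = (LINT t|N. shift_osc g (h k *\<^sub>R s t))" for k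
    using P.integral_fst'[OF integrable_norm[OF I[of k]]] by (simp add: osc split_def shift_osc_def)
  moreover have "(\<lambda>k. LINT t|N. shift_osc g (h k *\<^sub>R s t)) \<longlonglongrightarrow> (LINT t|N. 0)"
  proof (rule integral_dominated_convergence[where w = "\<lambda>_. 2 * (LINT x|lborel. norm (g x))"])
    show "AE t in N. (\<lambda>k. shift_osc g (h k *\<^sub>R s t)) \<longlonglongrightarrow> 0"
    proof (intro AE_I2)
      fix t
      have "(\<lambda>k. h k *\<^sub>R s t) \<longlonglongrightarrow> 0" using tendsto_scaleR[OF h tendsto_const, of "s t"] by simp
      then show "(\<lambda>k. shift_osc g (h k *\<^sub>R s t)) \<longlonglongrightarrow> 0" by (rule shift_osc_tendsto_0[OF g])
    qed
  qed (use Mosc shift_osc_bound[OF g] shift_osc_nonneg[of g] in auto)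
  ultimately show "(\<lambda>k. LINT p|(N \<Otimes>\<^sub>M lborel). norm (?f k p)) \<longlonglongrightarrow> 0" by simp
qed

text \<open>This plays the role of Lebesgue points: the scales are restricted to a
  subsequence, but one and the same subsequence serves almost every point.\<close>

lemma shift_AE_subsequence:
  fixes g :: "'a::euclidean_space \<Rightarrow> 'b::{banach, second_countable_topology}"
  assumes g: "integrable lborel g" and N: "finite_measure N"
    and s[measurable]: "s \<in> borel_measurable N" and h: "h \<longlonglongrightarrow> 0"
  obtains r :: "nat \<Rightarrow> nat" where "strict_mono r"
    "AE x in lborel. AE t in N. (\<lambda>k. g (x + h (r k) *\<^sub>R s t)) \<longlonglongrightarrow> g x"
proof -
  interpret N: finite_measure N by fact
  interpret P: pair_sigma_finite N lborel ..
  interpret Q: pair_sigma_finite lborel N ..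
  let ?f = "\<lambda>k (t, x). g (x + h k *\<^sub>R s t) - g x"
  note A = averaged_shift[OF g N s h]
  have I: "integrable (lborel \<Otimes>\<^sub>M N) (\<lambda>(x, t). ?f k (t, x))" for k
    using P.integrable_product_swap[OF A(1), of k] by simp
  have "(LINT p|(lborel \<Otimes>\<^sub>M N). norm (case p of (x, t) \<Rightarrow> ?f k (t, x)))
     = (LINT p|(N \<Otimes>\<^sub>M lborel). norm (?f k p))" for k
    using P.integral_product_swap[of "\<lambda>p. norm (?f k p)"] borel_measurable_integrable[OF A(1), of k]
    by (simp add: split_def)
  with A(2) have "(\<lambda>k. LINT p|(lborel \<Otimes>\<^sub>M N). norm (case p of (x, t) \<Rightarrow> ?f k (t, x))) \<longlonglongrightarrow> 0"
    by simp
  from tendsto_L1_AE_subseq[OF I this] obtain r where r: "strict_mono r"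
    "AE p in lborel \<Otimes>\<^sub>M N. (\<lambda>k. case p of (x, t) \<Rightarrow> ?f (r k) (t, x)) \<longlonglongrightarrow> 0" by blast
  from Q.AE_pair[OF r(2)]
  have "AE x in lborel. AE t in N. (\<lambda>k. g (x + h (r k) *\<^sub>R s t) - g x) \<longlonglongrightarrow> 0" by simp
  then have "AE x in lborel. AE t in N. (\<lambda>k. g (x + h (r k) *\<^sub>R s t)) \<longlonglongrightarrow> g x"
    by (simp add: LIM_zero_iff)
  with r(1) that show ?thesis by blast
qed

lemma integral_lborel_affine:
  fixes f :: "'a::euclidean_space \<Rightarrow> 'b::{banach, second_countable_topology}"
  assumes [measurable]: "f \<in> borel_measurable borel" and c: "c \<noteq> 0"
  shows "(LINT z|lborel. f z) = \<bar>c\<bar> ^ DIM('a) *\<^sub>R (LINT y|lborel. f (a + c *\<^sub>R y))"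
proof -
  have "(LINT z|lborel. f z)
      = (LINT z|density (distr lborel borel (\<lambda>x. a + c *\<^sub>R x)) (\<lambda>_. ennreal (\<bar>c\<bar> ^ DIM('a))). f z)"
    using lborel_affine[OF c, of a] by (simp add: ennreal_power)
  also have "\<dots> = (LINT z|distr lborel borel (\<lambda>x. a + c *\<^sub>R x). \<bar>c\<bar> ^ DIM('a) *\<^sub>R f z)"
    by (subst integral_density) auto
  also have "\<dots> = (LINT y|lborel. \<bar>c\<bar> ^ DIM('a) *\<^sub>R f (a + c *\<^sub>R y))"
    by (subst integral_distr) auto
  finally show ?thesis by simp
qed

lemma lebesgue_borel_representative:
  fixes f :: "'a::euclidean_space \<Rightarrow> 'b::euclidean_space"
  assumes f: "f \<in> borel_measurable lebesgue"
  obtains f' where "f' \<in> borel_measurable borel" "AE x in lborel. f x = f' x"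
proof -
  have "\<exists>g\<in>borel_measurable lborel. AE x in lborel. f x \<bullet> b = g x" for b
    using f by (intro completion_ex_borel_measurable_real) auto
  then obtain g where g: "\<And>b. g b \<in> borel_measurable lborel" "\<And>b. AE x in lborel. f x \<bullet> b = g b x"
    by metis
  have "AE x in lborel. \<forall>b\<in>Basis. f x \<bullet> b = g b x"
    using g(2) by (subst AE_ball_countable) (auto simp: countable_finite)
  then have "AE x in lborel. f x = (\<Sum>b\<in>Basis. g b x *\<^sub>R b)"
    by eventually_elim (metis (no_types, lifting) euclidean_representation sum.cong)
  moreover have "(\<lambda>x. \<Sum>b\<in>Basis. g b x *\<^sub>R b) \<in> borel_measurable borel"
    using g(1) by (auto intro!: borel_measurable_sum borel_measurable_scaleR)
  ultimately show ?thesis using that by blast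
qed

text \<open>Averaging the translates over a probability measure contracts the $L^1$ distance.\<close>

lemma average_shift_L1:
  fixes g :: "'a::euclidean_space \<Rightarrow> 'b::{banach, second_countable_topology}"
  assumes g: "integrable lborel g" and N: "prob_space N"
    and s[measurable]: "s \<in> borel_measurable N" and h: "h \<longlonglongrightarrow> 0"
  shows "integrable lborel (\<lambda>x. LINT t|N. g (x + h k *\<^sub>R s t))" (is "?I k")
    and "(\<lambda>k. LINT x|lborel. norm ((LINT t|N. g (x + h k *\<^sub>R s t)) - g x)) \<longlonglongrightarrow> 0" (is ?L)
proof -
  interpret N: prob_space N by fact
  interpret P: pair_sigma_finite N lborel ..
  have fN: "finite_measure N" by unfold_locales
  note A = averaged_shift[OF g fN s h]
  have [measurable]: "g \<in> borel_measurable borel" using borel_measurable_integrable[OF g] by simp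
  \<comment> \<open>The integral may be split at those points where the difference is integrable in \<open>t\<close>.\<close>
  have eq: "AE x in lborel. (LINT t|N. g (x + h k *\<^sub>R s t) - g x) = (LINT t|N. g (x + h k *\<^sub>R s t)) - g x" for k
    using P.AE_integrable_snd[OF A(1)[of k]]
  proof eventually_elim
    case (elim x)
    have "integrable N (\<lambda>t. (g (x + h k *\<^sub>R s t) - g x) + g x)"
      by (intro Bochner_Integration.integrable_add elim) simp
    then show ?case by (subst Bochner_Integration.integral_diff) (auto simp: N.prob_space)
  qed
  have M: "(\<lambda>x. LINT t|N. g (x + h k *\<^sub>R s t)) \<in> borel_measurable lborel" for k by measurable
  have I': "integrable lborel (\<lambda>x. (LINT t|N. g (x + h k *\<^sub>R s t)) - g x)" for k
    using P.integrable_snd[OF A(1)[of k]] eq[of k] M[of k]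
    by (subst integrable_cong_AE[OF _ _ AE_symmetric[OF eq]]) (auto intro!: borel_measurable_integrable simp: )
  show I: "?I k" for k
    using Bochner_Integration.integrable_add[OF I'[of k] g] by simp
  show ?L
  proof (rule Lim_null_comparison[OF always_eventually A(2)], intro allI)
    fix k
    have In: "integrable (N \<Otimes>\<^sub>M lborel) (\<lambda>(t, x). norm (g (x + h k *\<^sub>R s t) - g x))"
      using integrable_norm[OF A(1)[of k]] by (simp add: split_def)
    have "(LINT x|lborel. norm ((LINT t|N. g (x + h k *\<^sub>R s t)) - g x))
        = (LINT x|lborel. norm (LINT t|N. g (x + h k *\<^sub>R s t) - g x))"
      using eq[of k] by (intro integral_cong_AE) auto
    also have "\<dots> \<le> (LINT x|lborel. LINT t|N. norm (g (x + h k *\<^sub>R s t) - g x))"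
      using P.integrable_snd[OF A(1)[of k]] P.integrable_snd[OF In]
      by (intro integral_mono) auto
    also have "\<dots> = (LINT p|(N \<Otimes>\<^sub>M lborel). norm (case p of (t, x) \<Rightarrow> g (x + h k *\<^sub>R s t) - g x))"
      using P.integral_snd[OF In] by (simp add: split_def)
    finally show "norm (LINT x|lborel. norm ((LINT t|N. g (x + h k *\<^sub>R s t)) - g x)) \<le> \<dots>"
      by simp
  qed
qed

lemma average_shift_AE_subsequence:
  fixes g :: "'a::euclidean_space \<Rightarrow> 'b::{banach, second_countable_topology}"
  assumes g: "integrable lborel g" and N: "prob_space N"
    and s: "s \<in> borel_measurable N" and h: "h \<longlonglongrightarrow> 0"
  obtains r :: "nat \<Rightarrow> nat" where "strict_mono r"
    "AE x in lborel. (\<lambda>k. LINT t|N. g (x + h (r k) *\<^sub>R s t)) \<longlonglongrightarrow> g x"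
proof -
  note A = average_shift_L1[where g = g and N = N and s = s and h = h, OF g N s h]
  obtain r where r: "strict_mono r"
    "AE x in lborel. (\<lambda>k. (LINT t|N. g (x + h (r k) *\<^sub>R s t)) - g x) \<longlonglongrightarrow> 0"
    using tendsto_L1_AE_subseq[OF Bochner_Integration.integrable_diff[OF A(1) g] A(2)] by blast
  with that show ?thesis by (simp add: LIM_zero_iff)
qed

section \<open>Mollification\<close>

lemma integrable_bump: "integrable lborel (bump :: 'a::euclidean_space \<Rightarrow> real)"
proof (rule integrable_continuous_compact_support[where K = "cball 0 1"])
  have "test_function UNIV (bump :: 'a \<Rightarrow> real)" by (rule test_function_bump) simp
  then show "continuous_on UNIV (bump :: 'a \<Rightarrow> real)" by (rule test_function_continuous)
  show "bump x = 0" if "x \<notin> cball 0 1" for x :: 'a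
    using that bump_pos_iff[of x] bump_nonneg[of x] by auto
qed simp

text \<open>If the integral vanished, the open unit ball, where the bump is positive, would be a null set.\<close>

lemma bump_mass_pos: "(LINT x|lborel. bump (x :: 'a::euclidean_space)) > 0"
proof -
  have "(LINT x|lborel. bump (x :: 'a)) \<noteq> 0"
  proof
    assume "(LINT x|lborel. bump (x :: 'a)) = 0"
    then have "AE x in lborel. bump (x :: 'a) = 0"
      by (subst (asm) integral_nonneg_eq_0_iff_AE[OF integrable_bump]) (auto simp: bump_nonneg)
    then have "emeasure lborel {x :: 'a. bump x \<noteq> 0} = 0"
      by (subst (asm) AE_iff_measurable[OF _ refl]) (auto simp: bump_support)
    then show False
      using unit_ball_vol_pos[of "real DIM('a)"] by (simp add: bump_support emeasure_ball)
  qed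
  moreover have "(LINT x|lborel. bump (x :: 'a)) \<ge> 0" by (simp add: bump_nonneg)
  ultimately show ?thesis by simp
qed

text \<open>The bump function, normalised to have integral \<open>1\<close>.\<close>

definition mollifier :: "'a::euclidean_space \<Rightarrow> real" where
  "mollifier x = bump x / (LINT z::'a|lborel. bump z)"

lemma mollifier_nonneg: "mollifier x \<ge> 0"
  using bump_mass_pos[where 'a = 'a] by (simp add: mollifier_def bump_nonneg)

lemma mollifier_zero: "norm x \<ge> 1 \<Longrightarrow> mollifier x = 0"
  using bump_pos_iff[of x] bump_nonneg[of x] by (simp add: mollifier_def)

lemma test_function_mollifier:
  assumes "cball 0 1 \<subseteq> W"
  shows "test_function W (mollifier :: 'a::euclidean_space \<Rightarrow> real)"
proof -
  have "{x::'a. mollifier x \<noteq> 0} = ball 0 1"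
    using bump_mass_pos[where 'a = 'a] by (simp add: mollifier_def bump_support)
  moreover have "bump_algebra (mollifier :: 'a \<Rightarrow> real)"
  proof -
    define c where "c = 1 / (LINT z::'a|lborel. bump z)"
    have "mollifier x = c * flat_exp 0 (1 - x \<bullet> x)" for x :: 'a
      by (simp add: mollifier_def c_def bump_def[of x])
    then have "mollifier = (\<lambda>x::'a. c * flat_exp 0 (1 - x \<bullet> x))" by blast
    moreover have "bump_algebra (\<lambda>x::'a. c * flat_exp 0 (1 - x \<bullet> x))"
      by (intro bump_algebra.mult bump_algebra.const bump_algebra.flat)
    ultimately show ?thesis by simp
  qed
  ultimately show ?thesis
    using assms by (auto simp: test_function_def intro!: bump_algebra_Ck)
qed

lemma mollifier_continuous: "continuous_on UNIV (mollifier :: 'a::euclidean_space \<Rightarrow> real)"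
  by (rule test_function_continuous[OF test_function_mollifier[OF subset_UNIV]])

lemma mollifier_measurable [measurable]: "mollifier \<in> borel_measurable borel"
  by (rule borel_measurable_continuous_onI[OF mollifier_continuous])

text \<open>The support of the mollifier is the unit ball, so \<open>mollify h f x\<close> only depends on the values
  of \<open>f\<close> within distance \<open>h\<close> of \<open>x\<close>.\<close>

definition mollify ::
  "real \<Rightarrow> ('a::euclidean_space \<Rightarrow> 'b::{banach, second_countable_topology}) \<Rightarrow> 'a \<Rightarrow> 'b" where
  "mollify h f x = (LINT s|lborel. mollifier s *\<^sub>R f (x + h *\<^sub>R s))"

definition mollifier_measure :: "'a::euclidean_space measure" where
  "mollifier_measure = density lborel mollifier"

lemma prob_space_mollifier_measure: "prob_space (mollifier_measure :: 'a::euclidean_space measure)"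
proof
  have "(\<integral>\<^sup>+x. ennreal (mollifier (x :: 'a)) \<partial>lborel) = ennreal (LINT x::'a|lborel. mollifier x)"
    using integrable_bump[where 'a = 'a]
    by (intro nn_integral_eq_integral) (auto simp: mollifier_nonneg mollifier_def[abs_def] bump_nonneg)
  also have "(LINT x::'a|lborel. mollifier x) = 1"
    using bump_mass_pos[where 'a = 'a] by (simp add: mollifier_def)
  finally show "emeasure (mollifier_measure :: 'a measure) (space mollifier_measure) = 1"
    by (simp add: mollifier_measure_def emeasure_density)
qed

lemma mollify_eq_average:
  assumes "f \<in> borel_measurable borel"
  shows "mollify h f x = (LINT s|mollifier_measure. f (x + h *\<^sub>R s))"
  unfolding mollify_def mollifier_measure_def
  using assms by (subst integral_density) (auto simp: mollifier_nonneg)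

lemma mollify_L1:
  assumes f: "integrable lborel f" and h: "h \<longlonglongrightarrow> 0"
  shows "integrable lborel (mollify (h k) f)"
    and "(\<lambda>k. LINT x|lborel. norm (mollify (h k) f x - f x)) \<longlonglongrightarrow> 0"
proof -
  have "f \<in> borel_measurable borel" using borel_measurable_integrable[OF f] by simp
  note * = mollify_eq_average[OF this]
  note A = average_shift_L1[where N = mollifier_measure and g = f and h = h and s = "\<lambda>s. s",
      OF f prob_space_mollifier_measure _ h]
  show "integrable lborel (mollify (h k) f)"
    using A(1)[of k] by (simp add: *[abs_def] mollifier_measure_def)
  show "(\<lambda>k. LINT x|lborel. norm (mollify (h k) f x - f x)) \<longlonglongrightarrow> 0"
    using A(2) by (simp add: * mollifier_measure_def)
qed

text \<open>In this form the variable \<open>x\<close> enters only through a smooth kernel, which gives continuity of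
  the mollification, and which is a test function in \<open>z\<close> when \<open>x\<close> and \<open>h\<close> are fixed.\<close>

lemma mollify_kernel:
  fixes f :: "'a::euclidean_space \<Rightarrow> 'b::{banach, second_countable_topology}"
  assumes [measurable]: "f \<in> borel_measurable borel" and h: "h > 0"
  shows "mollify h f x = (1 / h ^ DIM('a)) *\<^sub>R (LINT z|lborel. mollifier (- (1 / h) *\<^sub>R x + (1 / h) *\<^sub>R z) *\<^sub>R f z)"
  using h by (subst integral_lborel_affine[where a = x and c = h]) (auto simp: mollify_def algebra_simps)

lemma mollify_continuous:
  fixes f :: "'a::euclidean_space \<Rightarrow> 'b::{banach, second_countable_topology}"
  assumes f: "integrable lborel f" and h: "h > 0"
  shows "continuous_on UNIV (mollify h f)"
proof -
  have [measurable]: "f \<in> borel_measurable borel" using borel_measurable_integrable[OF f] by simp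
  obtain B where B: "B \<ge> 0" "\<And>x::'a. norm (mollifier x) \<le> B"
    by (rule bounded_continuous_compact_support[OF mollifier_continuous[where 'a='a] compact_cball[of 0 1]])
      (auto simp: mollifier_zero)
  let ?K = "\<lambda>x z. mollifier (- (1 / h) *\<^sub>R x + (1 / h) *\<^sub>R z) *\<^sub>R f z"
  have "(\<lambda>k. LINT z|lborel. ?K (u k) z) \<longlonglongrightarrow> (LINT z|lborel. ?K x z)" if u: "u \<longlonglongrightarrow> x" for u x
  proof (rule integral_dominated_convergence[where w = "\<lambda>z. B * norm (f z)"])
    show "AE z in lborel. (\<lambda>k. ?K (u k) z) \<longlonglongrightarrow> ?K x z"
    proof (intro AE_I2 tendsto_scaleR tendsto_const)
      fix z
      show "(\<lambda>k. mollifier (- (1 / h) *\<^sub>R u k + (1 / h) *\<^sub>R z)) \<longlonglongrightarrow> mollifier (- (1 / h) *\<^sub>R x + (1 / h) *\<^sub>R z)"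
        by (rule continuous_on_tendsto_compose[OF mollifier_continuous]) (auto intro!: tendsto_intros u)
    qed
    show "AE z in lborel. norm (?K (u k) z) \<le> B * norm (f z)" for k
      using B by (auto intro!: mult_right_mono)
  qed (use f in auto)
  then have "(\<lambda>k. mollify h f (u k)) \<longlonglongrightarrow> mollify h f x" if "u \<longlonglongrightarrow> x" for u x
    unfolding mollify_kernel[OF \<open>f \<in> borel_measurable borel\<close> h] using that
    by (intro tendsto_scaleR tendsto_const) auto
  then show ?thesis
    by (auto simp: continuous_on_eq_continuous_at continuous_at_sequentially o_def)
qed

section \<open>The fundamental lemma for integrable functions\<close>

text \<open>Near a point of \<open>W\<close> the mollifications of \<open>g\<close> are integrals against test functions
  supported in \<open>W\<close>, hence \<open>0\<close>; along a subsequence they converge to \<open>g\<close> almost everywhere.\<close>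

lemma fundamental_lemma_integrable:
  fixes g :: "'a::euclidean_space \<Rightarrow> real"
  assumes g: "integrable lborel g" and W: "open W"
    and zero: "\<And>\<eta>. test_function W \<eta> \<Longrightarrow> (LINT x|lborel. \<eta> x * g x) = 0"
  shows "AE x in lborel. x \<in> W \<longrightarrow> g x = 0"
proof -
  have [measurable]: "g \<in> borel_measurable borel" using borel_measurable_integrable[OF g] by simp
  define h where "h k = inverse (real (Suc k))" for k
  have h: "h \<longlonglongrightarrow> 0" "\<And>k. h k > 0" using LIMSEQ_inverse_real_of_nat by (auto simp: h_def[abs_def])
  obtain r where r: "strict_mono r" "AE x in lborel. (\<lambda>k. mollify (h (r k)) g x) \<longlonglongrightarrow> g x"
    using average_shift_AE_subsequence[OF g prob_space_mollifier_measure _ h(1), of "\<lambda>s. s"]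
    by (auto simp: mollify_eq_average mollifier_measure_def)
  from r(2) show ?thesis
  proof eventually_elim
    case (elim x)
    show ?case
    proof
      assume "x \<in> W"
      with W obtain \<delta> where \<delta>: "\<delta> > 0" "cball x \<delta> \<subseteq> W" by (auto simp: open_contains_cball)
      have "(\<lambda>k. h (r k)) \<longlonglongrightarrow> 0"
        using LIMSEQ_subseq_LIMSEQ[OF h(1) r(1)] by (simp add: o_def)
      from order_tendstoD(2)[OF this \<delta>(1)]
      have "eventually (\<lambda>k. 0 = mollify (h (r k)) g x) sequentially"
      proof eventually_elim
        case (elim k)
        let ?h = "h (r k)"
        have "test_function W (\<lambda>z. mollifier (- (1 / ?h) *\<^sub>R x + (1 / ?h) *\<^sub>R z))"
        proof (rule test_function_affine[OF test_function_mollifier[OF subset_refl]])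
          fix z assume "- (1 / ?h) *\<^sub>R x + (1 / ?h) *\<^sub>R z \<in> cball 0 1"
          moreover have "- (1 / ?h) *\<^sub>R x + (1 / ?h) *\<^sub>R z = (1 / ?h) *\<^sub>R (z - x)"
            by (simp add: algebra_simps)
          ultimately have "norm (z - x) \<le> ?h"
            using h(2)[of "r k"] by (simp add: divide_simps)
          then show "z \<in> W" using elim \<delta>(2) by (auto simp: dist_norm norm_minus_commute)
        qed (use h(2)[of "r k"] in auto)
        from zero[OF this] show ?case
          by (simp add: mollify_kernel h(2))
      qed
      from Lim_transform_eventually[OF tendsto_const this] elim show "g x = 0"
        by (metis LIMSEQ_unique)
    qed
  qed
qed

section \<open>Calculus of test functions\<close>

lemma integrable_bounded_mult:
  fixes u f :: "'a::euclidean_space \<Rightarrow> real"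
  assumes f: "integrable lborel f" and u: "u \<in> borel_measurable borel" "\<And>x. \<bar>u x\<bar> \<le> B"
  shows "integrable lborel (\<lambda>x. u x * f x)"
proof (rule Bochner_Integration.integrable_bound)
  show "integrable lborel (\<lambda>x. B * f x)" using f by simp
  show "AE x in lborel. norm (u x * f x) \<le> norm (B * f x)"
  proof (intro AE_I2)
    fix x
    show "norm (u x * f x) \<le> norm (B * f x)"
      using u(2)[of x] unfolding norm_mult by (intro mult_right_mono) auto
  qed
qed (use u f in auto)

lemma test_function_integrable:
  assumes "test_function W \<eta>"
  shows "integrable lborel \<eta>"
proof -
  obtain K where "compact K" "\<And>x. x \<notin> K \<Longrightarrow> \<eta> x = 0"
    by (rule test_function_compact_support[OF assms]) blast
  then show ?thesis by (rule integrable_continuous_compact_support[OF test_function_continuous[OF assms]])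
qed

lemma test_function_bound:
  assumes "test_function W \<eta>"
  obtains B where "B \<ge> 0" "\<And>x. norm (\<eta> x) \<le> B"
proof -
  obtain K where K: "compact K" "\<And>x. x \<notin> K \<Longrightarrow> \<eta> x = 0"
    by (rule test_function_compact_support[OF assms]) blast
  show ?thesis
    by (rule bounded_continuous_compact_support[OF test_function_continuous[OF assms] K]) (auto intro: that)
qed

lemma test_function_derivative_bound:
  assumes "test_function W \<eta>"
  obtains B where "B \<ge> 0" "\<And>x. norm (frechet_derivative \<eta> (at x) v) \<le> B"
proof -
  obtain K where K: "compact K" "\<And>x v. x \<notin> K \<Longrightarrow> frechet_derivative \<eta> (at x) v = 0"
    by (rule test_function_compact_support[OF assms]) blast
  show ?thesis
    by (rule bounded_continuous_compact_support[OF test_function_continuous_derivative[OF assms] K])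
      (auto intro: that)
qed

lemma test_function_support_cball:
  assumes "test_function W \<eta>"
  obtains R where "R > 0" "\<And>x. norm x > R \<Longrightarrow> \<eta> x = 0"
    "\<And>x v. norm x > R \<Longrightarrow> frechet_derivative \<eta> (at x) v = 0"
proof -
  obtain K where K: "compact K" "\<And>x. x \<notin> K \<Longrightarrow> \<eta> x = 0"
    "\<And>x v. x \<notin> K \<Longrightarrow> frechet_derivative \<eta> (at x) v = 0"
    by (rule test_function_compact_support[OF assms]) blast
  obtain R where R: "R > 0" "\<And>x. x \<in> K \<Longrightarrow> norm x \<le> R"
    using compact_imp_bounded[OF K(1)] by (auto simp: bounded_pos)
  then have "x \<notin> K" if "norm x > R" for x using that by force
  with K R(1) that show ?thesis by metis
qed

lemma test_function_measurable:
  "test_function W \<eta> \<Longrightarrow> \<eta> \<in> borel_measurable borel"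
  "test_function W \<eta> \<Longrightarrow> (\<lambda>x. frechet_derivative \<eta> (at x) v) \<in> borel_measurable borel"
  by (auto intro: borel_measurable_continuous_onI test_function_continuous test_function_continuous_derivative)

lemma linear_bound_Basis:
  fixes D :: "'a::euclidean_space \<Rightarrow> 'b::real_normed_vector"
  assumes "linear D" "\<And>b. b \<in> Basis \<Longrightarrow> norm (D b) \<le> B b"
  shows "norm (D y) \<le> (\<Sum>b\<in>Basis. B b) * norm y"
proof -
  have "D y = D (\<Sum>b\<in>Basis. (y \<bullet> b) *\<^sub>R b)" by (simp add: euclidean_representation)
  also have "\<dots> = (\<Sum>b\<in>Basis. (y \<bullet> b) *\<^sub>R D b)"
    using assms(1) by (simp add: linear_sum linear_cmul)
  also have "norm \<dots> \<le> (\<Sum>b\<in>Basis. B b * norm y)"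
  proof (rule sum_norm_le)
    fix b :: 'a assume b: "b \<in> Basis"
    have "norm ((y \<bullet> b) *\<^sub>R D b) \<le> norm y * B b"
      unfolding norm_scaleR by (intro mult_mono Basis_le_norm b assms) auto
    then show "norm ((y \<bullet> b) *\<^sub>R D b) \<le> B b * norm y" by (simp add: mult.commute)
  qed
  finally show ?thesis by (simp add: sum_distrib_right)
qed

lemma test_function_lipschitz:
  assumes \<eta>: "test_function W \<eta>"
  obtains L where "L \<ge> 0" "\<And>x y. norm (\<eta> x - \<eta> y) \<le> L * norm (x - y)"
proof -
  have "\<exists>B\<ge>0. \<forall>x. norm (frechet_derivative \<eta> (at x) b) \<le> B" for b
    by (rule test_function_derivative_bound[OF \<eta>, of b]) blast
  then obtain B where B: "\<And>b. B b \<ge> 0" "\<And>b x. norm (frechet_derivative \<eta> (at x) b) \<le> B b" by metis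
  note D = test_function_has_derivative[OF \<eta>]
  have "norm (\<eta> x - \<eta> y) \<le> (\<Sum>b\<in>Basis. B b) * norm (x - y)" for x y
  proof (rule differentiable_bound[OF convex_UNIV])
    show "(\<eta> has_derivative frechet_derivative \<eta> (at x)) (at x within UNIV)" for x
      using D by simp
    show "onorm (frechet_derivative \<eta> (at x)) \<le> (\<Sum>b\<in>Basis. B b)" for x
      by (intro onorm_le linear_bound_Basis has_derivative_linear[OF D] B)
  qed auto
  moreover have "(\<Sum>b\<in>Basis. B b) \<ge> 0" by (intro sum_nonneg B)
  ultimately show ?thesis using that by blast
qed

lemma test_function_affine_derivative:
  assumes "test_function W \<eta>"
  shows "frechet_derivative (\<lambda>y. \<eta> (a + c *\<^sub>R y)) (at x) v
    = c *\<^sub>R frechet_derivative \<eta> (at (a + c *\<^sub>R x)) v"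
proof -
  note D = test_function_has_derivative[OF assms]
  have "((\<lambda>y. \<eta> (a + c *\<^sub>R y)) has_derivative
      (\<lambda>v. frechet_derivative \<eta> (at (a + c *\<^sub>R x)) (c *\<^sub>R v))) (at x)"
    by (rule has_derivative_compose[OF _ D]) (auto intro!: derivative_eq_intros)
  from frechet_derivative_at[OF this, symmetric] show ?thesis
    by (simp add: linear_cmul[OF has_derivative_linear[OF D]])
qed

text \<open>The directions \<open>q k\<close> may vary. This is what the chain rule needs, where the increments
  of the inner function are \<open>h k *\<^sub>R q k\<close> with merely convergent difference quotients \<open>q k\<close>.\<close>

lemma has_derivative_sequentially:
  fixes f :: "'a::real_normed_vector \<Rightarrow> 'b::real_normed_vector"
  assumes f: "(f has_derivative D) (at x)" and h: "h \<longlonglongrightarrow> 0" "\<And>k. h k \<noteq> 0" and q: "q \<longlonglongrightarrow> q0"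
  shows "(\<lambda>k. (1 / h k) *\<^sub>R (f (x + h k *\<^sub>R q k) - f x)) \<longlonglongrightarrow> D q0"
proof -
  interpret D: bounded_linear D by (rule has_derivative_bounded_linear[OF f])
  define E where "E y = norm (f (x + y) - f x - D y) / norm y" for y
  have "(E \<longlongrightarrow> E 0) (at 0)"
    using f by (simp add: has_derivative_at E_def[abs_def])
  then have "isCont E 0" by (simp add: isCont_def)
  moreover have y: "(\<lambda>k. h k *\<^sub>R q k) \<longlonglongrightarrow> 0" using tendsto_scaleR[OF h(1) q] by simp
  ultimately have "(\<lambda>k. E (h k *\<^sub>R q k)) \<longlonglongrightarrow> E 0" by (rule isCont_tendsto_compose)
  moreover have "E 0 = 0" by (simp add: E_def)
  ultimately have A: "(\<lambda>k. E (h k *\<^sub>R q k) * norm (q k)) \<longlonglongrightarrow> 0"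
    using tendsto_mult[OF _ tendsto_norm[OF q]] by fastforce
  have B: "norm ((1 / h k) *\<^sub>R (f (x + h k *\<^sub>R q k) - f x) - D (q k)) = E (h k *\<^sub>R q k) * norm (q k)" for k
  proof (cases "q k = 0")
    case False
    have "(1 / h k) *\<^sub>R (f (x + h k *\<^sub>R q k) - f x) - D (q k)
        = (1 / h k) *\<^sub>R (f (x + h k *\<^sub>R q k) - f x - D (h k *\<^sub>R q k))"
      using h(2)[of k] by (simp add: D.scaleR scaleR_diff_right)
    then show ?thesis using False h(2)[of k] by (simp add: E_def)
  qed (simp add: E_def D.zero)
  have "(\<lambda>k. (1 / h k) *\<^sub>R (f (x + h k *\<^sub>R q k) - f x) - D (q k)) \<longlonglongrightarrow> 0"
    by (rule tendsto_norm_zero_cancel, unfold B, rule A)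
  from tendsto_add[OF this D.tendsto[OF q]] show ?thesis by simp
qed

section \<open>Weak directional derivatives\<close>

text \<open>The scalar and directional form of \<open>has_weak_grad\<close>, on all of the space and with respect to
  \<open>lborel\<close>. It is used for bounded Borel functions, for which all integrals exist.\<close>

definition weak_deriv ::
  "'a::euclidean_space set \<Rightarrow> 'a \<Rightarrow> ('a \<Rightarrow> real) \<Rightarrow> ('a \<Rightarrow> real) \<Rightarrow> bool" where
  "weak_deriv W v u g \<longleftrightarrow> (\<forall>\<eta>. test_function W \<eta> \<longrightarrow>
     (LINT x|lborel. u x * frechet_derivative \<eta> (at x) v) = - (LINT x|lborel. g x * \<eta> x))"

text \<open>The sequence of increments may depend on the set \<open>K\<close>. A bound is included because limits of the
  quotients are taken under integrals.\<close>

definition quotients_converge ::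
  "'a::euclidean_space set \<Rightarrow> 'a \<Rightarrow> ('a \<Rightarrow> 'b::real_normed_vector) \<Rightarrow> ('a \<Rightarrow> 'b) \<Rightarrow> bool" where
  "quotients_converge K v u g \<longleftrightarrow> (\<exists>h L. h \<longlonglongrightarrow> 0 \<and> (\<forall>k. h k \<noteq> 0) \<and>
     (AE x in lborel. x \<in> K \<longrightarrow> (\<lambda>k. (1 / h k) *\<^sub>R (u (x + h k *\<^sub>R v) - u x)) \<longlonglongrightarrow> g x) \<and>
     (\<forall>k. AE x in lborel. x \<in> K \<longrightarrow> norm ((1 / h k) *\<^sub>R (u (x + h k *\<^sub>R v) - u x)) \<le> L))"

text \<open>A translation moves the difference quotient from \<open>u\<close> to the test function. Both sides
  then converge by dominated convergence. Only points of the support of the test function matter.\<close>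

lemma weak_deriv_from_difference_quotients:
  fixes u g :: "'a::euclidean_space \<Rightarrow> real"
  assumes u[measurable]: "u \<in> borel_measurable borel" and ub: "\<And>x. \<bar>u x\<bar> \<le> B"
    and g[measurable]: "g \<in> borel_measurable borel"
    and quotients: "\<And>K. compact K \<Longrightarrow> K \<subseteq> W \<Longrightarrow> quotients_converge K v u g"
  shows "weak_deriv W v u g"
  unfolding weak_deriv_def
proof (intro allI impI)
  fix \<eta> :: "'a \<Rightarrow> real" assume \<eta>: "test_function W \<eta>"
  obtain K where K: "compact K" "K \<subseteq> W" "\<And>x. x \<notin> K \<Longrightarrow> \<eta> x = 0"
    by (rule test_function_compact_support[OF \<eta>]) blast
  from quotients[OF K(1,2)] obtain h C where h: "h \<longlonglongrightarrow> 0" "\<And>k. h k \<noteq> (0::real)"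
    and lim: "AE x in lborel. x \<in> K \<longrightarrow> (\<lambda>k. (u (x + h k *\<^sub>R v) - u x) / h k) \<longlonglongrightarrow> g x"
    and bd: "\<And>k. AE x in lborel. x \<in> K \<longrightarrow> \<bar>(u (x + h k *\<^sub>R v) - u x) / h k\<bar> \<le> C"
    unfolding quotients_converge_def real_norm_def real_scaleR_def times_divide_eq_left mult_1_left by blast
  note [measurable] = test_function_measurable[OF \<eta>]
  note I\<eta> = test_function_integrable[OF \<eta>]
  obtain R where R: "R > 0" "\<And>x. norm x > R \<Longrightarrow> \<eta> x = 0" by (rule test_function_support_cball[OF \<eta>]) blast
  obtain L where L: "L \<ge> 0" "\<And>x y. norm (\<eta> x - \<eta> y) \<le> L * norm (x - y)"
    by (rule test_function_lipschitz[OF \<eta>]) blast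
  obtain H where H: "H > 0" "\<And>k. norm (h k) \<le> H"
    using convergent_imp_Bseq[of h] h(1) by (auto simp: convergent_def Bseq_def)
  have B0: "B \<ge> 0" using ub[of 0] by linarith
  have "(\<lambda>k. LINT x|lborel. (u (x + h k *\<^sub>R v) - u x) / h k * \<eta> x) \<longlonglongrightarrow> (LINT x|lborel. g x * \<eta> x)"
  proof (rule integral_dominated_convergence[where w = "\<lambda>x. C * \<bar>\<eta> x\<bar>"])
    show "AE x in lborel. (\<lambda>k. (u (x + h k *\<^sub>R v) - u x) / h k * \<eta> x) \<longlonglongrightarrow> g x * \<eta> x"
      using lim
    proof eventually_elim
      case (elim x)
      show ?case
      proof (cases "x \<in> K")
        case True
        show ?thesis by (rule tendsto_mult[OF elim[rule_format, OF True] tendsto_const])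
      qed (use K(3)[of x] in simp)
    qed
    show "AE x in lborel. norm ((u (x + h k *\<^sub>R v) - u x) / h k * \<eta> x) \<le> C * \<bar>\<eta> x\<bar>" for k
      using bd[of k]
    proof eventually_elim
      case (elim x)
      show ?case
      proof (cases "x \<in> K")
        case True
        from mult_right_mono[OF elim[rule_format, OF True] abs_ge_zero[of "\<eta> x"]] show ?thesis
          unfolding norm_mult by simp
      qed (use K(3)[of x] in simp)
    qed
  qed (use I\<eta> in auto)
  moreover have "(\<lambda>k. LINT x|lborel. u x * ((\<eta> (x + h k *\<^sub>R (- v)) - \<eta> x) / h k))
      \<longlonglongrightarrow> (LINT x|lborel. u x * frechet_derivative \<eta> (at x) (- v))"
  proof (rule integral_dominated_convergence[where w = "\<lambda>x. B * (L * norm v) * indicator (cball 0 (R + H * norm v)) x"])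
    show "AE x in lborel. (\<lambda>k. u x * ((\<eta> (x + h k *\<^sub>R (- v)) - \<eta> x) / h k)) \<longlonglongrightarrow> u x * frechet_derivative \<eta> (at x) (- v)"
      using has_derivative_sequentially[OF test_function_has_derivative[OF \<eta>] h tendsto_const[of "- v"]]
      by (intro AE_I2 tendsto_mult tendsto_const) (simp add: field_simps)
    show "AE x in lborel. norm (u x * ((\<eta> (x + h k *\<^sub>R (- v)) - \<eta> x) / h k))
        \<le> B * (L * norm v) * indicator (cball 0 (R + H * norm v)) x" for k
    proof (intro AE_I2)
      fix x
      show "norm (u x * ((\<eta> (x + h k *\<^sub>R (- v)) - \<eta> x) / h k)) \<le> B * (L * norm v) * indicator (cball 0 (R + H * norm v)) x"
      proof (cases "norm x \<le> R + H * norm v")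
        case True
        have "norm (\<eta> (x + h k *\<^sub>R (- v)) - \<eta> x) \<le> L * norm v * \<bar>h k\<bar>"
          using L(2)[of "x + h k *\<^sub>R (- v)" x] by (simp add: algebra_simps)
        then have "norm ((\<eta> (x + h k *\<^sub>R (- v)) - \<eta> x) / h k) \<le> L * norm v"
          using h(2)[of k] by (simp add: divide_simps)
        from mult_mono[OF ub[of x] this B0] show ?thesis
          using True unfolding norm_mult by simp
      next
        case False
        have "norm (h k *\<^sub>R v) \<le> H * norm v" using H(2)[of k] by (auto intro: mult_right_mono)
        moreover have "norm x \<le> norm (x + h k *\<^sub>R (- v)) + norm (h k *\<^sub>R v)"
          using norm_triangle_ineq[of "x + h k *\<^sub>R (- v)" "h k *\<^sub>R v"] by simp
        ultimately have "norm (x + h k *\<^sub>R (- v)) > R" using False by linarith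
        moreover have "norm x > R" using False mult_nonneg_nonneg[OF less_imp_le[OF H(1)] norm_ge_zero[of v]] by linarith
        ultimately show ?thesis using R(2) False by simp
      qed
    qed
  qed (use emeasure_bounded_finite[OF bounded_cball[of 0 "R + H * norm v"]] in auto)
  moreover have "(LINT x|lborel. (u (x + h k *\<^sub>R v) - u x) / h k * \<eta> x)
      = (LINT x|lborel. u x * ((\<eta> (x + h k *\<^sub>R (- v)) - \<eta> x) / h k))" for k
  proof -
    have I1: "integrable lborel (\<lambda>x. u (x + h k *\<^sub>R v) * \<eta> x)" "integrable lborel (\<lambda>x. u x * \<eta> x)"
      by (rule integrable_bounded_mult[OF I\<eta>, where B = B]; simp add: ub)+
    have I2: "integrable lborel (\<lambda>x. u x * \<eta> (x + h k *\<^sub>R (- v)))"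
      by (rule integrable_bounded_mult[OF integrable_lborel_shift[OF I\<eta>] u ub])
    have "(LINT x|lborel. (u (x + h k *\<^sub>R v) - u x) / h k * \<eta> x)
        = ((LINT x|lborel. u (x + h k *\<^sub>R v) * \<eta> x) - (LINT x|lborel. u x * \<eta> x)) / h k"
      using I1 by (simp add: left_diff_distrib)
    also have "(LINT x|lborel. u (x + h k *\<^sub>R v) * \<eta> x) = (LINT x|lborel. u x * \<eta> (x + h k *\<^sub>R (- v)))"
      using integral_lborel_shift[of "\<lambda>x. u x * \<eta> (x + h k *\<^sub>R (- v))" "h k *\<^sub>R v"] by simp
    also have "((LINT x|lborel. u x * \<eta> (x + h k *\<^sub>R (- v))) - (LINT x|lborel. u x * \<eta> x)) / h k
        = (LINT x|lborel. u x * ((\<eta> (x + h k *\<^sub>R (- v)) - \<eta> x) / h k))"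
      using I1 I2 by (simp add: right_diff_distrib)
    finally show ?thesis .
  qed
  ultimately have "(LINT x|lborel. g x * \<eta> x) = (LINT x|lborel. u x * frechet_derivative \<eta> (at x) (- v))"
    by (metis (no_types, lifting) LIMSEQ_unique ext)
  then show "(LINT x|lborel. u x * frechet_derivative \<eta> (at x) v) = - (LINT x|lborel. g x * \<eta> x)"
    by (simp add: linear_neg[OF has_derivative_linear[OF test_function_has_derivative[OF \<eta>]]])
qed

definition unit_interval_measure :: "real measure" where
  "unit_interval_measure = restrict_space lborel {0..1}"

lemma prob_space_unit_interval: "prob_space unit_interval_measure"
  by (intro prob_spaceI) (simp add: unit_interval_measure_def emeasure_restrict_space)

lemma integrable_pair_bounded:
  fixes f :: "'b \<times> 'a::euclidean_space \<Rightarrow> real"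
  assumes N: "finite_measure N" and f: "f \<in> borel_measurable (N \<Otimes>\<^sub>M lborel)"
    and b: "\<And>t x. t \<in> space N \<Longrightarrow> \<bar>f (t, x)\<bar> \<le> B" and z: "\<And>t x. t \<in> space N \<Longrightarrow> norm x > R \<Longrightarrow> f (t, x) = 0"
  shows "integrable (N \<Otimes>\<^sub>M lborel) f"
proof (rule integrableI_bounded_set[where A = "space N \<times> cball 0 R"])
  interpret N: finite_measure N by fact
  show "space N \<times> cball 0 R \<in> sets (N \<Otimes>\<^sub>M lborel)" by simp
  have "emeasure (N \<Otimes>\<^sub>M lborel) (space N \<times> cball (0::'a) R) = emeasure N (space N) * emeasure lborel (cball (0::'a) R)"
    by (rule lborel.emeasure_pair_measure_Times) auto
  also have "\<dots> < \<infinity>"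
    using emeasure_bounded_finite[of "cball (0::'a) R"] N.emeasure_finite[of "space N"]
    by (auto simp: ennreal_mult_eq_top_iff less_top[symmetric])
  finally show "emeasure (N \<Otimes>\<^sub>M lborel) (space N \<times> cball (0::'a) R) < \<infinity>" .
  show "AE p in N \<Otimes>\<^sub>M lborel. p \<notin> space N \<times> cball 0 R \<longrightarrow> f p = 0"
    using z by (intro AE_I2) (force simp: space_pair_measure not_le)
qed (use f b in \<open>auto simp: space_pair_measure intro!: AE_I2\<close>)

lemma test_function_line_FTC:
  fixes \<eta> :: "'a::euclidean_space \<Rightarrow> real"
  assumes \<eta>: "test_function W \<eta>"
  shows "(LINT t|unit_interval_measure. frechet_derivative \<eta> (at (x + t *\<^sub>R v)) v) = \<eta> (x + v) - \<eta> x"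
proof -
  have "(LINT t|lborel. frechet_derivative \<eta> (at (x + t *\<^sub>R v)) v * indicator {0..1} t)
      = \<eta> (x + 1 *\<^sub>R v) - \<eta> (x + 0 *\<^sub>R v)"
  proof (rule integral_FTC_Icc_real)
    fix t :: real
    have "((\<lambda>t. \<eta> (x + t *\<^sub>R v)) has_derivative (\<lambda>s. frechet_derivative \<eta> (at (x + t *\<^sub>R v)) (s *\<^sub>R v))) (at t)"
      by (rule has_derivative_compose[OF _ test_function_has_derivative[OF \<eta>]]) (auto intro!: derivative_eq_intros)
    then show "DERIV (\<lambda>t. \<eta> (x + t *\<^sub>R v)) t :> frechet_derivative \<eta> (at (x + t *\<^sub>R v)) v"
      by (simp add: has_field_derivative_def mult.commute[of _ "frechet_derivative \<eta> (at (x + t *\<^sub>R v)) v"]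
          linear_cmul[OF has_derivative_linear[OF test_function_has_derivative[OF \<eta>]]])
    have "continuous_on UNIV (\<lambda>t. frechet_derivative \<eta> (at (x + t *\<^sub>R v)) v)"
      by (rule continuous_on_compose2[OF test_function_continuous_derivative[OF \<eta>]]) (auto intro!: continuous_intros)
    then show "isCont (\<lambda>t. frechet_derivative \<eta> (at (x + t *\<^sub>R v)) v) t"
      by (simp add: continuous_on_eq_continuous_at)
  qed simp
  then show ?thesis
    by (simp add: unit_interval_measure_def integral_restrict_space mult.commute)
qed

text \<open>Conversely, a weak derivative gives the fundamental theorem of calculus along almost every
  segment. Testing the identity with \<open>\<eta>\<close>, it reduces by the theorem of Fubini and by translations
  to the fundamental theorem for \<open>\<eta>\<close> on a segment; the fundamental lemma then removes \<open>\<eta>\<close>.\<close>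

lemma weak_deriv_line_FTC:
  fixes u g :: "'a::euclidean_space \<Rightarrow> real"
  assumes wd: "weak_deriv W v u g"
    and u[measurable]: "u \<in> borel_measurable borel" and ub: "\<And>x. \<bar>u x\<bar> \<le> Bu"
    and g[measurable]: "g \<in> borel_measurable borel" and gb: "\<And>x. \<bar>g x\<bar> \<le> Bg"
    and V: "open V" and VW: "\<And>x t. x \<in> V \<Longrightarrow> t \<in> {0..1} \<Longrightarrow> x + (t * h) *\<^sub>R v \<in> W"
  shows "AE x in lborel. x \<in> V \<longrightarrow>
    u (x + h *\<^sub>R v) - u x = h * (LINT t|unit_interval_measure. g (x + (t * h) *\<^sub>R v))"
proof -
  let ?I = unit_interval_measure
  interpret I: prob_space ?I by (rule prob_space_unit_interval)
  interpret P: pair_sigma_finite ?I "lborel :: 'a measure" ..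
  have fI: "finite_measure ?I" by unfold_locales
  have id[measurable]: "(\<lambda>t. t) \<in> borel_measurable ?I"
    by (simp add: unit_interval_measure_def measurable_restrict_space1)
  have spI: "space ?I = {0..1}" by (simp add: unit_interval_measure_def space_restrict_space)
  have Bu0: "Bu \<ge> 0" using ub[of 0] by linarith
  have Bg0: "Bg \<ge> 0" using gb[of 0] by linarith
  \<comment> \<open>\<open>A x\<close> is the average of \<open>g\<close> over the segment from \<open>x\<close> to \<open>x + h *\<^sub>R v\<close>.\<close>
  define A where "A x = (LINT t|?I. g (x + (t * h) *\<^sub>R v))" for x
  have A[measurable]: "A \<in> borel_measurable borel"
  proof -
    have "A \<in> borel_measurable lborel" unfolding A_def[abs_def] by measurable
    then show ?thesis by simp
  qed
  have Ab: "\<bar>A x\<bar> \<le> Bg" for x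
  proof -
    have "norm (A x) \<le> (LINT t|?I. norm (g (x + (t * h) *\<^sub>R v)))" unfolding A_def by (rule integral_norm_bound)
    also have "\<dots> \<le> (LINT t|?I. Bg)"
      using gb Bg0 by (intro integral_mono I.integrable_const_bound[where B = Bg]) auto
    finally show ?thesis by (simp add: I.prob_space)
  qed
  define q where "q x = u (x + h *\<^sub>R v) - u x - h * A x" for x
  have q[measurable]: "q \<in> borel_measurable borel" unfolding q_def[abs_def] by measurable
  have qb: "\<bar>q x\<bar> \<le> 2 * Bu + \<bar>h\<bar> * Bg" for x
  proof -
    have "\<bar>h * A x\<bar> \<le> \<bar>h\<bar> * Bg" using Ab[of x] by (simp add: abs_mult mult_left_mono)
    then show ?thesis using ub[of "x + h *\<^sub>R v"] ub[of x] by (simp add: q_def)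
  qed
  \<comment> \<open>The defect \<open>q\<close> is bounded, and becomes integrable after restriction to a ball.\<close>
  have "AE x in lborel. x \<in> V \<inter> ball 0 (real m) \<longrightarrow> indicator (ball 0 (real m)) x * q x = 0" for m
  proof (rule fundamental_lemma_integrable)
    show "integrable lborel (\<lambda>x. indicator (ball 0 (real m)) x * q x)"
      using qb emeasure_bounded_finite[of "ball (0::'a) (real m)"]
      by (intro integrableI_bounded_set[where A = "ball 0 (real m)" and B = "2 * Bu + \<bar>h\<bar> * Bg"])
        (auto simp: less_top indicator_def)
    show "open (V \<inter> ball 0 (real m))" using V by auto
    fix \<eta> :: "'a \<Rightarrow> real" assume \<eta>': "test_function (V \<inter> ball 0 (real m)) \<eta>"
    then have \<eta>: "test_function V \<eta>" by (rule test_function_mono) auto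
    note [measurable] = test_function_measurable[OF \<eta>]
    note I\<eta> = test_function_integrable[OF \<eta>]
    obtain R where R: "R > 0" "\<And>x. norm x > R \<Longrightarrow> \<eta> x = 0"
      "\<And>x v. norm x > R \<Longrightarrow> frechet_derivative \<eta> (at x) v = 0"
      by (rule test_function_support_cball[OF \<eta>]) blast
    obtain B\<eta> where B\<eta>: "B\<eta> \<ge> 0" "\<And>x. \<bar>\<eta> x\<bar> \<le> B\<eta>" using test_function_bound[OF \<eta>] by auto
    let ?D = "\<lambda>x. frechet_derivative \<eta> (at x) v"
    obtain BD where BD: "BD \<ge> 0" "\<And>x. \<bar>?D x\<bar> \<le> BD" using test_function_derivative_bound[OF \<eta>, of v] by auto
    have shiftR: "norm (x - (t * h) *\<^sub>R v) > R" if "t \<in> {0..1}" "norm x > R + \<bar>h\<bar> * norm v" for t x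
    proof -
      have "norm x \<le> norm (x - (t * h) *\<^sub>R v) + norm ((t * h) *\<^sub>R v)"
        by (metis diff_add_cancel norm_triangle_ineq)
      moreover have "norm ((t * h) *\<^sub>R v) \<le> \<bar>h\<bar> * norm v"
        using that(1) by (auto simp: abs_mult mult_le_cancel_right1 intro!: mult_right_mono mult_left_le_one_le)
      ultimately show ?thesis using that(2) by linarith
    qed
    \<comment> \<open>The integral over \<open>t\<close> is moved outside, where the weak derivative applies for each \<open>t\<close>, and
      back inside, where it is that of a derivative along a segment.\<close>
    have "(LINT x|lborel. \<eta> x * A x) = (LINT x|lborel. LINT t|?I. \<eta> x * g (x + (t * h) *\<^sub>R v))"
      by (simp add: A_def)
    also have "\<dots> = (LINT t|?I. LINT x|lborel. \<eta> x * g (x + (t * h) *\<^sub>R v))"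
    proof (rule P.Fubini_integral)
      show "integrable (?I \<Otimes>\<^sub>M lborel) (\<lambda>(t, x). \<eta> x * g (x + (t * h) *\<^sub>R v))"
        by (rule integrable_pair_bounded[OF fI, where B = "B\<eta> * Bg" and R = R])
          (use R B\<eta> gb Bg0 in \<open>auto simp: abs_mult intro!: mult_mono\<close>)
    qed
    also have "\<dots> = (LINT t|?I. - (LINT x|lborel. u x * ?D (x - (t * h) *\<^sub>R v)))"
    proof (intro Bochner_Integration.integral_cong refl)
      fix t assume t: "t \<in> space ?I"
      let ?\<eta> = "\<lambda>x. \<eta> (- ((t * h) *\<^sub>R v) + 1 *\<^sub>R x)"
      have T: "test_function W ?\<eta>"
      proof (rule test_function_affine[OF \<eta>])
        fix y assume "- ((t * h) *\<^sub>R v) + 1 *\<^sub>R y \<in> V"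
        from VW[OF this, of t] t show "y \<in> W" by (simp add: spI)
      qed simp
      have "(LINT x|lborel. \<eta> x * g (x + (t * h) *\<^sub>R v)) = (LINT x|lborel. g x * ?\<eta> x)"
        using integral_lborel_shift[of "\<lambda>x. g x * ?\<eta> x" "(t * h) *\<^sub>R v"] by (simp add: mult.commute)
      also have "\<dots> = - (LINT x|lborel. u x * frechet_derivative ?\<eta> (at x) v)"
        using wd T by (simp add: weak_deriv_def)
      also have "\<dots> = - (LINT x|lborel. u x * ?D (x - (t * h) *\<^sub>R v))"
        unfolding test_function_affine_derivative[OF \<eta>] by simp
      finally show "(LINT x|lborel. \<eta> x * g (x + (t * h) *\<^sub>R v)) = \<dots>" .
    qed
    finally have E1: "h * (LINT x|lborel. \<eta> x * A x)
        = (LINT t|?I. LINT x|lborel. u x * (- h * ?D (x - (t * h) *\<^sub>R v)))"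
      by (simp add: mult.left_commute[of _ h])
    also have "\<dots> = (LINT x|lborel. LINT t|?I. u x * (- h * ?D (x - (t * h) *\<^sub>R v)))"
    proof (rule P.Fubini_integral[symmetric])
      show "integrable (?I \<Otimes>\<^sub>M lborel) (\<lambda>(t, x). u x * (- h * ?D (x - (t * h) *\<^sub>R v)))"
        by (rule integrable_pair_bounded[OF fI, where B = "Bu * (\<bar>h\<bar> * BD)" and R = "R + \<bar>h\<bar> * norm v"])
          (use R BD ub Bu0 shiftR in \<open>auto simp: abs_mult spI intro!: mult_mono\<close>)
    qed
    also have "\<dots> = (LINT x|lborel. u x * (\<eta> (x - h *\<^sub>R v) - \<eta> x))"
    proof (intro Bochner_Integration.integral_cong refl)
      fix x
      have "?D z * (- h) = frechet_derivative \<eta> (at z) (- h *\<^sub>R v)" for z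
        using linear_cmul[OF has_derivative_linear[OF test_function_has_derivative[OF \<eta>, of z]], of "- h" v] by simp
      then have "- h * ?D (x - (t * h) *\<^sub>R v) = frechet_derivative \<eta> (at (x + t *\<^sub>R (- h *\<^sub>R v))) (- h *\<^sub>R v)" for t
        by (simp add: mult.commute)
      with test_function_line_FTC[OF \<eta>, of x "- h *\<^sub>R v"]
      have "(LINT t|?I. - h * ?D (x - (t * h) *\<^sub>R v)) = \<eta> (x - h *\<^sub>R v) - \<eta> x"
        by simp
      from arg_cong[OF this, of "\<lambda>z. u x * z"]
      show "(LINT t|?I. u x * (- h * ?D (x - (t * h) *\<^sub>R v))) = u x * (\<eta> (x - h *\<^sub>R v) - \<eta> x)"
        by simp
    qed
    also have "\<dots> = (LINT x|lborel. u x * \<eta> (x - h *\<^sub>R v)) - (LINT x|lborel. u x * \<eta> x)"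
    proof -
      have "integrable lborel (\<lambda>x. u x * \<eta> (x + - (h *\<^sub>R v)))" "integrable lborel (\<lambda>x. u x * \<eta> x)"
        by (intro integrable_bounded_mult[OF _ u ub] integrable_lborel_shift[OF I\<eta>] I\<eta>)+
      then show ?thesis by (simp add: right_diff_distrib)
    qed
    also have "(LINT x|lborel. u x * \<eta> (x - h *\<^sub>R v)) = (LINT x|lborel. u (x + h *\<^sub>R v) * \<eta> x)"
      using integral_lborel_shift[of "\<lambda>x. u x * \<eta> (x - h *\<^sub>R v)" "h *\<^sub>R v"] by simp
    finally have E: "h * (LINT x|lborel. \<eta> x * A x)
      = (LINT x|lborel. u (x + h *\<^sub>R v) * \<eta> x) - (LINT x|lborel. u x * \<eta> x)" .
    have off: "\<eta> x = 0" if "x \<notin> ball 0 (real m)" for x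
      by (rule test_function_compact_support[OF \<eta>']) (use that in blast)
    have "(LINT x|lborel. \<eta> x * (indicator (ball 0 (real m)) x * q x))
        = (LINT x|lborel. u (x + h *\<^sub>R v) * \<eta> x - u x * \<eta> x - h * (A x * \<eta> x))"
      by (intro Bochner_Integration.integral_cong) (use off in \<open>auto simp: q_def indicator_def algebra_simps\<close>)
    also have "\<dots> = (LINT x|lborel. u (x + h *\<^sub>R v) * \<eta> x) - (LINT x|lborel. u x * \<eta> x) - h * (LINT x|lborel. A x * \<eta> x)"
    proof -
      have "integrable lborel (\<lambda>x. u (x + h *\<^sub>R v) * \<eta> x)" "integrable lborel (\<lambda>x. u x * \<eta> x)"
        by (rule integrable_bounded_mult[OF I\<eta>, where B = Bu]; simp add: ub)+
      moreover have "integrable lborel (\<lambda>x. A x * \<eta> x)"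
        by (rule integrable_bounded_mult[OF I\<eta> A Ab])
      ultimately show ?thesis by simp
    qed
    also have "\<dots> = 0" using E by (simp add: mult.commute)
    finally show "(LINT x|lborel. \<eta> x * (indicator (ball 0 (real m)) x * q x)) = 0" .
  qed
  then have "AE x in lborel. \<forall>m. x \<in> V \<inter> ball 0 (real m) \<longrightarrow> indicator (ball 0 (real m)) x * q x = 0"
    unfolding AE_all_countable by blast
  then show ?thesis
  proof eventually_elim
    case (elim x)
    obtain m :: nat where "norm x < real m" using reals_Archimedean2 by blast
    with elim[rule_format, of m] show ?case by (auto simp: q_def A_def)
  qed
qed

section \<open>Uniqueness of weak gradients\<close>

lemma AE_lebesgue_on_iff:
  assumes "W \<in> sets borel"
  shows "(AE x in lebesgue_on W. P x) \<longleftrightarrow> (AE x in lborel. x \<in> W \<longrightarrow> P x)"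
  using assms by (simp add: AE_restrict_space_iff AE_completion_iff)

lemma LINT_lebesgue_on_borel:
  fixes f :: "'a::euclidean_space \<Rightarrow> 'b::euclidean_space"
  assumes [measurable]: "W \<in> sets borel" "f \<in> borel_measurable borel"
  shows "(LINT x|lebesgue_on W. f x) = (LINT x|lborel. indicator W x *\<^sub>R f x)"
    and "integrable (lebesgue_on W) f \<longleftrightarrow> integrable lborel (\<lambda>x. indicator W x *\<^sub>R f x)"
proof -
  have W: "W \<inter> space lebesgue \<in> sets lebesgue" using assms by simp
  have M: "(\<lambda>x. indicator W x *\<^sub>R f x) \<in> borel_measurable lborel" by measurable
  show "(LINT x|lebesgue_on W. f x) = (LINT x|lborel. indicator W x *\<^sub>R f x)"
    by (simp only: integral_restrict_space[OF W] integral_completion[OF M])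
  show "integrable (lebesgue_on W) f \<longleftrightarrow> integrable lborel (\<lambda>x. indicator W x *\<^sub>R f x)"
    by (simp only: integrable_restrict_space[OF W] integrable_completion[OF M])
qed

lemma borel_measurable_lebesgue_on:
  "f \<in> borel_measurable borel \<Longrightarrow> f \<in> borel_measurable (lebesgue_on W)"
  by (intro measurable_restrict_space1 measurable_completion) simp

lemma borel_measurable_vec_nth [measurable (raw)]:
  fixes f :: "'a \<Rightarrow> ('b::euclidean_space)^'n"
  shows "f \<in> borel_measurable M \<Longrightarrow> (\<lambda>x. f x $ i) \<in> borel_measurable M"
  by (rule borel_measurable_continuous_on[OF linear_continuous_on[OF bounded_linear_vec_nth]])

lemma locally_integrable_bounded_linear:
  "bounded_linear L \<Longrightarrow> locally_integrable W f \<Longrightarrow> locally_integrable W (\<lambda>x. L (f x))"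
  by (auto simp: locally_integrable_def intro: integrable_bounded_linear)

lemma locally_integrable_add:
  "locally_integrable W f \<Longrightarrow> locally_integrable W g \<Longrightarrow> locally_integrable W (\<lambda>x. f x + g x)"
  by (auto simp: locally_integrable_def)

lemma locally_integrable_diff:
  "locally_integrable W f \<Longrightarrow> locally_integrable W g \<Longrightarrow> locally_integrable W (\<lambda>x. f x - g x)"
  by (auto simp: locally_integrable_def)

lemma locally_integrable_component:
  fixes G :: "'a::euclidean_space \<Rightarrow> real^'d^'k" and u :: "'a \<Rightarrow> real^'k"
  shows "locally_integrable W u \<Longrightarrow> locally_integrable W (\<lambda>x. u x $ i)"
    and "locally_integrable W G \<Longrightarrow> locally_integrable W (\<lambda>x. G x $ i $ j)"
  by (intro locally_integrable_bounded_linear[of "\<lambda>y. y $ i"] bounded_linear_vec_nth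
      locally_integrable_bounded_linear[of "\<lambda>A. A $ i $ j"]
      bounded_linear_compose[OF bounded_linear_vec_nth[of j]]; assumption)+

lemma bounded_borel_locally_integrable:
  fixes f :: "'a::euclidean_space \<Rightarrow> 'b::euclidean_space"
  assumes f: "f \<in> borel_measurable borel" and b: "\<And>x. norm (f x) \<le> B"
  shows "locally_integrable W f"
  unfolding locally_integrable_def
proof (intro allI impI)
  fix K :: "'a set" assume K: "compact K \<and> K \<subseteq> W"
  then have KB: "K \<in> sets borel" by (auto intro: borel_closed compact_imp_closed)
  show "integrable (lebesgue_on K) f"
    unfolding LINT_lebesgue_on_borel(2)[OF KB f]
    using K KB f b emeasure_bounded_finite[of K] compact_imp_bounded[of K]
    by (intro integrableI_bounded_set_indicator[where B = B]) auto
qed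

lemma locally_integrable_mult_continuous:
  fixes f \<eta> :: "'a::euclidean_space \<Rightarrow> real"
  assumes f: "locally_integrable W f" and W: "W \<in> sets borel" and \<eta>: "continuous_on UNIV \<eta>"
    and K: "compact K" "K \<subseteq> W" "\<And>x. x \<notin> K \<Longrightarrow> \<eta> x = 0"
  shows "integrable (lebesgue_on W) (\<lambda>x. f x * \<eta> x)"
proof -
  obtain B where B: "B \<ge> 0" "\<And>x. norm (\<eta> x) \<le> B"
    by (rule bounded_continuous_compact_support[OF \<eta> K(1,3)]) auto
  have KL: "K \<inter> space lebesgue \<in> sets lebesgue" "W \<inter> space lebesgue \<in> sets lebesgue"
    using borel_closed[OF compact_imp_closed[OF K(1)]] W by auto
  have fK: "integrable lebesgue (\<lambda>x. indicator K x *\<^sub>R f x)"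
    using f K unfolding locally_integrable_def integrable_restrict_space[OF KL(1), symmetric] by blast
  have "\<eta> \<in> borel_measurable borel" by (rule borel_measurable_continuous_onI[OF \<eta>])
  then have \<eta>m: "\<eta> \<in> borel_measurable lebesgue" by (intro measurable_completion) simp
  have "integrable lebesgue (\<lambda>x. (indicator K x *\<^sub>R f x) * \<eta> x)"
  proof (rule Bochner_Integration.integrable_bound)
    show "integrable lebesgue (\<lambda>x. (indicator K x *\<^sub>R f x) * B)" by (rule integrable_mult_left[OF fK])
    show "AE x in lebesgue. norm ((indicator K x *\<^sub>R f x) * \<eta> x) \<le> norm ((indicator K x *\<^sub>R f x) * B)"
    proof (intro AE_I2)
      fix x
      show "norm ((indicator K x *\<^sub>R f x) * \<eta> x) \<le> norm ((indicator K x *\<^sub>R f x) * B)"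
        using B(2)[of x] unfolding norm_mult by (intro mult_left_mono) auto
    qed
  qed (intro borel_measurable_times borel_measurable_integrable[OF fK] \<eta>m)
  also have "(\<lambda>x. (indicator K x *\<^sub>R f x) * \<eta> x) = (\<lambda>x. indicator W x *\<^sub>R (f x * \<eta> x))"
  proof
    fix x
    show "(indicator K x *\<^sub>R f x) * \<eta> x = indicator W x *\<^sub>R (f x * \<eta> x)"
      using K(2) K(3)[of x] by (cases "x \<in> K") auto
  qed
  finally show ?thesis by (simp only: integrable_restrict_space[OF KL(2)])
qed

text \<open>All integrals in the definition of a weak gradient exist, so that weak gradients may be
  added and subtracted.\<close>

lemma locally_integrable_mult_test:
  fixes f \<eta> :: "'a::euclidean_space \<Rightarrow> real"
  assumes "locally_integrable W f" "W \<in> sets borel" "test_function W \<eta>"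
  shows "integrable (lebesgue_on W) (\<lambda>x. f x * \<eta> x)"
    and "integrable (lebesgue_on W) (\<lambda>x. f x * frechet_derivative \<eta> (at x) v)"
proof -
  obtain K where K: "compact K" "K \<subseteq> W" "\<And>x. x \<notin> K \<Longrightarrow> \<eta> x = 0"
    "\<And>x v. x \<notin> K \<Longrightarrow> frechet_derivative \<eta> (at x) v = 0"
    by (rule test_function_compact_support[OF assms(3)]) blast
  show "integrable (lebesgue_on W) (\<lambda>x. f x * \<eta> x)"
    by (rule locally_integrable_mult_continuous[OF assms(1,2) test_function_continuous[OF assms(3)] K(1-3)])
  show "integrable (lebesgue_on W) (\<lambda>x. f x * frechet_derivative \<eta> (at x) v)"
    by (rule locally_integrable_mult_continuous[OF assms(1,2) test_function_continuous_derivative[OF assms(3)] K(1,2,4)])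
qed

text \<open>On each ball the function may be replaced by a Borel function that is integrable on the whole
  space; countably many balls cover \<open>W\<close>.\<close>

lemma fundamental_lemma:
  fixes g :: "'a::euclidean_space \<Rightarrow> real"
  assumes g: "locally_integrable W g" and W: "open W"
    and zero: "\<And>\<eta>. test_function W \<eta> \<Longrightarrow> (LINT x|lebesgue_on W. g x * \<eta> x) = 0"
  shows "AE x in lebesgue_on W. g x = 0"
proof -
  have WB: "W \<in> sets borel" using W by simp
  have ball: "AE x in lborel. x \<in> ball a r \<longrightarrow> g x = 0" if B: "cball a r \<subseteq> W" for a r
  proof -
    let ?K = "cball a r"
    have KL: "?K \<inter> space lebesgue \<in> sets lebesgue" "W \<inter> space lebesgue \<in> sets lebesgue" using WB by auto
    have gK: "integrable lebesgue (\<lambda>x. indicator ?K x *\<^sub>R g x)"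
      using g B unfolding locally_integrable_def integrable_restrict_space[OF KL(1), symmetric] by simp
    obtain g' where g': "g' \<in> borel_measurable borel" "AE x in lborel. indicator ?K x *\<^sub>R g x = g' x"
      by (rule lebesgue_borel_representative[OF borel_measurable_integrable[OF gK]]) blast
    have gl: "g' \<in> borel_measurable lebesgue" using g'(1) by (intro measurable_completion) simp
    have "integrable lebesgue g'"
      by (rule integrable_cong_AE_imp[OF gK gl]) (use g'(2) in \<open>simp add: AE_completion_iff\<close>)
    then have ig': "integrable lborel g'" using g'(1) by (simp add: integrable_completion)
    have "AE x in lborel. x \<in> ball a r \<longrightarrow> g' x = 0"
    proof (rule fundamental_lemma_integrable[OF ig' open_ball])
      fix \<eta> :: "'a \<Rightarrow> real" assume \<eta>: "test_function (ball a r) \<eta>"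
      then have \<eta>W: "test_function W \<eta>" by (rule test_function_mono) (use B in auto)
      have off: "\<eta> x = 0" if "x \<notin> ?K" for x
        by (rule test_function_compact_support[OF \<eta>]) (use that ball_subset_cball in blast)
      have \<eta>m: "\<eta> \<in> borel_measurable lebesgue"
        using test_function_measurable(1)[OF \<eta>] by (intro measurable_completion) simp
      have "(LINT x|lborel. \<eta> x * g' x) = (LINT x|lebesgue. \<eta> x * g' x)"
        using g'(1) test_function_measurable(1)[OF \<eta>] by (simp add: integral_completion)
      also have "\<dots> = (LINT x|lebesgue. (indicator ?K x *\<^sub>R g x) * \<eta> x)"
        using g'(2) \<eta>m gl borel_measurable_integrable[OF gK]
        by (intro integral_cong_AE borel_measurable_times) (auto simp: AE_completion_iff mult.commute)
      also have "\<dots> = (LINT x|lebesgue. indicator W x *\<^sub>R (g x * \<eta> x))"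
        using off B by (intro Bochner_Integration.integral_cong) (auto simp: indicator_def)
      also have "\<dots> = (LINT x|lebesgue_on W. g x * \<eta> x)"
        by (rule integral_restrict_space[OF KL(2), symmetric])
      also have "\<dots> = 0" by (rule zero[OF \<eta>W])
      finally show "(LINT x|lborel. \<eta> x * g' x) = 0" .
    qed
    with g'(2) show ?thesis
      by eventually_elim (auto simp: indicator_def split: if_splits)
  qed
  define \<F> where "\<F> = {ball a r | a r. cball a r \<subseteq> W}"
  obtain \<F>' where \<F>': "\<F>' \<subseteq> \<F>" "countable \<F>'" "\<Union>\<F>' = \<Union>\<F>"
    by (rule Lindelof_openin[of \<F> UNIV]) (auto simp: \<F>_def)
  have "W \<subseteq> \<Union>\<F>"
  proof
    fix x assume "x \<in> W"
    with W obtain r where "r > 0" "cball x r \<subseteq> W" by (auto simp: open_contains_cball)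
    then show "x \<in> \<Union>\<F>" by (auto simp: \<F>_def intro!: exI[of _ "ball x r"])
  qed
  have "AE x in lborel. \<forall>S\<in>\<F>'. x \<in> S \<longrightarrow> g x = 0"
  proof (rule AE_ball_countable'[OF _ \<F>'(2)])
    fix S assume "S \<in> \<F>'"
    then obtain a r where "S = ball a r" "cball a r \<subseteq> W" using \<F>'(1) by (auto simp: \<F>_def)
    with ball show "AE x in lborel. x \<in> S \<longrightarrow> g x = 0" by blast
  qed
  then have "AE x in lborel. x \<in> W \<longrightarrow> g x = 0"
  proof eventually_elim
    case (elim x)
    show ?case
    proof
      assume "x \<in> W"
      then have "x \<in> \<Union>\<F>'" unfolding \<F>'(3) using \<open>W \<subseteq> \<Union>\<F>\<close> by (rule subsetD[rotated])
      then obtain S where "S \<in> \<F>'" "x \<in> S" by (rule UnionE)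
      with elim show "g x = 0" by blast
    qed
  qed
  then show ?thesis by (simp add: AE_lebesgue_on_iff[OF WB])
qed

lemma has_weak_grad_add:
  assumes W: "open W" and u: "has_weak_grad W u G" and v: "has_weak_grad W v H"
  shows "has_weak_grad W (\<lambda>x. u x + v x) (\<lambda>x. G x + H x)"
  unfolding has_weak_grad_def
proof (intro conjI allI impI)
  have WB: "W \<in> sets borel" using W by simp
  have L: "locally_integrable W u" "locally_integrable W G" "locally_integrable W v" "locally_integrable W H"
    using u v by (auto simp: has_weak_grad_def)
  then show "locally_integrable W (\<lambda>x. u x + v x)" "locally_integrable W (\<lambda>x. G x + H x)"
    by (auto intro: locally_integrable_add)
  fix \<psi> :: "real^'a \<Rightarrow> real" and i j
  assume \<psi>: "test_function W \<psi>"
  note I = locally_integrable_mult_test[OF _ WB \<psi>]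
  show "(LINT x|lebesgue_on W. (u x + v x) $ i * frechet_derivative \<psi> (at x) (axis j 1))
      = - (LINT x|lebesgue_on W. (G x + H x) $ i $ j * \<psi> x)"
    using u v \<psi> L
    by (simp add: has_weak_grad_def distrib_right I locally_integrable_component)
qed

lemma has_weak_grad_diff:
  assumes W: "open W" and u: "has_weak_grad W u G" and v: "has_weak_grad W v H"
  shows "has_weak_grad W (\<lambda>x. u x - v x) (\<lambda>x. G x - H x)"
  unfolding has_weak_grad_def
proof (intro conjI allI impI)
  have WB: "W \<in> sets borel" using W by simp
  have L: "locally_integrable W u" "locally_integrable W G" "locally_integrable W v" "locally_integrable W H"
    using u v by (auto simp: has_weak_grad_def)
  then show "locally_integrable W (\<lambda>x. u x - v x)" "locally_integrable W (\<lambda>x. G x - H x)"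
    by (auto intro: locally_integrable_diff)
  fix \<psi> :: "real^'a \<Rightarrow> real" and i j
  assume \<psi>: "test_function W \<psi>"
  note I = locally_integrable_mult_test[OF _ WB \<psi>]
  show "(LINT x|lebesgue_on W. (u x - v x) $ i * frechet_derivative \<psi> (at x) (axis j 1))
      = - (LINT x|lebesgue_on W. (G x - H x) $ i $ j * \<psi> x)"
    using u v \<psi> L
    by (simp add: has_weak_grad_def left_diff_distrib I locally_integrable_component)
qed

text \<open>Uniqueness is indispensable since \<open>weak_grad\<close> is an arbitrary choice among all weak gradients.\<close>

lemma has_weak_grad_unique:
  fixes u :: "real^'d \<Rightarrow> real^'k"
  assumes W: "open W" and G: "has_weak_grad W u G" and H: "has_weak_grad W u H"
  shows "AE x in lebesgue_on W. G x = H x"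
proof -
  have WB: "W \<in> sets borel" using W by simp
  have D: "has_weak_grad W (\<lambda>x. u x - u x) (\<lambda>x. G x - H x)"
    by (rule has_weak_grad_diff[OF W G H])
  have "AE x in lebesgue_on W. (G x - H x) $ i $ j = 0" for i j
  proof (rule fundamental_lemma[OF _ W])
    show "locally_integrable W (\<lambda>x. (G x - H x) $ i $ j)"
      using D by (intro locally_integrable_component) (simp add: has_weak_grad_def)
    show "(LINT x|lebesgue_on W. (G x - H x) $ i $ j * \<eta> x) = 0" if "test_function W \<eta>" for \<eta>
      using D that by (simp add: has_weak_grad_def)
  qed
  then have "AE x in lebesgue_on W. \<forall>i\<in>UNIV. \<forall>j\<in>UNIV. (G x - H x) $ i $ j = 0"
    by (intro AE_ball_countable' countable_finite finite) auto
  then show ?thesis by eventually_elim (simp add: vec_eq_iff)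
qed

lemma has_weak_grad_weak_grad: "has_weak_grad W u G \<Longrightarrow> has_weak_grad W u (weak_grad W u)"
  unfolding weak_grad_def by (rule someI[of "has_weak_grad W u"])

lemma weak_grad_AE:
  "open W \<Longrightarrow> has_weak_grad W u G \<Longrightarrow> AE x in lebesgue_on W. weak_grad W u x = G x"
  by (rule has_weak_grad_unique[OF _ has_weak_grad_weak_grad])

lemma has_weak_grad_cong_AE:
  fixes u u' :: "real^'d \<Rightarrow> real^'k"
  assumes W: "open W" and G: "has_weak_grad W u G"
    and u': "u' \<in> borel_measurable borel" "AE x in lebesgue_on W. u x = u' x"
    and G': "G' \<in> borel_measurable borel" "AE x in lebesgue_on W. G x = G' x"
  shows "has_weak_grad W u' G'"
  unfolding has_weak_grad_def
proof (intro conjI allI impI)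
  have WB: "W \<in> sets borel" using W by simp
  have L: "locally_integrable W u" "locally_integrable W G" using G by (auto simp: has_weak_grad_def)
  have sub: "AE x in lebesgue_on K. P x" if "compact K \<and> K \<subseteq> W" "AE x in lebesgue_on W. P x" for K P
  proof -
    have "K \<in> sets borel" using that by (auto intro: borel_closed compact_imp_closed)
    with that WB show ?thesis by (auto simp: AE_lebesgue_on_iff elim!: eventually_mono)
  qed
  show "locally_integrable W u'"
    using L(1) borel_measurable_lebesgue_on[OF u'(1)] sub[OF _ u'(2)]
    unfolding locally_integrable_def by (blast intro: integrable_cong_AE_imp)
  show "locally_integrable W G'"
    using L(2) borel_measurable_lebesgue_on[OF G'(1)] sub[OF _ G'(2)]
    unfolding locally_integrable_def by (blast intro: integrable_cong_AE_imp)
  fix \<psi> :: "real^'d \<Rightarrow> real" and i j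
  assume \<psi>: "test_function W \<psi>"
  note I = locally_integrable_mult_test[OF _ WB \<psi>]
  have [measurable]: "(\<lambda>x. u' x $ i) \<in> borel_measurable borel" "(\<lambda>x. G' x $ i $ j) \<in> borel_measurable borel"
    using u'(1) G'(1) by (auto intro!: borel_measurable_vec_nth)
  note [measurable] = test_function_measurable[OF \<psi>]
  have "(LINT x|lebesgue_on W. u' x $ i * frechet_derivative \<psi> (at x) (axis j 1))
      = (LINT x|lebesgue_on W. u x $ i * frechet_derivative \<psi> (at x) (axis j 1))"
  proof (rule integral_cong_AE)
    show "(\<lambda>x. u' x $ i * frechet_derivative \<psi> (at x) (axis j 1)) \<in> borel_measurable (lebesgue_on W)"
      by (rule borel_measurable_lebesgue_on) measurable
    show "(\<lambda>x. u x $ i * frechet_derivative \<psi> (at x) (axis j 1)) \<in> borel_measurable (lebesgue_on W)"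
      by (rule borel_measurable_integrable[OF I(2)[OF locally_integrable_component(1)[OF L(1)]]])
  qed (use u'(2) in auto)
  also have "\<dots> = - (LINT x|lebesgue_on W. G x $ i $ j * \<psi> x)"
    using G \<psi> by (simp add: has_weak_grad_def)
  also have "(LINT x|lebesgue_on W. G x $ i $ j * \<psi> x) = (LINT x|lebesgue_on W. G' x $ i $ j * \<psi> x)"
  proof (rule integral_cong_AE)
    show "(\<lambda>x. G' x $ i $ j * \<psi> x) \<in> borel_measurable (lebesgue_on W)"
      by (rule borel_measurable_lebesgue_on) measurable
    show "(\<lambda>x. G x $ i $ j * \<psi> x) \<in> borel_measurable (lebesgue_on W)"
      by (rule borel_measurable_integrable[OF I(1)[OF locally_integrable_component(2)[OF L(2)]]])
  qed (use G'(2) in auto)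
  finally show "(LINT x|lebesgue_on W. u' x $ i * frechet_derivative \<psi> (at x) (axis j 1))
      = - (LINT x|lebesgue_on W. G' x $ i $ j * \<psi> x)" .
qed

text \<open>For bounded Borel functions the integrals over \<open>W\<close> are integrals over the whole space, as test
  functions vanish off \<open>W\<close>.\<close>

lemma has_weak_grad_iff_weak_deriv:
  fixes u :: "real^'d \<Rightarrow> real^'k"
  assumes W: "open W"
    and u: "u \<in> borel_measurable borel" "\<And>x. norm (u x) \<le> B"
    and G: "G \<in> borel_measurable borel" "\<And>x. norm (G x) \<le> C"
  shows "has_weak_grad W u G \<longleftrightarrow>
    (\<forall>i j. weak_deriv W (axis j 1) (\<lambda>x. u x $ i) (\<lambda>x. G x $ i $ j))"
proof -
  have WB: "W \<in> sets borel" using W by simp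
  have [measurable]: "(\<lambda>x. u x $ i) \<in> borel_measurable borel" "(\<lambda>x. G x $ i $ j) \<in> borel_measurable borel" for i j
    using u(1) G(1) by (auto intro!: borel_measurable_vec_nth)
  have "(LINT x|lebesgue_on W. u x $ i * frechet_derivative \<eta> (at x) (axis j 1))
      = (LINT x|lborel. u x $ i * frechet_derivative \<eta> (at x) (axis j 1))"
    "(LINT x|lebesgue_on W. G x $ i $ j * \<eta> x) = (LINT x|lborel. G x $ i $ j * \<eta> x)"
    if \<eta>: "test_function W \<eta>" for \<eta> i j
  proof -
    note [measurable] = test_function_measurable[OF \<eta>]
    obtain K where K: "K \<subseteq> W" "\<And>x. x \<notin> K \<Longrightarrow> \<eta> x = 0"
      "\<And>x v. x \<notin> K \<Longrightarrow> frechet_derivative \<eta> (at x) v = 0"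
      by (rule test_function_compact_support[OF \<eta>]) blast
    have off: "indicator W x *\<^sub>R (u x $ i * frechet_derivative \<eta> (at x) (axis j 1))
        = u x $ i * frechet_derivative \<eta> (at x) (axis j 1)"
      "indicator W x *\<^sub>R (G x $ i $ j * \<eta> x) = G x $ i $ j * \<eta> x" for x
      using K(1) K(2)[of x] K(3)[of x] by (cases "x \<in> K"; auto)+
    show "(LINT x|lebesgue_on W. u x $ i * frechet_derivative \<eta> (at x) (axis j 1))
      = (LINT x|lborel. u x $ i * frechet_derivative \<eta> (at x) (axis j 1))"
      by (subst LINT_lebesgue_on_borel[OF WB], measurable) (simp only: off)
    show "(LINT x|lebesgue_on W. G x $ i $ j * \<eta> x) = (LINT x|lborel. G x $ i $ j * \<eta> x)"
      by (subst LINT_lebesgue_on_borel[OF WB], measurable) (simp only: off)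
  qed
  then show ?thesis
    using bounded_borel_locally_integrable[OF u] bounded_borel_locally_integrable[OF G]
    by (auto simp: has_weak_grad_def weak_deriv_def)
qed

lemma Lp_1_iff: "u \<in> Lp 1 W \<longleftrightarrow> integrable (lebesgue_on W) u"
  by (auto simp: Lp_def dest: borel_measurable_integrable integrable_norm_cancel)

text \<open>A genuinely bounded Borel representative, extended by zero, makes the functions of
  $L^\infty$ accessible to translations and to the theorem of Fubini.\<close>

lemma Lp_infinity_representative:
  fixes u :: "'a::euclidean_space \<Rightarrow> 'b::euclidean_space"
  assumes u: "u \<in> Lp \<infinity> W" and W: "open W"
  obtains u' B where "u' \<in> borel_measurable borel" "\<And>x. norm (u' x) \<le> B" "\<And>x. x \<notin> W \<Longrightarrow> u' x = 0"
    "AE x in lebesgue_on W. u x = u' x"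
proof -
  have WB: "W \<in> sets borel" using W by simp
  have WL: "W \<inter> space lebesgue \<in> sets lebesgue" using WB by auto
  have um: "u \<in> borel_measurable (lebesgue_on W)" and un: "Linf_norm W u < \<infinity>"
    using u by (auto simp: Lp_def)
  obtain B where B: "Linf_norm W u < ereal B" using un ereal_dense2 by blast
  have bd: "AE x in lebesgue_on W. norm (u x) \<le> B"
    using esssup_AE[of "\<lambda>x. ereal (norm (u x))" "lebesgue_on W"]
  proof eventually_elim
    case (elim x)
    then have "ereal (norm (u x)) < ereal B" using B unfolding Linf_norm_def by (rule le_less_trans)
    then show ?case by simp
  qed
  have "(\<lambda>x. indicator W x *\<^sub>R u x) \<in> borel_measurable lebesgue"
    using um by (simp only: borel_measurable_restrict_space_iff[OF WL])
  then obtain u0 where u0: "u0 \<in> borel_measurable borel" "AE x in lborel. indicator W x *\<^sub>R u x = u0 x"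
    by (rule lebesgue_borel_representative) blast
  define u' where "u' x = (if norm (u0 x) \<le> B \<and> x \<in> W then u0 x else 0)" for x
  show ?thesis
  proof (rule that[of u' "max B 0"])
    show "u' \<in> borel_measurable borel"
      unfolding u'_def[abs_def] using u0(1) WB by measurable
    show "norm (u' x) \<le> max B 0" for x by (auto simp: u'_def)
    show "x \<notin> W \<Longrightarrow> u' x = 0" for x by (simp add: u'_def)
    show "AE x in lebesgue_on W. u x = u' x"
      using u0(2) bd unfolding AE_lebesgue_on_iff[OF WB]
      by eventually_elim (auto simp: u'_def)
  qed
qed

section \<open>Difference quotients, extension by zero and the chain rule\<close>

lemma matrix_axis_component: "(A *v axis j 1) $ i = (A :: real^'d^'k) $ i $ j"
  by (simp add: matrix_vector_mult_basis column_def)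

lemma bounded_linear_matrix_apply: "bounded_linear (\<lambda>A :: real^'d^'k. A *v x)"
  by (intro linear_conv_bounded_linear[THEN iffD1] linearI)
    (simp_all add: matrix_vector_mult_add_rdistrib scaleR_matrix_vector_assoc)

lemma norm_matrix_axis_le:
  fixes G :: "'a \<Rightarrow> real^'d^'k"
  assumes "\<And>x. norm (G x) \<le> C"
  obtains C' where "C' \<ge> 0" "\<And>x. norm (G x *v axis j 1) \<le> C'"
proof -
  obtain K where K: "K \<ge> 0" "\<And>A :: real^'d^'k. norm (A *v axis j 1) \<le> norm A * K"
    using bounded_linear.nonneg_bounded[OF bounded_linear_matrix_apply] by blast
  have "norm (G x *v axis j 1) \<le> \<bar>C\<bar> * K" for x
    using K(2)[of "G x"] mult_right_mono[OF order_trans[OF assms[of x] abs_ge_self] K(1)] by linarith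
  with K(1) that[of "\<bar>C\<bar> * K"] show ?thesis by simp
qed

lemma weak_grad_line_FTC:
  fixes u :: "real^'d \<Rightarrow> real^'k" and G :: "real^'d \<Rightarrow> real^'d^'k"
  assumes W: "open W" and wg: "has_weak_grad W u G"
    and u: "u \<in> borel_measurable borel" "\<And>x. norm (u x) \<le> B"
    and G: "G \<in> borel_measurable borel" "\<And>x. norm (G x) \<le> C"
    and V: "open V" and VW: "\<And>x t. x \<in> V \<Longrightarrow> t \<in> {0..1} \<Longrightarrow> x + (t * h) *\<^sub>R axis j 1 \<in> W"
  shows "AE x in lborel. x \<in> V \<longrightarrow> u (x + h *\<^sub>R axis j 1) - u x
    = h *\<^sub>R (LINT t|unit_interval_measure. G (x + h *\<^sub>R (t *\<^sub>R axis j 1)) *v axis j 1)"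
proof -
  interpret I: prob_space unit_interval_measure by (rule prob_space_unit_interval)
  have [measurable]: "(\<lambda>t. t) \<in> borel_measurable unit_interval_measure"
    by (simp add: unit_interval_measure_def measurable_restrict_space1)
  note [measurable] = u(1) G(1)
  have wd: "weak_deriv W (axis j 1) (\<lambda>x. u x $ i) (\<lambda>x. G x $ i $ j)" for i
    using wg has_weak_grad_iff_weak_deriv[OF W u G] by blast
  have "AE x in lborel. x \<in> V \<longrightarrow> u (x + h *\<^sub>R axis j 1) $ i - u x $ i
      = h * (LINT t|unit_interval_measure. G (x + (t * h) *\<^sub>R axis j 1) $ i $ j)" for i
  proof (rule weak_deriv_line_FTC[OF wd[of i] _ _ _ _ V VW, where Bu = B and Bg = C])
    show "\<bar>u x $ i\<bar> \<le> B" for x using component_le_norm_cart[of "u x" i] u(2)[of x] by linarith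
    show "\<bar>G x $ i $ j\<bar> \<le> C" for x
      using component_le_norm_cart[of "G x $ i" j] Finite_Cartesian_Product.norm_nth_le[of "G x" i] G(2)[of x] by linarith
  qed auto
  then have "AE x in lborel. \<forall>i\<in>UNIV. x \<in> V \<longrightarrow> u (x + h *\<^sub>R axis j 1) $ i - u x $ i
      = h * (LINT t|unit_interval_measure. G (x + (t * h) *\<^sub>R axis j 1) $ i $ j)"
    by (intro AE_ball_countable' countable_finite finite) auto
  then show ?thesis
  proof eventually_elim
    case (elim x)
    obtain C' where C': "C' \<ge> 0" "\<And>x. norm (G x *v axis j 1) \<le> C'"
      by (rule norm_matrix_axis_le[where G = G and j = j, OF G(2)]) blast
    have M: "(\<lambda>t. G (x + h *\<^sub>R (t *\<^sub>R axis j 1)) *v axis j 1) \<in> borel_measurable unit_interval_measure"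
      by (rule borel_measurable_continuous_on[OF linear_continuous_on[OF bounded_linear_matrix_apply]]) measurable
    have I: "integrable unit_interval_measure (\<lambda>t. G (x + h *\<^sub>R (t *\<^sub>R axis j 1)) *v axis j 1)"
      using C' by (intro I.integrable_const_bound[where B = C'] M) auto
    have "(LINT t|unit_interval_measure. G (x + h *\<^sub>R (t *\<^sub>R axis j 1)) *v axis j 1) $ i
        = (LINT t|unit_interval_measure. G (x + (t * h) *\<^sub>R axis j 1) $ i $ j)" for i
      using integral_bounded_linear[OF bounded_linear_vec_nth I, of i]
      by (simp add: matrix_axis_component mult.commute)
    with elim show ?case by (auto simp: vec_eq_iff)
  qed
qed

text \<open>Along almost every segment the difference quotient is the average of the gradient over the
  segment. Such averages are bounded, and they converge almost everywhere along a subsequence.\<close>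

lemma weak_grad_difference_quotients:
  fixes u :: "real^'d \<Rightarrow> real^'k" and G :: "real^'d \<Rightarrow> real^'d^'k"
  assumes W: "open W" and wg: "has_weak_grad W u G"
    and u: "u \<in> borel_measurable borel" "\<And>x. norm (u x) \<le> B"
    and G: "G \<in> borel_measurable borel" "\<And>x. norm (G x) \<le> C" "integrable lborel G"
    and h: "h \<longlonglongrightarrow> 0" "\<And>k. h k \<noteq> 0"
    and V: "open V" and VW: "\<And>x t k. x \<in> V \<Longrightarrow> t \<in> {0..1} \<Longrightarrow> x + (t * h k) *\<^sub>R axis j 1 \<in> W"
  obtains r L where "strict_mono (r :: nat \<Rightarrow> nat)"
    "AE x in lborel. x \<in> V \<longrightarrow>
       (\<lambda>k. (1 / h (r k)) *\<^sub>R (u (x + h (r k) *\<^sub>R axis j 1) - u x)) \<longlonglongrightarrow> G x *v axis j 1"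
    "\<And>k. AE x in lborel. x \<in> V \<longrightarrow> norm ((1 / h k) *\<^sub>R (u (x + h k *\<^sub>R axis j 1) - u x)) \<le> L"
proof -
  let ?I = unit_interval_measure
  interpret I: prob_space ?I by (rule prob_space_unit_interval)
  have s: "(\<lambda>t. t *\<^sub>R axis j (1::real)) \<in> borel_measurable ?I"
    by (simp add: unit_interval_measure_def measurable_restrict_space1)
  have iG: "integrable lborel (\<lambda>x. G x *v axis j 1)"
    by (rule integrable_bounded_linear[OF bounded_linear_matrix_apply G(3)])
  define A where "A h x = (LINT t|?I. G (x + h *\<^sub>R (t *\<^sub>R axis j 1)) *v axis j 1)" for h x
  obtain r where r: "strict_mono r" "AE x in lborel. (\<lambda>k. A (h (r k)) x) \<longlonglongrightarrow> G x *v axis j 1"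
    unfolding A_def by (rule average_shift_AE_subsequence[OF iG prob_space_unit_interval s h(1)]) blast
  have eq0: "AE x in lborel. x \<in> V \<longrightarrow> u (x + h k *\<^sub>R axis j 1) - u x = h k *\<^sub>R A (h k) x" for k
    unfolding A_def by (rule weak_grad_line_FTC[OF W wg u G(1,2) V VW])
  have eq: "AE x in lborel. x \<in> V \<longrightarrow> (1 / h k) *\<^sub>R (u (x + h k *\<^sub>R axis j 1) - u x) = A (h k) x" for k
    using eq0[of k] by eventually_elim (use h(2)[of k] in simp)
  obtain L where L: "L \<ge> 0" "\<And>x. norm (G x *v axis j 1) \<le> L"
    by (rule norm_matrix_axis_le[where G = G and j = j, OF G(2)]) blast
  have AL: "norm (A h x) \<le> L" for h x
  proof (cases "integrable ?I (\<lambda>t. G (x + h *\<^sub>R (t *\<^sub>R axis j 1)) *v axis j 1)")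
    case True
    have "norm (A h x) \<le> (LINT t|?I. norm (G (x + h *\<^sub>R (t *\<^sub>R axis j 1)) *v axis j 1))"
      unfolding A_def by (rule integral_norm_bound)
    also have "\<dots> \<le> (LINT t|?I. L)"
      using L True by (intro integral_mono) auto
    finally show ?thesis by (simp add: I.prob_space)
  qed (use L in \<open>simp add: A_def not_integrable_integral_eq\<close>)
  show ?thesis
  proof (rule that[OF r(1)])
    have "AE x in lborel. \<forall>k. x \<in> V \<longrightarrow> (1 / h k) *\<^sub>R (u (x + h k *\<^sub>R axis j 1) - u x) = A (h k) x"
      unfolding AE_all_countable using eq by blast
    with r(2) show "AE x in lborel. x \<in> V \<longrightarrow>
       (\<lambda>k. (1 / h (r k)) *\<^sub>R (u (x + h (r k) *\<^sub>R axis j 1) - u x)) \<longlonglongrightarrow> G x *v axis j 1"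
    proof eventually_elim
      case (elim x)
      show ?case
      proof
        assume x: "x \<in> V"
        show "(\<lambda>k. (1 / h (r k)) *\<^sub>R (u (x + h (r k) *\<^sub>R axis j 1) - u x)) \<longlonglongrightarrow> G x *v axis j 1"
          using elim(2)[rule_format, OF x] elim(1) by presburger
      qed
    qed
    show "AE x in lborel. x \<in> V \<longrightarrow> norm ((1 / h k) *\<^sub>R (u (x + h k *\<^sub>R axis j 1) - u x)) \<le> L" for k
      using eq[of k] by eventually_elim (use AL[of "h k"] in presburger)
  qed
qed

text \<open>Together with the previous lemma, a bounded weak gradient is the same as boundedly convergent
  difference quotients. Weak derivatives can thus be computed pointwise.\<close>

lemma has_weak_grad_from_difference_quotients:
  fixes u :: "real^'d \<Rightarrow> real^'k" and G :: "real^'d \<Rightarrow> real^'d^'k"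
  assumes W: "open W"
    and u: "u \<in> borel_measurable borel" "\<And>x. norm (u x) \<le> B"
    and G: "G \<in> borel_measurable borel" "\<And>x. norm (G x) \<le> C"
    and quotients: "\<And>K j. compact K \<Longrightarrow> K \<subseteq> W \<Longrightarrow>
      quotients_converge K (axis j 1) u (\<lambda>x. G x *v axis j 1)"
  shows "has_weak_grad W u G"
  unfolding has_weak_grad_iff_weak_deriv[OF W u G]
proof (intro allI)
  fix i j
  note [measurable] = u(1) G(1)
  show "weak_deriv W (axis j 1) (\<lambda>x. u x $ i) (\<lambda>x. G x $ i $ j)"
  proof (rule weak_deriv_from_difference_quotients)
    show "\<bar>u x $ i\<bar> \<le> B" for x using component_le_norm_cart[of "u x" i] u(2)[of x] by linarith
    fix K :: "(real^'d) set" assume "compact K" "K \<subseteq> W"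
    from quotients[OF this, of j] obtain h L where h: "h \<longlonglongrightarrow> 0" "\<forall>k. h k \<noteq> (0::real)"
      and l: "AE x in lborel. x \<in> K \<longrightarrow> (\<lambda>k. (1 / h k) *\<^sub>R (u (x + h k *\<^sub>R axis j 1) - u x)) \<longlonglongrightarrow> G x *v axis j 1"
      and b: "\<And>k. AE x in lborel. x \<in> K \<longrightarrow> norm ((1 / h k) *\<^sub>R (u (x + h k *\<^sub>R axis j 1) - u x)) \<le> L"
      unfolding quotients_converge_def by blast
    have comp: "((1 / h k) *\<^sub>R (u (x + h k *\<^sub>R axis j 1) - u x)) $ i
        = (1 / h k) *\<^sub>R (u (x + h k *\<^sub>R axis j 1) $ i - u x $ i)" for k x
      by simp
    have "AE x in lborel. x \<in> K \<longrightarrow>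
        (\<lambda>k. (1 / h k) *\<^sub>R (u (x + h k *\<^sub>R axis j 1) $ i - u x $ i)) \<longlonglongrightarrow> G x $ i $ j"
      using l
    proof eventually_elim
      case (elim x)
      show ?case
      proof
        assume "x \<in> K"
        from tendsto_vec_nth[OF elim[rule_format, OF this], of i]
        show "(\<lambda>k. (1 / h k) *\<^sub>R (u (x + h k *\<^sub>R axis j 1) $ i - u x $ i)) \<longlonglongrightarrow> G x $ i $ j"
          unfolding comp matrix_axis_component .
      qed
    qed
    moreover have "AE x in lborel. x \<in> K \<longrightarrow>
        norm ((1 / h k) *\<^sub>R (u (x + h k *\<^sub>R axis j 1) $ i - u x $ i)) \<le> L" for k
      using b[of k]
    proof eventually_elim
      case (elim x)
      show ?case
        using elim component_le_norm_cart[of "(1 / h k) *\<^sub>R (u (x + h k *\<^sub>R axis j 1) - u x)" i]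
        unfolding comp real_norm_def by linarith
    qed
    ultimately show "quotients_converge K (axis j 1) (\<lambda>x. u x $ i) (\<lambda>x. G x $ i $ j)"
      unfolding quotients_converge_def using h by blast
  qed auto
qed

lemma compact_neighbourhood:
  fixes K :: "'a::euclidean_space set"
  assumes K: "compact K" "K \<subseteq> W" and W: "open W"
  obtains \<delta> V where "\<delta> > 0" "open V" "K \<subseteq> V" "\<And>x y. x \<in> V \<Longrightarrow> norm y \<le> \<delta> \<Longrightarrow> x + y \<in> W"
    "\<And>x y. x \<in> K \<Longrightarrow> norm y \<le> \<delta> \<Longrightarrow> x + y \<in> V"
proof -
  obtain d where d: "d > 0" "\<And>x y. x \<in> K \<Longrightarrow> y \<in> - W \<Longrightarrow> d \<le> dist x y"
  proof -
    have "closed (- W)" "K \<inter> - W = {}" using W K(2) by auto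
    from separate_compact_closed[OF K(1) this] that show ?thesis by blast
  qed
  \<comment> \<open>Half of the distance goes to \<open>V\<close>, and a third of it to \<open>\<delta>\<close>.\<close>
  have dW: "y \<in> W" if "x \<in> K" "dist x y < d" for x y
    using d(2)[of x y] that by fastforce
  show ?thesis
  proof (rule that[of "d / 3" "\<Union>x\<in>K. ball x (d / 2)"])
    show "x + y \<in> W" if "x \<in> (\<Union>x\<in>K. ball x (d / 2))" "norm y \<le> d / 3" for x y
    proof -
      from that obtain z where z: "z \<in> K" "dist z x < d / 2" by auto
      have "dist z (x + y) \<le> dist z x + norm y" by (metis dist_triangle dist_add_cancel add_0_right dist_0_norm)
      also have "\<dots> < d" using z(2) that(2) d(1) by simp
      finally show ?thesis using dW[OF z(1)] by simp
    qed
    show "x + y \<in> (\<Union>x\<in>K. ball x (d / 2))" if "x \<in> K" "norm y \<le> d / 3" for x y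
    proof -
      have "dist x (x + y) < d / 2" using that(2) d(1) by (simp add: dist_norm)
      then show ?thesis using that(1) by auto
    qed
    show "K \<subseteq> (\<Union>x\<in>K. ball x (d / 2))" using d(1) by auto
  qed (use d(1) in auto)
qed

lemma null_step_sequence:
  assumes "\<delta> > (0::real)"
  obtains h where "h \<longlonglongrightarrow> 0" "\<And>k. h k > 0" "\<And>k. h k \<le> \<delta>"
proof (rule that[of "\<lambda>k. \<delta> * inverse (real (Suc k))"])
  show "(\<lambda>k. \<delta> * inverse (real (Suc k))) \<longlonglongrightarrow> 0"
    using tendsto_mult_right_zero[OF LIMSEQ_inverse_real_of_nat] by simp
qed (use assms in \<open>auto simp: field_simps\<close>)

lemma norm_scaled_axis_le:
  assumes "t \<in> {0..1}" "0 \<le> h" "h \<le> \<delta>"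
  shows "norm ((t * h) *\<^sub>R axis j (1::real)) \<le> \<delta>"
  using assms mult_left_le_one_le[of h t] by (auto simp: abs_mult)

text \<open>Near \<open>K\<close> the difference quotients are controlled by the weak gradient in \<open>W\<close>; away from
  \<open>K\<close> they vanish.\<close>

lemma weak_grad_zero_extension:
  fixes u :: "real^'d \<Rightarrow> real^'k" and G :: "real^'d \<Rightarrow> real^'d^'k"
  assumes W: "open W" and wg: "has_weak_grad W u G"
    and u: "u \<in> borel_measurable borel" "\<And>x. norm (u x) \<le> B"
    and G: "G \<in> borel_measurable borel" "\<And>x. norm (G x) \<le> C" "integrable lborel G"
    and K: "compact K" "K \<subseteq> W" and off: "\<And>x. x \<notin> K \<Longrightarrow> u x = 0" "\<And>x. x \<notin> K \<Longrightarrow> G x = 0"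
  shows "has_weak_grad UNIV u G"
proof (rule has_weak_grad_from_difference_quotients[OF open_UNIV u G(1,2)])
  fix K' :: "(real^'d) set" and j :: 'd
  obtain \<delta> V where \<delta>: "\<delta> > 0" and V: "open V" "K \<subseteq> V"
    and VW: "\<And>x y. x \<in> V \<Longrightarrow> norm y \<le> \<delta> \<Longrightarrow> x + y \<in> W"
    and KV: "\<And>x y. x \<in> K \<Longrightarrow> norm y \<le> \<delta> \<Longrightarrow> x + y \<in> V"
    by (rule compact_neighbourhood[OF K W]) blast
  obtain h where h: "h \<longlonglongrightarrow> 0" "\<And>k. h k > 0" "\<And>k. h k \<le> \<delta>" by (rule null_step_sequence[OF \<delta>]) blast
  have seg: "x + (t * h k) *\<^sub>R axis j 1 \<in> W" if "x \<in> V" "t \<in> {0..1}" for x t k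
    by (rule VW[OF that(1) norm_scaled_axis_le[OF that(2) less_imp_le[OF h(2)] h(3)]])
  have h0: "h k \<noteq> 0" for k using h(2)[of k] by simp
  obtain r L where r: "strict_mono (r :: nat \<Rightarrow> nat)"
    and l: "AE x in lborel. x \<in> V \<longrightarrow>
       (\<lambda>k. (1 / h (r k)) *\<^sub>R (u (x + h (r k) *\<^sub>R axis j 1) - u x)) \<longlonglongrightarrow> G x *v axis j 1"
    and b: "\<And>k. AE x in lborel. x \<in> V \<longrightarrow> norm ((1 / h k) *\<^sub>R (u (x + h k *\<^sub>R axis j 1) - u x)) \<le> L"
    by (rule weak_grad_difference_quotients[OF W wg u G h(1) h0 V(1) seg]) blast+
  \<comment> \<open>Increments are at most \<open>\<delta>\<close>, so from outside of \<open>V\<close> they do not reach \<open>K\<close>.\<close>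
  have zero: "u (x + h k *\<^sub>R axis j 1) - u x = 0" "G x = 0" if "x \<notin> V" for x k
  proof -
    have "x \<notin> K" using that V(2) by blast
    moreover have "x + h k *\<^sub>R axis j 1 \<notin> K"
    proof
      assume "x + h k *\<^sub>R axis j 1 \<in> K"
      then have "(x + h k *\<^sub>R axis j 1) + (- (h k *\<^sub>R axis j 1)) \<in> V"
        by (rule KV) (use h(2)[of k] h(3)[of k] in simp)
      with that show False by simp
    qed
    ultimately show "u (x + h k *\<^sub>R axis j 1) - u x = 0" "G x = 0" by (simp_all add: off)
  qed
  have "AE x in lborel. x \<in> K' \<longrightarrow>
      (\<lambda>k. (1 / h (r k)) *\<^sub>R (u (x + h (r k) *\<^sub>R axis j 1) - u x)) \<longlonglongrightarrow> G x *v axis j 1"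
    using l
  proof eventually_elim
    case (elim x)
    show ?case
    proof (cases "x \<in> V")
      case False
      show ?thesis by (simp add: zero[OF False])
    qed (use elim in blast)
  qed
  moreover have "AE x in lborel. x \<in> K' \<longrightarrow> norm ((1 / h (r k)) *\<^sub>R (u (x + h (r k) *\<^sub>R axis j 1) - u x)) \<le> max L 0" for k
    using b[of "r k"]
  proof eventually_elim
    case (elim x)
    show ?case
    proof (cases "x \<in> V")
      case False
      show ?thesis by (simp add: zero[OF False])
    qed (use elim in \<open>blast intro: max.coboundedI1\<close>)
  qed
  moreover have "(\<lambda>k. h (r k)) \<longlonglongrightarrow> 0" using LIMSEQ_subseq_LIMSEQ[OF h(1) r] by (simp add: o_def)
  ultimately show "quotients_converge K' (axis j 1) u (\<lambda>x. G x *v axis j 1)"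
    unfolding quotients_converge_def using h0 by (intro exI[of _ "\<lambda>k. h (r k)"] exI[of _ "max L 0"]) blast
qed

text \<open>Along a sequence of increments for which the difference quotients of \<open>w\<close> converge, those of
  \<open>P \<circ> w\<close> converge because \<open>P\<close> is differentiable at the value of \<open>w\<close>, and they are bounded because
  \<open>P\<close> is Lipschitz near it. The representatives \<open>p\<close> and \<open>H\<close> are prescribed on \<open>W\<close> only, as \<open>P\<close> need
  not make sense elsewhere.\<close>

lemma weak_chain_rule:
  fixes w :: "real^'d \<Rightarrow> real^'k" and G :: "real^'d \<Rightarrow> real^'d^'k" and P :: "real^'k \<Rightarrow> real^'l"
  assumes W: "open W" and wg: "has_weak_grad W w G"
    and w: "w \<in> borel_measurable borel" "\<And>x. norm (w x) \<le> B"
    and G: "G \<in> borel_measurable borel" "\<And>x. norm (G x) \<le> C" "integrable lborel G"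
    and r0: "r0 > 0"
    and lip: "\<And>x y. x \<in> W \<Longrightarrow> norm (y - w x) \<le> r0 \<Longrightarrow> norm (P y - P (w x)) \<le> Lip * norm (y - w x)"
    and P: "\<And>x. x \<in> W \<Longrightarrow> (P has_derivative (\<lambda>v. J (w x) *v v)) (at (w x))"
    and Pw: "p \<in> borel_measurable borel" "\<And>x. norm (p x) \<le> B'" "\<And>x. x \<in> W \<Longrightarrow> p x = P (w x)"
    and H: "H \<in> borel_measurable borel" "\<And>x. norm (H x) \<le> C'" "\<And>x. x \<in> W \<Longrightarrow> H x = J (w x) ** G x"
  shows "has_weak_grad W p H"
proof (rule has_weak_grad_from_difference_quotients[OF W Pw(1,2) H(1,2)])
  fix K :: "(real^'d) set" and j :: 'd
  assume K: "compact K" "K \<subseteq> W"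
  obtain \<delta> V where \<delta>: "\<delta> > 0" and V: "open V" "K \<subseteq> V"
    and VW: "\<And>x y. x \<in> V \<Longrightarrow> norm y \<le> \<delta> \<Longrightarrow> x + y \<in> W"
    by (rule compact_neighbourhood[OF K W]) blast
  obtain L0 where L0: "L0 \<ge> 0" "\<And>x. norm (G x *v axis j 1) \<le> L0"
    by (rule norm_matrix_axis_le[where G = G and j = j, OF G(2)]) blast
  obtain h0 where h0: "h0 \<longlonglongrightarrow> 0" "\<And>k. h0 k > 0" "\<And>k. h0 k \<le> \<delta>" by (rule null_step_sequence[OF \<delta>]) blast
  have seg0: "x + (t * h0 k) *\<^sub>R axis j 1 \<in> W" if "x \<in> V" "t \<in> {0..1}" for x t k
    by (rule VW[OF that(1) norm_scaled_axis_le[OF that(2) less_imp_le[OF h0(2)] h0(3)]])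
  have h00: "h0 k \<noteq> 0" for k using h0(2)[of k] by simp
  obtain r L where r: "strict_mono (r :: nat \<Rightarrow> nat)"
    and l: "AE x in lborel. x \<in> V \<longrightarrow>
       (\<lambda>k. (1 / h0 (r k)) *\<^sub>R (w (x + h0 (r k) *\<^sub>R axis j 1) - w x)) \<longlonglongrightarrow> G x *v axis j 1"
    and b: "\<And>k. AE x in lborel. x \<in> V \<longrightarrow> norm ((1 / h0 k) *\<^sub>R (w (x + h0 k *\<^sub>R axis j 1) - w x)) \<le> L"
    by (rule weak_grad_difference_quotients[OF W wg w G h0(1) h00 V(1) seg0]) blast+
  have h0r: "(\<lambda>k. h0 (r k)) \<longlonglongrightarrow> 0" using LIMSEQ_subseq_LIMSEQ[OF h0(1) r] by (simp add: o_def)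
  \<comment> \<open>Dropping the first terms keeps every increment of \<open>w\<close> below \<open>r0\<close>.\<close>
  have "(\<lambda>k. h0 (r k) * L) \<longlonglongrightarrow> 0" using tendsto_mult_left_zero[OF h0r] .
  then have "eventually (\<lambda>k. h0 (r k) * L < r0) sequentially" using r0 by (rule order_tendstoD)
  then obtain N where N: "\<And>k. k \<ge> N \<Longrightarrow> h0 (r k) * L < r0" by (auto simp: eventually_sequentially)
  define h where "h k = h0 (r (k + N))" for k
  have h: "h \<longlonglongrightarrow> 0" "\<And>k. h k > 0" "\<And>k. h k * L < r0"
    using LIMSEQ_ignore_initial_segment[OF h0r, of N] h0(2) N by (auto simp: h_def[abs_def])
  have hn: "h k \<noteq> 0" for k using h(2)[of k] by simp
  have lh: "AE x in lborel. x \<in> V \<longrightarrow> (\<lambda>k. (1 / h k) *\<^sub>R (w (x + h k *\<^sub>R axis j 1) - w x)) \<longlonglongrightarrow> G x *v axis j 1"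
    using l
  proof eventually_elim
    case (elim x)
    show ?case
    proof
      assume "x \<in> V"
      from LIMSEQ_ignore_initial_segment[OF elim[rule_format, OF this], of N]
      show "(\<lambda>k. (1 / h k) *\<^sub>R (w (x + h k *\<^sub>R axis j 1) - w x)) \<longlonglongrightarrow> G x *v axis j 1"
        unfolding h_def .
    qed
  qed
  have bh: "AE x in lborel. \<forall>k. x \<in> V \<longrightarrow> norm ((1 / h k) *\<^sub>R (w (x + h k *\<^sub>R axis j 1) - w x)) \<le> L"
    unfolding AE_all_countable h_def using b by blast
  have pw: "p (x + h k *\<^sub>R axis j 1) = P (w (x + h k *\<^sub>R axis j 1))" "p x = P (w x)" "x \<in> W" if "x \<in> K" for x k
  proof -
    have "x \<in> V" using that V(2) by blast
    from seg0[OF this, of 1 "r (k + N)"] have "x + h k *\<^sub>R axis j 1 \<in> W" by (simp add: h_def)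
    moreover show "x \<in> W" using that K(2) by blast
    ultimately show "p (x + h k *\<^sub>R axis j 1) = P (w (x + h k *\<^sub>R axis j 1))" "p x = P (w x)"
      by (simp_all add: Pw(3))
  qed
  have "AE x in lborel. x \<in> K \<longrightarrow> (\<lambda>k. (1 / h k) *\<^sub>R (p (x + h k *\<^sub>R axis j 1) - p x)) \<longlonglongrightarrow> H x *v axis j 1"
    using lh
  proof eventually_elim
    case (elim x)
    show ?case
    proof
      assume x: "x \<in> K"
      let ?q = "\<lambda>k. (1 / h k) *\<^sub>R (w (x + h k *\<^sub>R axis j 1) - w x)"
      have q: "?q \<longlonglongrightarrow> G x *v axis j 1" using elim x V(2) by blast
      have eq: "w x + h k *\<^sub>R ?q k = w (x + h k *\<^sub>R axis j 1)" for k using hn[of k] by simp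
      from has_derivative_sequentially[OF P[OF pw(3)[OF x]] h(1) hn q]
      have "(\<lambda>k. (1 / h k) *\<^sub>R (P (w (x + h k *\<^sub>R axis j 1)) - P (w x))) \<longlonglongrightarrow> J (w x) *v (G x *v axis j 1)"
        unfolding eq .
      then show "(\<lambda>k. (1 / h k) *\<^sub>R (p (x + h k *\<^sub>R axis j 1) - p x)) \<longlonglongrightarrow> H x *v axis j 1"
        unfolding pw(1,2)[OF x] H(3)[OF pw(3)[OF x]] matrix_vector_mul_assoc .
    qed
  qed
  moreover have "AE x in lborel. x \<in> K \<longrightarrow> norm ((1 / h k) *\<^sub>R (p (x + h k *\<^sub>R axis j 1) - p x)) \<le> \<bar>Lip\<bar> * L" for k
    using bh
  proof eventually_elim
    case (elim x)
    show ?case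
    proof
      assume x: "x \<in> K"
      then have "x \<in> V" using V(2) by blast
      with elim have q: "norm ((1 / h k) *\<^sub>R (w (x + h k *\<^sub>R axis j 1) - w x)) \<le> L" by blast
      then have d: "norm (w (x + h k *\<^sub>R axis j 1) - w x) \<le> h k * L"
        using h(2)[of k] by (simp add: divide_simps mult.commute)
      have "norm (P (w (x + h k *\<^sub>R axis j 1)) - P (w x)) \<le> Lip * norm (w (x + h k *\<^sub>R axis j 1) - w x)"
        using d h(3)[of k] by (intro lip pw(3)[OF x]) linarith
      also have "\<dots> \<le> \<bar>Lip\<bar> * (h k * L)" using d by (intro mult_mono) auto
      finally show "norm ((1 / h k) *\<^sub>R (p (x + h k *\<^sub>R axis j 1) - p x)) \<le> \<bar>Lip\<bar> * L"
        unfolding pw(1,2)[OF x] using h(2)[of k] by (simp add: divide_simps mult_ac)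
    qed
  qed
  ultimately show "quotients_converge K (axis j 1) p (\<lambda>x. H x *v axis j 1)"
    unfolding quotients_converge_def using h(1) hn by blast
qed

section \<open>Weak gradients of limits, of test functions and under rescaling\<close>

lemma has_weak_grad_subset:
  fixes u :: "real^'d \<Rightarrow> real^'k" and G :: "real^'d \<Rightarrow> real^'d^'k"
  assumes wg: "has_weak_grad W u G" and "open V" "open W" "V \<subseteq> W"
    and u: "u \<in> borel_measurable borel" "\<And>x. norm (u x) \<le> B"
    and G: "G \<in> borel_measurable borel" "\<And>x. norm (G x) \<le> C"
  shows "has_weak_grad V u G"
  using wg test_function_mono[OF _ \<open>V \<subseteq> W\<close>]
  unfolding has_weak_grad_iff_weak_deriv[OF \<open>open V\<close> u G] has_weak_grad_iff_weak_deriv[OF \<open>open W\<close> u G]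
    weak_deriv_def
  by blast

lemma bounded_integrable_borel:
  fixes f :: "'a::euclidean_space \<Rightarrow> 'b::euclidean_space"
  assumes "f \<in> borel_measurable borel" "\<And>x. norm (f x) \<le> B" "bounded S" "\<And>x. x \<notin> S \<Longrightarrow> f x = 0"
  shows "integrable lborel f"
proof -
  obtain R where R: "\<And>x. x \<in> S \<Longrightarrow> norm x \<le> R" using assms(3) by (auto simp: bounded_iff)
  have off: "f x = 0" if "x \<notin> cball 0 R" for x using that R[of x] assms(4)[of x] by auto
  show ?thesis
    using assms(1,2) off emeasure_bounded_finite[OF bounded_cball[of "0::'a" R]]
    by (intro integrableI_bounded_set[where A = "cball 0 R" and B = B]) (auto simp: less_top)
qed

lemma L1_limit_integral_mult:
  fixes f :: "'a::euclidean_space \<Rightarrow> real" and F :: "nat \<Rightarrow> 'a \<Rightarrow> real"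
  assumes f: "integrable lborel f" and F: "\<And>n. integrable lborel (F n)"
    and \<zeta>: "\<zeta> \<in> borel_measurable borel" "\<And>x. \<bar>\<zeta> x\<bar> \<le> B"
    and lim: "(\<lambda>n. LINT x|lborel. \<bar>f x - F n x\<bar>) \<longlonglongrightarrow> 0"
  shows "(\<lambda>n. LINT x|lborel. F n x * \<zeta> x) \<longlonglongrightarrow> (LINT x|lborel. f x * \<zeta> x)"
proof -
  have I: "integrable lborel (\<lambda>x. \<zeta> x * f x)" "integrable lborel (\<lambda>x. \<zeta> x * F n x)"
    "integrable lborel (\<lambda>x. \<zeta> x * \<bar>f x - F n x\<bar>)" for n
    by (rule integrable_bounded_mult[OF _ \<zeta>]; use f F in auto)+
  have "(\<lambda>n. (LINT x|lborel. F n x * \<zeta> x) - (LINT x|lborel. f x * \<zeta> x)) \<longlonglongrightarrow> 0"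
  proof (rule Lim_null_comparison[OF always_eventually[OF allI]])
    show "(\<lambda>n. B * (LINT x|lborel. \<bar>f x - F n x\<bar>)) \<longlonglongrightarrow> 0" using tendsto_mult_right_zero[OF lim] .
    fix n
    have "(LINT x|lborel. F n x * \<zeta> x) - (LINT x|lborel. f x * \<zeta> x) = (LINT x|lborel. \<zeta> x * F n x - \<zeta> x * f x)"
      using I by (simp add: mult.commute)
    also have "norm \<dots> \<le> (LINT x|lborel. norm (\<zeta> x * F n x - \<zeta> x * f x))" by (rule integral_norm_bound)
    also have "\<dots> \<le> (LINT x|lborel. B * \<bar>f x - F n x\<bar>)"
    proof (rule integral_mono)
      fix x
      have "norm (\<zeta> x * F n x - \<zeta> x * f x) = \<bar>\<zeta> x\<bar> * \<bar>f x - F n x\<bar>"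
        by (metis abs_minus_commute abs_mult real_norm_def right_diff_distrib)
      also have "\<dots> \<le> B * \<bar>f x - F n x\<bar>" by (intro mult_right_mono \<zeta>) auto
      finally show "norm (\<zeta> x * F n x - \<zeta> x * f x) \<le> B * \<bar>f x - F n x\<bar>" .
    qed (use I f F in auto)
    finally show "norm ((LINT x|lborel. F n x * \<zeta> x) - (LINT x|lborel. f x * \<zeta> x)) \<le> B * (LINT x|lborel. \<bar>f x - F n x\<bar>)"
      by simp
  qed
  then show ?thesis by (simp add: LIM_zero_iff)
qed

lemma bounded_linear_matrix_entry: "bounded_linear (\<lambda>A :: real^'d^'k. A $ i $ j)"
  by (rule bounded_linear_compose[OF bounded_linear_vec_nth bounded_linear_vec_nth])

lemma abs_matrix_entry_le: "\<bar>(A :: real^'d^'k) $ i $ j\<bar> \<le> norm A"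
  using component_le_norm_cart[of "A $ i" j] Finite_Cartesian_Product.norm_nth_le[of A i] by linarith

text \<open>The defining identity passes to the limit because test functions and their derivatives are
  bounded.\<close>

lemma weak_grad_L1_limit:
  fixes u :: "real^'d \<Rightarrow> real^'k" and G :: "real^'d \<Rightarrow> real^'d^'k"
  assumes wg: "\<And>n. has_weak_grad UNIV (U n) (H n)"
    and u: "u \<in> borel_measurable borel" "\<And>x. norm (u x) \<le> B" "integrable lborel u"
    and G: "G \<in> borel_measurable borel" "\<And>x. norm (G x) \<le> C" "integrable lborel G"
    and U: "\<And>n. U n \<in> borel_measurable borel" "\<And>n. \<exists>B. \<forall>x. norm (U n x) \<le> B" "\<And>n. integrable lborel (U n)"
    and H: "\<And>n. H n \<in> borel_measurable borel" "\<And>n. \<exists>B. \<forall>x. norm (H n x) \<le> B" "\<And>n. integrable lborel (H n)"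
    and lim: "(\<lambda>n. LINT x|lborel. norm (u x - U n x)) \<longlonglongrightarrow> 0" "(\<lambda>n. LINT x|lborel. norm (G x - H n x)) \<longlonglongrightarrow> 0"
  shows "has_weak_grad UNIV u G"
  unfolding has_weak_grad_iff_weak_deriv[OF open_UNIV u(1,2) G(1,2)] weak_deriv_def
proof (intro allI impI)
  fix i :: 'k and j :: 'd and \<eta> :: "real^'d \<Rightarrow> real"
  assume \<eta>: "test_function UNIV \<eta>"
  obtain B1 where B1: "\<And>x. norm (\<eta> x) \<le> B1" by (rule test_function_bound[OF \<eta>]) blast
  obtain B2 where B2: "\<And>x. norm (frechet_derivative \<eta> (at x) (axis j 1)) \<le> B2"
    by (rule test_function_derivative_bound[OF \<eta>, where v = "axis j 1"]) blast
  have eq: "(LINT x|lborel. U n x $ i * frechet_derivative \<eta> (at x) (axis j 1)) = - (LINT x|lborel. H n x $ i $ j * \<eta> x)" for n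
  proof -
    obtain b c where "\<And>x. norm (U n x) \<le> b" "\<And>x. norm (H n x) \<le> c" using U(2)[of n] H(2)[of n] by auto
    from has_weak_grad_iff_weak_deriv[OF open_UNIV U(1) this(1) H(1) this(2)] wg[of n] \<eta>
    show ?thesis unfolding weak_deriv_def by blast
  qed
  have "(\<lambda>n. LINT x|lborel. U n x $ i * frechet_derivative \<eta> (at x) (axis j 1))
      \<longlonglongrightarrow> (LINT x|lborel. u x $ i * frechet_derivative \<eta> (at x) (axis j 1))"
  proof (rule L1_limit_integral_mult)
    show "integrable lborel (\<lambda>x. u x $ i)" "\<And>n. integrable lborel (\<lambda>x. U n x $ i)"
      by (intro integrable_bounded_linear[OF bounded_linear_vec_nth] u U)+
    show "(\<lambda>n. LINT x|lborel. \<bar>u x $ i - U n x $ i\<bar>) \<longlonglongrightarrow> 0"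
    proof (rule Lim_null_comparison[OF always_eventually[OF allI] lim(1)])
      fix n
      have D: "integrable lborel (\<lambda>x. u x - U n x)" using u(3) U(3) by simp
      have "(LINT x|lborel. \<bar>u x $ i - U n x $ i\<bar>) \<le> (LINT x|lborel. norm (u x - U n x))"
        using integrable_bounded_linear[OF bounded_linear_vec_nth D, of i] D
          component_le_norm_cart[of "u x - U n x" i for x]
        by (intro integral_mono) auto
      then show "norm (LINT x|lborel. \<bar>u x $ i - U n x $ i\<bar>) \<le> (LINT x|lborel. norm (u x - U n x))" by simp
    qed
  qed (use B2 test_function_measurable(2)[OF \<eta>] in auto)
  moreover have "(\<lambda>n. LINT x|lborel. H n x $ i $ j * \<eta> x) \<longlonglongrightarrow> (LINT x|lborel. G x $ i $ j * \<eta> x)"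
  proof (rule L1_limit_integral_mult)
    show "integrable lborel (\<lambda>x. G x $ i $ j)" "\<And>n. integrable lborel (\<lambda>x. H n x $ i $ j)"
      by (intro integrable_bounded_linear[OF bounded_linear_matrix_entry] G H)+
    show "(\<lambda>n. LINT x|lborel. \<bar>G x $ i $ j - H n x $ i $ j\<bar>) \<longlonglongrightarrow> 0"
    proof (rule Lim_null_comparison[OF always_eventually[OF allI] lim(2)])
      fix n
      have D: "integrable lborel (\<lambda>x. G x - H n x)" using G(3) H(3) by simp
      have "(LINT x|lborel. \<bar>G x $ i $ j - H n x $ i $ j\<bar>) \<le> (LINT x|lborel. norm (G x - H n x))"
        using integrable_bounded_linear[OF bounded_linear_matrix_entry D, of i j] D
          abs_matrix_entry_le[of "G x - H n x" i j for x]
        by (intro integral_mono) auto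
      then show "norm (LINT x|lborel. \<bar>G x $ i $ j - H n x $ i $ j\<bar>) \<le> (LINT x|lborel. norm (G x - H n x))" by simp
    qed
  qed (use B1 test_function_measurable(1)[OF \<eta>] in auto)
  ultimately show "(LINT x|lborel. u x $ i * frechet_derivative \<eta> (at x) (axis j 1)) = - (LINT x|lborel. G x $ i $ j * \<eta> x)"
    unfolding eq by (rule LIMSEQ_unique[OF _ tendsto_minus])
qed

lemma jacobian_matrix_apply:
  assumes "f differentiable at x"
  shows "jacobian_matrix f x *v v = frechet_derivative f (at x) v"
  unfolding jacobian_matrix_def
  by (rule matrix_works) (simp add: linear_matrix_vector_mul_eq linear_frechet_derivative[OF assms])

lemma jacobian_matrix_entry: "jacobian_matrix f x $ i $ j = frechet_derivative f (at x) (axis j 1) $ i"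
  by (simp add: jacobian_matrix_def matrix_def)

lemma test_function_weak_grad:
  fixes \<psi> :: "real^'d \<Rightarrow> real^'k"
  assumes \<psi>: "test_function W \<psi>"
  shows "has_weak_grad UNIV \<psi> (jacobian_matrix \<psi>)"
    and "jacobian_matrix \<psi> \<in> borel_measurable borel"
    and "\<exists>C. \<forall>x. norm (jacobian_matrix \<psi> x) \<le> C"
    and "integrable lborel (jacobian_matrix \<psi>)"
    and "\<And>x. x \<notin> W \<Longrightarrow> jacobian_matrix \<psi> x = 0"
proof -
  have cont: "continuous_on UNIV (jacobian_matrix \<psi>)"
  proof -
    have "jacobian_matrix \<psi> = (\<lambda>x. \<chi> i j. frechet_derivative \<psi> (at x) (axis j 1) $ i)"
      by (simp add: fun_eq_iff vec_eq_iff jacobian_matrix_entry)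
    moreover have "continuous_on UNIV (\<lambda>x. \<chi> i j. frechet_derivative \<psi> (at x) (axis j 1) $ i)"
      by (intro continuous_on_vec_lambda continuous_on_component test_function_continuous_derivative[OF \<psi>])
    ultimately show ?thesis by simp
  qed
  obtain K where K: "compact K" "K \<subseteq> W" "\<And>x v. x \<notin> K \<Longrightarrow> frechet_derivative \<psi> (at x) v = 0"
    by (rule test_function_compact_support[OF \<psi>]) blast
  have off: "jacobian_matrix \<psi> x = 0" if "x \<notin> K" for x
    using K(3)[OF that] by (simp add: vec_eq_iff jacobian_matrix_entry)
  then show "\<And>x. x \<notin> W \<Longrightarrow> jacobian_matrix \<psi> x = 0" using K(2) by blast
  show m: "jacobian_matrix \<psi> \<in> borel_measurable borel" by (rule borel_measurable_continuous_onI[OF cont])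
  obtain C where C: "\<And>x. norm (jacobian_matrix \<psi> x) \<le> C"
    by (rule bounded_continuous_compact_support[OF cont K(1) off], assumption, rule that)
  then show "\<exists>C. \<forall>x. norm (jacobian_matrix \<psi> x) \<le> C" by blast
  show "integrable lborel (jacobian_matrix \<psi>)"
    by (rule integrable_continuous_compact_support[OF cont K(1) off])
  obtain B where B: "\<And>x. norm (\<psi> x) \<le> B" by (rule test_function_bound[OF \<psi>]) blast
  obtain L where L: "L \<ge> 0" "\<And>x y. norm (\<psi> x - \<psi> y) \<le> L * norm (x - y)" by (rule test_function_lipschitz[OF \<psi>]) blast
  show "has_weak_grad UNIV \<psi> (jacobian_matrix \<psi>)"
  proof (rule has_weak_grad_from_difference_quotients[OF open_UNIV test_function_measurable(1)[OF \<psi>] B m C])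
    fix K :: "(real^'d) set" and j :: 'd
    obtain h where h: "h \<longlonglongrightarrow> 0" "\<And>k. h k > 0" "\<And>k. h k \<le> (1::real)" by (rule null_step_sequence[of 1]) auto
    have hn: "h k \<noteq> 0" for k using h(2)[of k] by simp
    have "(\<lambda>k. (1 / h k) *\<^sub>R (\<psi> (x + h k *\<^sub>R axis j 1) - \<psi> x)) \<longlonglongrightarrow> jacobian_matrix \<psi> x *v axis j 1" for x
    proof -
      have "\<psi> differentiable at x" using test_function_has_derivative[OF \<psi>] by (auto simp: differentiable_def)
      from has_derivative_sequentially[OF test_function_has_derivative[OF \<psi>] h(1) hn tendsto_const[of "axis j 1"], of x]
      show ?thesis unfolding jacobian_matrix_apply[OF \<open>\<psi> differentiable at x\<close>] .
    qed
    moreover have "norm ((1 / h k) *\<^sub>R (\<psi> (x + h k *\<^sub>R axis j 1) - \<psi> x)) \<le> L" for x k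
      using L(2)[of "x + h k *\<^sub>R axis j 1" x] h(2)[of k] by (simp add: divide_simps mult.commute)
    ultimately show "quotients_converge K (axis j 1) \<psi> (\<lambda>x. jacobian_matrix \<psi> x *v axis j 1)"
      unfolding quotients_converge_def using h(1) hn by (intro exI[of _ h] exI[of _ L]) simp
  qed
qed

text \<open>Lebesgue measure is complete; thus representatives such as \<open>weak_grad\<close> are measurable.\<close>

lemma borel_measurable_lebesgue_on_AE:
  fixes f g :: "'a::euclidean_space \<Rightarrow> 'b::euclidean_space"
  assumes W: "W \<in> sets borel" and f: "f \<in> borel_measurable (lebesgue_on W)"
    and ae: "AE x in lebesgue_on W. f x = g x"
  shows "g \<in> borel_measurable (lebesgue_on W)"
proof -
  have WL: "W \<inter> space lebesgue \<in> sets lebesgue" using W by auto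
  have "(\<lambda>x. indicator W x *\<^sub>R f x) \<in> borel_measurable lebesgue"
    using f by (simp only: borel_measurable_restrict_space_iff[OF WL])
  moreover have "AE x in lebesgue. indicator W x *\<^sub>R f x = indicator W x *\<^sub>R g x"
    using ae unfolding AE_restrict_space_iff[OF WL] by eventually_elim (auto simp: indicator_def)
  ultimately have "(\<lambda>x. indicator W x *\<^sub>R g x) \<in> borel_measurable lebesgue"
    by (rule borel_measurable_AE)
  then show ?thesis by (simp only: borel_measurable_restrict_space_iff[OF WL])
qed

lemma LINT_norm_lebesgue_on_AE:
  fixes f f' :: "'a::euclidean_space \<Rightarrow> 'b::euclidean_space"
  assumes W: "W \<in> sets borel" and f': "f' \<in> borel_measurable borel" and ae: "AE x in lebesgue_on W. f x = f' x"
  shows "(LINT x|lebesgue_on W. norm (f x)) = (LINT x|lborel. indicator W x * norm (f' x))"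
proof -
  have f'm: "f' \<in> borel_measurable (lebesgue_on W)" by (rule borel_measurable_lebesgue_on[OF f'])
  have ae': "AE x in lebesgue_on W. f' x = f x" using ae by eventually_elim simp
  have "(LINT x|lebesgue_on W. norm (f x)) = (LINT x|lebesgue_on W. norm (f' x))"
    using ae f'm borel_measurable_lebesgue_on_AE[OF W f'm ae'] by (intro integral_cong_AE) auto
  also have "\<dots> = (LINT x|lborel. indicator W x *\<^sub>R norm (f' x))"
    using f' by (intro LINT_lebesgue_on_borel W) measurable
  finally show ?thesis by simp
qed

lemma W11_norm_eq_lborel:
  fixes u u' :: "real^'d \<Rightarrow> real^'k"
  assumes D: "open D" and wg: "has_weak_grad D u G"
    and u': "u' \<in> borel_measurable borel" "AE x in lebesgue_on D. u x = u' x"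
    and G': "G' \<in> borel_measurable borel" "AE x in lebesgue_on D. G x = G' x"
  shows "W11_norm D u = (LINT x|lborel. indicator D x * norm (u' x)) + (LINT x|lborel. indicator D x * norm (G' x))"
proof -
  have DB: "D \<in> sets borel" using D by simp
  have "AE x in lebesgue_on D. weak_grad D u x = G' x"
    using weak_grad_AE[OF D wg] G'(2) by eventually_elim simp
  from LINT_norm_lebesgue_on_AE[OF DB G'(1) this] LINT_norm_lebesgue_on_AE[OF DB u']
  show ?thesis by (simp add: W11_norm_def)
qed

text \<open>The extension by zero of an element of \<open>W1inf_zero D\<close> is the $W^{1,1}$ limit of the test functions
  that approximate it in \<open>D\<close>, and so has the extension by zero of its gradient as weak gradient on
  the whole space.\<close>

lemma W1inf_zero_extension:
  fixes \<phi> :: "real^'d \<Rightarrow> real^'k"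
  assumes D: "open D" "bounded D" and \<phi>: "\<phi> \<in> W1inf_zero D"
  obtains \<phi>' \<Phi> B C where "\<phi>' \<in> borel_measurable borel" "\<And>x. norm (\<phi>' x) \<le> B" "\<And>x. x \<notin> D \<Longrightarrow> \<phi>' x = 0"
    "\<Phi> \<in> borel_measurable borel" "\<And>x. norm (\<Phi> x) \<le> C" "\<And>x. x \<notin> D \<Longrightarrow> \<Phi> x = 0"
    "has_weak_grad UNIV \<phi>' \<Phi>" "AE x in lebesgue_on D. weak_grad D \<phi> x = \<Phi> x"
proof -
  from \<phi> obtain G where G: "has_weak_grad D \<phi> G" "G \<in> Lp \<infinity> D" and L: "\<phi> \<in> Lp \<infinity> D"
    by (auto simp: W1inf_zero_def W1p_def)
  from \<phi> obtain \<psi> where \<psi>: "\<And>n. test_function D (\<psi> n)"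
    and lim: "(\<lambda>n. W11_norm D (\<lambda>x. \<phi> x - \<psi> n x)) \<longlonglongrightarrow> 0"
    by (auto simp: W1inf_zero_def W11_zero_def)
  obtain \<phi>' B where \<phi>': "\<phi>' \<in> borel_measurable borel" "\<And>x. norm (\<phi>' x) \<le> B" "\<And>x. x \<notin> D \<Longrightarrow> \<phi>' x = 0"
    "AE x in lebesgue_on D. \<phi> x = \<phi>' x"
    by (rule Lp_infinity_representative[OF L D(1)]) blast
  obtain \<Phi> C where \<Phi>: "\<Phi> \<in> borel_measurable borel" "\<And>x. norm (\<Phi> x) \<le> C" "\<And>x. x \<notin> D \<Longrightarrow> \<Phi> x = 0"
    "AE x in lebesgue_on D. G x = \<Phi> x"
    by (rule Lp_infinity_representative[OF G(2) D(1)]) blast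
  have I\<phi>: "integrable lborel \<phi>'" by (rule bounded_integrable_borel[OF \<phi>'(1,2) D(2) \<phi>'(3)])
  have I\<Phi>: "integrable lborel \<Phi>" by (rule bounded_integrable_borel[OF \<Phi>(1,2) D(2) \<Phi>(3)])
  note T = test_function_weak_grad[OF \<psi>]
  note Tm = test_function_measurable(1)[OF \<psi>]
  have off: "\<psi> n x = 0" if "x \<notin> D" for n x
    by (rule test_function_compact_support[OF \<psi>[of n]]) (use that in blast)
  have bd: "\<exists>B. \<forall>x. norm (\<psi> n x) \<le> B" for n
    by (rule test_function_bound[OF \<psi>[of n]]) blast
  define a where "a n = (LINT x|lborel. norm (\<phi>' x - \<psi> n x))" for n
  define b where "b n = (LINT x|lborel. norm (\<Phi> x - jacobian_matrix (\<psi> n) x))" for n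
  have "W11_norm D (\<lambda>x. \<phi> x - \<psi> n x) = a n + b n" for n
  proof -
    obtain B' where B': "\<And>x. norm (\<psi> n x) \<le> B'" using bd by blast
    obtain C' where C': "\<And>x. norm (jacobian_matrix (\<psi> n) x) \<le> C'" using T(3) by blast
    have wg: "has_weak_grad D (\<lambda>x. \<phi> x - \<psi> n x) (\<lambda>x. G x - jacobian_matrix (\<psi> n) x)"
      by (rule has_weak_grad_diff[OF D(1) G(1) has_weak_grad_subset[OF T(1) D(1) open_UNIV subset_UNIV Tm B' T(2) C']])
    have "W11_norm D (\<lambda>x. \<phi> x - \<psi> n x)
        = (LINT x|lborel. indicator D x * norm (\<phi>' x - \<psi> n x)) + (LINT x|lborel. indicator D x * norm (\<Phi> x - jacobian_matrix (\<psi> n) x))"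
    proof (rule W11_norm_eq_lborel[OF D(1) wg])
      show "AE x in lebesgue_on D. \<phi> x - \<psi> n x = \<phi>' x - \<psi> n x" using \<phi>'(4) by eventually_elim simp
      show "AE x in lebesgue_on D. G x - jacobian_matrix (\<psi> n) x = \<Phi> x - jacobian_matrix (\<psi> n) x"
        using \<Phi>(4) by eventually_elim simp
    qed (use \<phi>'(1) \<Phi>(1) Tm T(2) in auto)
    also have "(\<lambda>x. indicator D x * norm (\<phi>' x - \<psi> n x)) = (\<lambda>x. norm (\<phi>' x - \<psi> n x))"
      using \<phi>'(3) off by (auto simp: indicator_def fun_eq_iff)
    also have "(\<lambda>x. indicator D x * norm (\<Phi> x - jacobian_matrix (\<psi> n) x)) = (\<lambda>x. norm (\<Phi> x - jacobian_matrix (\<psi> n) x))"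
      using \<Phi>(3) T(5) by (auto simp: indicator_def fun_eq_iff)
    finally show ?thesis by (simp add: a_def b_def)
  qed
  with lim have ab: "(\<lambda>n. a n + b n) \<longlonglongrightarrow> 0" by simp
  have nn: "a n \<ge> 0" "b n \<ge> 0" for n by (simp_all add: a_def b_def)
  \<comment> \<open>Both summands are nonnegative, hence each of them tends to \<open>0\<close>.\<close>
  have "a \<longlonglongrightarrow> 0" "b \<longlonglongrightarrow> 0"
    by (rule Lim_null_comparison[OF always_eventually[OF allI] ab]; use nn in simp)+
  then have "has_weak_grad UNIV \<phi>' \<Phi>"
    unfolding a_def b_def
    by (intro weak_grad_L1_limit[where U = \<psi> and H = "\<lambda>n. jacobian_matrix (\<psi> n)", OF T(1) \<phi>'(1,2) I\<phi> \<Phi>(1,2) I\<Phi> Tm bd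
          test_function_integrable[OF \<psi>] T(2) T(3) T(4)])
  moreover have "AE x in lebesgue_on D. weak_grad D \<phi> x = \<Phi> x"
    using weak_grad_AE[OF D(1) G(1)] \<Phi>(4) by eventually_elim simp
  ultimately show ?thesis using that[OF \<phi>'(1-3) \<Phi>(1-3)] by blast
qed

text \<open>The factor \<open>e\<close> in front of \<open>u\<close> keeps the gradient bounded while the perturbation
  becomes uniformly small.\<close>

lemma weak_grad_rescale:
  fixes u :: "real^'d \<Rightarrow> real^'k" and G :: "real^'d \<Rightarrow> real^'d^'k"
  assumes wg: "has_weak_grad UNIV u G" and e: "e > 0"
    and u: "u \<in> borel_measurable borel" "\<And>x. norm (u x) \<le> B"
    and G: "G \<in> borel_measurable borel" "\<And>x. norm (G x) \<le> C"
  shows "has_weak_grad UNIV (\<lambda>x. e *\<^sub>R u ((1 / e) *\<^sub>R (x - a))) (\<lambda>x. G ((1 / e) *\<^sub>R (x - a)))"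
proof -
  note [measurable] = u(1) G(1)
  have ub: "norm (e *\<^sub>R u ((1 / e) *\<^sub>R (x - a))) \<le> e * B" for x using e u(2) by simp
  show ?thesis
  proof (subst has_weak_grad_iff_weak_deriv[OF open_UNIV _ ub _ G(2)]; (measurable)?)
    show "\<forall>i j. weak_deriv UNIV (axis j 1) (\<lambda>x. (e *\<^sub>R u ((1 / e) *\<^sub>R (x - a))) $ i) (\<lambda>x. G ((1 / e) *\<^sub>R (x - a)) $ i $ j)"
      unfolding weak_deriv_def
    proof (intro allI impI)
      fix i :: 'k and j :: 'd and \<eta> :: "real^'d \<Rightarrow> real"
      assume \<eta>: "test_function UNIV \<eta>"
      note [measurable] = test_function_measurable[OF \<eta>]
      let ?\<eta> = "\<lambda>y. \<eta> (a + e *\<^sub>R y)"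
      have T: "test_function UNIV ?\<eta>" by (rule test_function_affine[OF \<eta>]) (use e in auto)
      have unscale: "(1 / e) *\<^sub>R (a + e *\<^sub>R y - a) = y" for y using e by simp
      have "(LINT x|lborel. (e *\<^sub>R u ((1 / e) *\<^sub>R (x - a))) $ i * frechet_derivative \<eta> (at x) (axis j 1))
          = \<bar>e\<bar> ^ DIM(real^'d) *\<^sub>R (LINT y|lborel. u y $ i * (e *\<^sub>R frechet_derivative \<eta> (at (a + e *\<^sub>R y)) (axis j 1)))"
        using e by (subst integral_lborel_affine[where c = e and a = a]) (simp_all add: unscale mult_ac)
      also have "(LINT y|lborel. u y $ i * (e *\<^sub>R frechet_derivative \<eta> (at (a + e *\<^sub>R y)) (axis j 1)))
          = (LINT y|lborel. u y $ i * frechet_derivative ?\<eta> (at y) (axis j 1))"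
        unfolding test_function_affine_derivative[OF \<eta>] ..
      also have "\<dots> = - (LINT y|lborel. G y $ i $ j * ?\<eta> y)"
        using wg T unfolding has_weak_grad_iff_weak_deriv[OF open_UNIV u G] weak_deriv_def by blast
      also have "\<bar>e\<bar> ^ DIM(real^'d) *\<^sub>R - (LINT y|lborel. G y $ i $ j * ?\<eta> y)
          = - (LINT x|lborel. G ((1 / e) *\<^sub>R (x - a)) $ i $ j * \<eta> x)"
        using e by (subst integral_lborel_affine[where c = e and a = a]) (simp_all add: unscale)
      finally show "(LINT x|lborel. (e *\<^sub>R u ((1 / e) *\<^sub>R (x - a))) $ i * frechet_derivative \<eta> (at x) (axis j 1))
          = - (LINT x|lborel. G ((1 / e) *\<^sub>R (x - a)) $ i $ j * \<eta> x)" .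
    qed
  qed
qed

section \<open>Weak gradients of mollifications\<close>

lemma mollify_measurable:
  fixes f :: "'a::euclidean_space \<Rightarrow> 'b::euclidean_space"
  assumes [measurable]: "f \<in> borel_measurable borel"
  shows "mollify h f \<in> borel_measurable borel"
proof -
  have "mollify h f \<in> borel_measurable lborel" unfolding mollify_def[abs_def] by measurable
  then show ?thesis by simp
qed

lemma mollifier_average_integrable:
  fixes f :: "'a::euclidean_space \<Rightarrow> 'b::euclidean_space"
  assumes [measurable]: "f \<in> borel_measurable borel" and b: "\<And>x. norm (f x) \<le> B"
  shows "integrable mollifier_measure (\<lambda>s. f (x + h *\<^sub>R s))"
proof -
  interpret prob_space "mollifier_measure :: 'a measure" by (rule prob_space_mollifier_measure)
  have "(\<lambda>s. f (x + h *\<^sub>R s)) \<in> borel_measurable mollifier_measure"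
    unfolding mollifier_measure_def by measurable
  then show ?thesis using b by (intro integrable_const_bound[where B = B]) auto
qed

lemma mollify_norm_le:
  fixes f :: "'a::euclidean_space \<Rightarrow> 'b::euclidean_space"
  assumes f: "f \<in> borel_measurable borel" and b: "\<And>x. norm (f x) \<le> B"
  shows "norm (mollify h f x) \<le> B"
proof -
  interpret prob_space "mollifier_measure :: 'a measure" by (rule prob_space_mollifier_measure)
  have "norm (mollify h f x) \<le> (LINT s|mollifier_measure. norm (f (x + h *\<^sub>R s)))"
    unfolding mollify_eq_average[OF f] by (rule integral_norm_bound)
  also have "\<dots> \<le> (LINT s|(mollifier_measure :: 'a measure). B)"
    using mollifier_average_integrable[OF f b] b by (intro integral_mono integrable_norm) auto
  finally show ?thesis by (simp add: prob_space)
qed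

lemma mollify_bounded_linear:
  fixes f :: "'a::euclidean_space \<Rightarrow> 'b::euclidean_space" and T :: "'b \<Rightarrow> real"
  assumes T: "bounded_linear T" and f: "f \<in> borel_measurable borel" and b: "\<And>x. norm (f x) \<le> B"
  shows "T (mollify h f x) = mollify h (\<lambda>x. T (f x)) x"
proof -
  have "(\<lambda>x. T (f x)) \<in> borel_measurable borel"
    by (rule borel_measurable_continuous_on[OF linear_continuous_on[OF T] f])
  then show ?thesis
    unfolding mollify_eq_average[OF f] by (simp add: mollify_eq_average
      integral_bounded_linear[OF T mollifier_average_integrable[OF f b]])
qed

lemma mollify_zero:
  assumes "h > 0" "\<And>y. norm y \<le> h \<Longrightarrow> f (x + y) = 0"
  shows "mollify h f x = 0"
proof -
  have *: "mollifier s *\<^sub>R f (x + h *\<^sub>R s) = 0" for s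
  proof (cases "norm s < 1")
    case True
    then have "norm (h *\<^sub>R s) \<le> h" using assms(1) by (simp add: mult_left_le)
    then show ?thesis using assms(2) by simp
  qed (simp add: mollifier_zero)
  show ?thesis unfolding mollify_def * by (rule integral_zero)
qed

text \<open>Mollification is an average of translations, each of which respects weak derivatives.\<close>

lemma weak_deriv_mollify:
  fixes u g :: "'a::euclidean_space \<Rightarrow> real"
  assumes wd: "weak_deriv UNIV v u g"
    and u[measurable]: "u \<in> borel_measurable borel" and ub: "\<And>x. \<bar>u x\<bar> \<le> Bu"
    and g[measurable]: "g \<in> borel_measurable borel" and gb: "\<And>x. \<bar>g x\<bar> \<le> Bg"
  shows "weak_deriv UNIV v (mollify h u) (mollify h g)"
  unfolding weak_deriv_def
proof (intro allI impI)
  let ?N = "mollifier_measure :: 'a measure"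
  interpret N: prob_space ?N by (rule prob_space_mollifier_measure)
  interpret P: pair_sigma_finite ?N "lborel :: 'a measure" ..
  have fN: "finite_measure ?N" by unfold_locales
  have id[measurable]: "(\<lambda>t. t) \<in> borel_measurable ?N" by (simp add: mollifier_measure_def)
  have fub: "(LINT x|lborel. mollify h f x * \<zeta> x) = (LINT s|?N. LINT x|lborel. f (x + h *\<^sub>R s) * \<zeta> x)"
    if f[measurable]: "f \<in> borel_measurable borel" and fb: "\<And>x. \<bar>f x\<bar> \<le> B"
      and z[measurable]: "\<zeta> \<in> borel_measurable borel" and zb: "\<And>x. \<bar>\<zeta> x\<bar> \<le> B'" and z0: "\<And>x. norm x > R \<Longrightarrow> \<zeta> x = 0"
    for f \<zeta> :: "'a \<Rightarrow> real" and B B' R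
  proof -
    have "(LINT x|lborel. mollify h f x * \<zeta> x) = (LINT x|lborel. LINT s|?N. f (x + h *\<^sub>R s) * \<zeta> x)"
      by (simp add: mollify_eq_average)
    also have "\<dots> = (LINT s|?N. LINT x|lborel. f (x + h *\<^sub>R s) * \<zeta> x)"
    proof (rule P.Fubini_integral)
      have B0: "B \<ge> 0" using fb[of 0] by linarith
      show "integrable (?N \<Otimes>\<^sub>M lborel) (\<lambda>(s, x). f (x + h *\<^sub>R s) * \<zeta> x)"
        by (rule integrable_pair_bounded[OF fN, where B = "B * B'" and R = R])
          (use z0 zb fb B0 in \<open>auto simp: abs_mult intro!: mult_mono\<close>)
    qed
    finally show ?thesis .
  qed
  fix \<eta> :: "'a \<Rightarrow> real" assume \<eta>: "test_function UNIV \<eta>"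
  note [measurable] = test_function_measurable[OF \<eta>]
  obtain R where R: "\<And>x. norm x > R \<Longrightarrow> \<eta> x = 0" "\<And>x v. norm x > R \<Longrightarrow> frechet_derivative \<eta> (at x) v = 0"
    by (rule test_function_support_cball[OF \<eta>]) blast
  obtain B1 where B1: "\<And>x. \<bar>\<eta> x\<bar> \<le> B1" by (rule test_function_bound[OF \<eta>]) auto
  let ?D = "\<lambda>x. frechet_derivative \<eta> (at x) v"
  obtain B2 where B2: "\<And>x. \<bar>?D x\<bar> \<le> B2" by (rule test_function_derivative_bound[OF \<eta>, where v = v]) auto
  have "(LINT x|lborel. mollify h u x * ?D x) = (LINT s|?N. LINT x|lborel. u (x + h *\<^sub>R s) * ?D x)"
    by (rule fub[OF u ub _ B2 R(2)]) measurable
  also have "\<dots> = (LINT s|?N. - (LINT x|lborel. g (x + h *\<^sub>R s) * \<eta> x))"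
  proof (intro Bochner_Integration.integral_cong refl)
    fix s :: 'a
    let ?\<eta> = "\<lambda>x. \<eta> (- (h *\<^sub>R s) + 1 *\<^sub>R x)"
    have T: "test_function UNIV ?\<eta>" by (rule test_function_affine[OF \<eta>]) auto
    have "(LINT x|lborel. u (x + h *\<^sub>R s) * ?D x) = (LINT x|lborel. u x * frechet_derivative ?\<eta> (at x) v)"
      unfolding test_function_affine_derivative[OF \<eta>]
      using integral_lborel_shift[of "\<lambda>x. u x * ?D (x - h *\<^sub>R s)" "h *\<^sub>R s"] by simp
    also have "\<dots> = - (LINT x|lborel. g x * ?\<eta> x)" using wd T by (simp add: weak_deriv_def)
    also have "(LINT x|lborel. g x * ?\<eta> x) = (LINT x|lborel. g (x + h *\<^sub>R s) * \<eta> x)"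
      using integral_lborel_shift[of "\<lambda>x. g x * \<eta> (x - h *\<^sub>R s)" "h *\<^sub>R s"] by simp
    finally show "(LINT x|lborel. u (x + h *\<^sub>R s) * ?D x) = - (LINT x|lborel. g (x + h *\<^sub>R s) * \<eta> x)" .
  qed
  also have "\<dots> = - (LINT s|?N. LINT x|lborel. g (x + h *\<^sub>R s) * \<eta> x)" by simp
  also have "(LINT s|?N. LINT x|lborel. g (x + h *\<^sub>R s) * \<eta> x) = (LINT x|lborel. mollify h g x * \<eta> x)"
    by (rule fub[OF g gb _ B1 R(1), symmetric]) measurable
  finally show "(LINT x|lborel. mollify h u x * ?D x) = - (LINT x|lborel. mollify h g x * \<eta> x)" .
qed

lemma weak_grad_mollify:
  fixes u :: "real^'d \<Rightarrow> real^'k" and G :: "real^'d \<Rightarrow> real^'d^'k"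
  assumes wg: "has_weak_grad UNIV u G"
    and u: "u \<in> borel_measurable borel" "\<And>x. norm (u x) \<le> B"
    and G: "G \<in> borel_measurable borel" "\<And>x. norm (G x) \<le> C"
  shows "has_weak_grad UNIV (mollify h u) (mollify h G)"
proof (subst has_weak_grad_iff_weak_deriv[OF open_UNIV mollify_measurable[OF u(1)] mollify_norm_le[OF u]
      mollify_measurable[OF G(1)] mollify_norm_le[OF G]], intro allI)
  fix i j
  have "weak_deriv UNIV (axis j 1) (mollify h (\<lambda>x. u x $ i)) (mollify h (\<lambda>x. G x $ i $ j))"
  proof (rule weak_deriv_mollify)
    show "weak_deriv UNIV (axis j 1) (\<lambda>x. u x $ i) (\<lambda>x. G x $ i $ j)"
      using wg has_weak_grad_iff_weak_deriv[OF open_UNIV u G] by blast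
    show "\<bar>u x $ i\<bar> \<le> B" for x using component_le_norm_cart[of "u x" i] u(2)[of x] by linarith
    show "\<bar>G x $ i $ j\<bar> \<le> C" for x using abs_matrix_entry_le[of "G x" i j] G(2)[of x] by linarith
  qed (use u(1) G(1) in measurable)
  then show "weak_deriv UNIV (axis j 1) (\<lambda>x. mollify h u x $ i) (\<lambda>x. mollify h G x $ i $ j)"
    using mollify_bounded_linear[where h = h, OF bounded_linear_vec_nth[of i] u]
      mollify_bounded_linear[where h = h, OF bounded_linear_matrix_entry[of i j] G] by simp
qed

section \<open>Traces under compactly supported perturbations\<close>

lemma W1p_1_iff: "u \<in> W1p 1 W \<longleftrightarrow>
    integrable (lebesgue_on W) u \<and> (\<exists>G. has_weak_grad W u G \<and> integrable (lebesgue_on W) G)"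
  by (simp add: W1p_def Lp_1_iff)

lemma W1p_1_add: "open W \<Longrightarrow> u \<in> W1p 1 W \<Longrightarrow> v \<in> W1p 1 W \<Longrightarrow> (\<lambda>x. u x + v x) \<in> W1p 1 W"
  unfolding W1p_1_iff by (blast intro: has_weak_grad_add Bochner_Integration.integrable_add)

lemma W1p_1_diff: "open W \<Longrightarrow> u \<in> W1p 1 W \<Longrightarrow> v \<in> W1p 1 W \<Longrightarrow> (\<lambda>x. u x - v x) \<in> W1p 1 W"
  unfolding W1p_1_iff by (blast intro: has_weak_grad_diff Bochner_Integration.integrable_diff)

lemma LINT_norm_cong_AE:
  fixes f g :: "'a::euclidean_space \<Rightarrow> 'b::euclidean_space"
  assumes W: "W \<in> sets borel" and f: "f \<in> borel_measurable (lebesgue_on W)"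
    and ae: "AE x in lebesgue_on W. f x = g x"
  shows "(LINT x|lebesgue_on W. norm (f x)) = (LINT x|lebesgue_on W. norm (g x))"
  using ae f borel_measurable_lebesgue_on_AE[OF W f ae] by (intro integral_cong_AE) auto

text \<open>The gradient part is not literally subadditive, as \<open>weak_grad\<close> of a sum is only almost everywhere
  the sum of the \<open>weak_grad\<close>s.\<close>

lemma W11_norm_triangle:
  assumes W: "open W" and u: "u \<in> W1p 1 W" and v: "v \<in> W1p 1 W"
  shows "W11_norm W (\<lambda>x. u x + v x) \<le> W11_norm W u + W11_norm W v"
proof -
  have WB: "W \<in> sets borel" using W by simp
  from u v obtain G H where G: "has_weak_grad W u G" "integrable (lebesgue_on W) G"
    and H: "has_weak_grad W v H" "integrable (lebesgue_on W) H"
    and I: "integrable (lebesgue_on W) u" "integrable (lebesgue_on W) v" by (auto simp: W1p_1_iff)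
  have wn: "(LINT x|lebesgue_on W. norm (weak_grad W w x)) = (LINT x|lebesgue_on W. norm (E x))"
    if wg: "has_weak_grad W w E" and iE: "integrable (lebesgue_on W) E" for w :: "real^'a \<Rightarrow> real^'b" and E
  proof -
    have "AE x in lebesgue_on W. E x = weak_grad W w x" using weak_grad_AE[OF W wg] by eventually_elim simp
    from LINT_norm_cong_AE[OF WB borel_measurable_integrable[OF iE] this] show ?thesis by simp
  qed
  have tri: "(LINT x|lebesgue_on W. norm (a x + b x)) \<le> (LINT x|lebesgue_on W. norm (a x)) + (LINT x|lebesgue_on W. norm (b x))"
    if "integrable (lebesgue_on W) a" "integrable (lebesgue_on W) b" for a b :: "real^'a \<Rightarrow> 'c::euclidean_space"
  proof -
    have "(LINT x|lebesgue_on W. norm (a x + b x)) \<le> (LINT x|lebesgue_on W. norm (a x) + norm (b x))"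
      using that by (intro integral_mono norm_triangle_ineq) auto
    then show ?thesis using that by simp
  qed
  show ?thesis
    using tri[OF I] tri[OF G(2) H(2)] wn[OF G] wn[OF H]
      wn[OF has_weak_grad_add[OF W G(1) H(1)] Bochner_Integration.integrable_add[OF G(2) H(2)]]
    by (simp add: W11_norm_def)
qed

lemma W1p_1_from_lborel:
  fixes u :: "real^'d \<Rightarrow> real^'k"
  assumes W: "open W" and wg: "has_weak_grad W u G" and I: "integrable lborel u" "integrable lborel G"
  shows "u \<in> W1p 1 W"
    and "W11_norm W u \<le> (LINT x|lborel. norm (u x)) + (LINT x|lborel. norm (G x))"
proof -
  have WB[measurable]: "W \<in> sets borel" using W by simp
  have m[measurable]: "u \<in> borel_measurable borel" "G \<in> borel_measurable borel"
    using borel_measurable_integrable[OF I(1)] borel_measurable_integrable[OF I(2)] by simp_all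
  have res: "integrable lborel (\<lambda>x. indicator W x *\<^sub>R f x)" if "integrable lborel f"
    for f :: "real^'d \<Rightarrow> 'c::euclidean_space"
    using that by (intro integrable_mult_indicator) auto
  show "u \<in> W1p 1 W"
    unfolding W1p_1_iff using wg LINT_lebesgue_on_borel(2)[OF WB m(1)] LINT_lebesgue_on_borel(2)[OF WB m(2)]
      res[OF I(1)] res[OF I(2)] by blast
  have le: "(LINT x|lborel. indicator W x * norm (f x)) \<le> (LINT x|lborel. norm (f x))" if "integrable lborel f"
    for f :: "real^'d \<Rightarrow> 'c::euclidean_space"
    using that integrable_norm[OF res[OF that]] by (intro integral_mono) (auto simp: indicator_def)
  show "W11_norm W u \<le> (LINT x|lborel. norm (u x)) + (LINT x|lborel. norm (G x))"
    using W11_norm_eq_lborel[OF W wg m(1) _ m(2)] le[OF I(1)] le[OF I(2)] by simp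
qed

text \<open>A continuous sequence that approximates \<open>n\<close> becomes one that approximates \<open>n + f\<close> by adding
  mollifications of \<open>f\<close>. For small radii these vanish on the boundary, so the trace is unchanged.\<close>

lemma has_trace_add_compact_support:
  fixes n f g :: "real^'d \<Rightarrow> real^'k" and G :: "real^'d \<Rightarrow> real^'d^'k"
  assumes W: "open W" and tr: "has_trace W n g" and wg: "has_weak_grad UNIV f G"
    and f: "f \<in> borel_measurable borel" "\<And>x. norm (f x) \<le> B" "integrable lborel f"
    and G: "G \<in> borel_measurable borel" "\<And>x. norm (G x) \<le> C" "integrable lborel G"
    and K: "compact K" "K \<subseteq> W" and off: "\<And>x. x \<notin> K \<Longrightarrow> f x = 0"
  shows "has_trace W (\<lambda>x. n x + f x) g"
proof -
  let ?H = "restrict_space (hausdorff_measure (CARD('d) - 1)) (frontier W)"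
  from tr obtain v where n: "n \<in> W1p 1 W" and ig: "integrable ?H g"
    and v: "\<And>j. v j \<in> W1p 1 W" "\<And>j. continuous_on (closure W) (v j)"
    and lim: "(\<lambda>j. W11_norm W (\<lambda>x. v j x - n x)) \<longlonglongrightarrow> 0"
      "(\<lambda>j. \<integral>\<^sup>+x. ennreal (norm (v j x - g x)) \<partial>?H) \<longlonglongrightarrow> 0"
    unfolding has_trace_def by blast
  obtain \<delta> V where \<delta>: "\<delta> > 0" and V: "open V" "K \<subseteq> V"
    and KV: "\<And>x y. x \<in> V \<Longrightarrow> norm y \<le> \<delta> \<Longrightarrow> x + y \<in> W"
    by (rule compact_neighbourhood[OF K W]) blast
  obtain h where h: "h \<longlonglongrightarrow> 0" "\<And>k. h k > 0" "\<And>k. h k \<le> \<delta>" by (rule null_step_sequence[OF \<delta>]) blast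
  define F where "F j = mollify (h j) f" for j
  have sub: "has_weak_grad W p q" if "has_weak_grad UNIV p q" "p \<in> borel_measurable borel" "\<And>x. norm (p x) \<le> b"
    "q \<in> borel_measurable borel" "\<And>x. norm (q x) \<le> c" for p :: "real^'d \<Rightarrow> real^'k" and q b c
    by (rule has_weak_grad_subset[OF that(1) W open_UNIV subset_UNIV that(2-5)])
  have wF: "has_weak_grad W (F j) (mollify (h j) G)" for j
    unfolding F_def
    by (rule sub[OF weak_grad_mollify[OF wg f(1,2) G(1,2)] mollify_measurable[OF f(1)] mollify_norm_le[OF f(1,2)]
          mollify_measurable[OF G(1)] mollify_norm_le[OF G(1,2)]])
  have wf: "has_weak_grad W f G" by (rule sub[OF wg f(1,2) G(1,2)])
  note mf = mollify_L1[OF f(3) h(1)] and mG = mollify_L1[OF G(3) h(1)]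
  have fW: "f \<in> W1p 1 W" by (rule W1p_1_from_lborel[OF W wf f(3) G(3)])
  have FW: "F j \<in> W1p 1 W" for j by (rule W1p_1_from_lborel[OF W wF mf(1)[folded F_def] mG(1)])
  have FfW: "(\<lambda>x. F j x - f x) \<in> W1p 1 W" for j by (rule W1p_1_diff[OF W FW fW])
  have Fzero: "F j x = 0" if "x \<in> frontier W" for j x
    unfolding F_def
  proof (rule mollify_zero[OF h(2)])
    fix y :: "real^'d" assume y: "norm y \<le> h j"
    have "x \<notin> W" using that W by (simp add: frontier_def interior_open)
    have "x + y \<notin> K"
    proof
      assume "x + y \<in> K"
      with V(2) have "(x + y) + (- y) \<in> W" by (intro KV) (use y h(3)[of j] in auto)
      with \<open>x \<notin> W\<close> show False by simp
    qed
    then show "f (x + y) = 0" by (rule off)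
  qed
  show ?thesis
    unfolding has_trace_def
  proof (intro conjI exI[of _ "\<lambda>j x. v j x + F j x"] allI)
    show "(\<lambda>x. n x + f x) \<in> W1p 1 W" by (rule W1p_1_add[OF W n fW])
    show "integrable ?H g" by (rule ig)
    show "(\<lambda>x. v j x + F j x) \<in> W1p 1 W" for j by (rule W1p_1_add[OF W v(1) FW])
    show "continuous_on (closure W) (\<lambda>x. v j x + F j x)" for j
      unfolding F_def by (intro continuous_on_add v(2) continuous_on_subset[OF mollify_continuous[OF f(3) h(2)] subset_UNIV])
    show "(\<lambda>j. W11_norm W (\<lambda>x. v j x + F j x - (n x + f x))) \<longlonglongrightarrow> 0"
    proof (rule Lim_null_comparison[OF always_eventually[OF allI]])
      let ?b = "\<lambda>j. (LINT x|lborel. norm (F j x - f x)) + (LINT x|lborel. norm (mollify (h j) G x - G x))"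
      show "(\<lambda>j. W11_norm W (\<lambda>x. v j x - n x) + ?b j) \<longlonglongrightarrow> 0"
        using tendsto_add[OF lim(1) tendsto_add[OF mf(2)[folded F_def] mG(2)]] by simp
      fix j
      have "W11_norm W (\<lambda>x. v j x + F j x - (n x + f x)) = W11_norm W (\<lambda>x. (v j x - n x) + (F j x - f x))"
        by (simp add: algebra_simps)
      also have "\<dots> \<le> W11_norm W (\<lambda>x. v j x - n x) + W11_norm W (\<lambda>x. F j x - f x)"
        by (rule W11_norm_triangle[OF W W1p_1_diff[OF W v(1) n] FfW])
      also have "W11_norm W (\<lambda>x. F j x - f x) \<le> ?b j"
        by (rule W1p_1_from_lborel(2)[OF W has_weak_grad_diff[OF W wF wf]
            Bochner_Integration.integrable_diff[OF mf(1)[folded F_def] f(3)] Bochner_Integration.integrable_diff[OF mG(1) G(3)]])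
      finally show "norm (W11_norm W (\<lambda>x. v j x + F j x - (n x + f x))) \<le> W11_norm W (\<lambda>x. v j x - n x) + ?b j"
        by (simp add: W11_norm_def)
    qed
    have "(\<integral>\<^sup>+x. ennreal (norm (v j x + F j x - g x)) \<partial>?H) = (\<integral>\<^sup>+x. ennreal (norm (v j x - g x)) \<partial>?H)" for j
      by (intro nn_integral_cong) (auto simp: space_restrict_space Fzero)
    then show "(\<lambda>j. \<integral>\<^sup>+x. ennreal (norm (v j x + F j x - g x)) \<partial>?H) \<longlonglongrightarrow> 0"
      using lim(2) by simp
  qed
qed

section \<open>Bounds for the projection in a tube\<close>

lemma Ck_on_3_regularity:
  fixes P :: "real^'k \<Rightarrow> real^'l"
  assumes U: "open U" and P: "Ck_on 3 U P"
  shows "\<And>y. y \<in> U \<Longrightarrow> (P has_derivative (\<lambda>v. jacobian_matrix P y *v v)) (at y)"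
    and "continuous_on U (jacobian_matrix P)"
proof -
  have d: "P differentiable_on U" and c: "\<And>v. (\<lambda>x. frechet_derivative P (at x) v) differentiable_on U"
    using P by (simp_all add: numeral_3_eq_3)
  show "(P has_derivative (\<lambda>v. jacobian_matrix P y *v v)) (at y)" if "y \<in> U" for y
  proof -
    have "P differentiable at y" using d that differentiable_on_eq_differentiable_at[OF U] by blast
    then show ?thesis
      unfolding jacobian_matrix_apply[OF \<open>P differentiable at y\<close>] by (rule frechet_derivative_works[THEN iffD1])
  qed
  have "jacobian_matrix P = (\<lambda>x. \<chi> i j. frechet_derivative P (at x) (axis j 1) $ i)"
    by (simp add: fun_eq_iff vec_eq_iff jacobian_matrix_entry)
  moreover have "continuous_on U (\<lambda>x. \<chi> i j. frechet_derivative P (at x) (axis j 1) $ i)"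
    by (intro continuous_on_vec_lambda continuous_on_component differentiable_imp_continuous_on c)
  ultimately show "continuous_on U (jacobian_matrix P)" by simp
qed

text \<open>A single radius \<open>r\<close> serves the whole compact set \<open>M\<close>. The segment from \<open>y\<close> to \<open>z\<close> stays within
  \<open>2 * r\<close> of \<open>M\<close>, where the derivative is bounded; the mean value inequality gives the Lipschitz bound.\<close>

lemma uniform_tube_bounds:
  fixes P :: "real^'k \<Rightarrow> real^'l"
  assumes U: "open U" and P: "Ck_on 3 U P" and M: "compact M" "M \<subseteq> U"
  obtains r C where "r > 0" "\<And>p y. p \<in> M \<Longrightarrow> norm (y - p) \<le> r \<Longrightarrow> y \<in> U"
    "\<And>p y. p \<in> M \<Longrightarrow> norm (y - p) \<le> r \<Longrightarrow> norm (jacobian_matrix P y) \<le> C"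
    "\<And>p y z. p \<in> M \<Longrightarrow> norm (y - p) \<le> r \<Longrightarrow> norm (z - y) \<le> r \<Longrightarrow> norm (P z - P y) \<le> C * norm (z - y)"
proof -
  obtain \<delta> V where \<delta>: "\<delta> > 0" and V: "open V" "M \<subseteq> V" and VU: "\<And>x y. x \<in> V \<Longrightarrow> norm y \<le> \<delta> \<Longrightarrow> x + y \<in> U"
    by (rule compact_neighbourhood[OF M U]) blast
  define Q where "Q = (\<Union>x\<in>M. \<Union>y\<in>cball 0 \<delta>. {x + y})"
  have Q: "compact Q" unfolding Q_def by (intro compact_sums' M compact_cball)
  have QI: "y \<in> Q" if "p \<in> M" "norm (y - p) \<le> \<delta>" for p y
    unfolding Q_def by (rule UN_I[OF that(1)], rule UN_I[of "y - p"]) (use that(2) in auto)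
  have QU: "Q \<subseteq> U" unfolding Q_def using V(2) by (auto intro!: VU)
  have "compact (jacobian_matrix P ` Q)"
    by (intro compact_continuous_image Q continuous_on_subset[OF Ck_on_3_regularity(2)[OF U P] QU])
  then obtain C where "\<forall>y\<in>Q. norm (jacobian_matrix P y) \<le> C"
    by (auto dest!: compact_imp_bounded simp: bounded_iff)
  then have C: "norm (jacobian_matrix P y) \<le> C" if "y \<in> Q" for y using that by blast
  obtain K where K: "K \<ge> 0" "\<And>(A :: real^'k^'l) v. norm (A *v v) \<le> norm A * K * norm v"
  proof -
    define K where "K = real CARD('l) * real CARD('k)"
    have "norm (A *v v) \<le> norm A * K * norm v" for A :: "real^'k^'l" and v
    proof -
      have "onorm ((*v) A) \<le> K * norm A"
        unfolding K_def by (rule onorm_le_matrix_component[OF abs_matrix_entry_le])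
      from order_trans[OF onorm[OF matrix_vector_mul_bounded_linear, of A v] mult_right_mono[OF this norm_ge_zero]]
      show ?thesis by (simp add: mult_ac)
    qed
    then show ?thesis using that[of K] by (simp add: K_def)
  qed
  show ?thesis
  proof (rule that[of "\<delta> / 2" "max C (\<bar>C\<bar> * K)"])
    fix p y assume p: "p \<in> M" "norm (y - p) \<le> \<delta> / 2"
    have yQ: "y \<in> Q" by (rule QI[OF p(1)]) (use p(2) \<delta> in linarith)
    then show "y \<in> U" using QU by blast
    show "norm (jacobian_matrix P y) \<le> max C (\<bar>C\<bar> * K)" using C[OF yQ] by simp
    fix z assume z: "norm (z - y) \<le> \<delta> / 2"
    have ball: "cball y (\<delta> / 2) \<subseteq> Q"
    proof
      fix w assume "w \<in> cball y (\<delta> / 2)"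
      then have "norm (w - y) \<le> \<delta> / 2" by (simp add: dist_norm norm_minus_commute)
      then show "w \<in> Q" using p(2) norm_triangle_ineq[of "w - y" "y - p"] by (intro QI[OF p(1)]) simp
    qed
    have "norm (P z - P y) \<le> (\<bar>C\<bar> * K) * norm (z - y)"
    proof (rule differentiable_bound[where f = P and x = z and y = y
          and f' = "\<lambda>w v. jacobian_matrix P w *v v", OF convex_cball[of y "\<delta> / 2"]])
      fix w assume w: "w \<in> cball y (\<delta> / 2)"
      show "(P has_derivative (\<lambda>v. jacobian_matrix P w *v v)) (at w within cball y (\<delta> / 2))"
        by (rule has_derivative_at_withinI[OF Ck_on_3_regularity(1)[OF U P subsetD[OF QU subsetD[OF ball w]]]])
      show "onorm (\<lambda>v. jacobian_matrix P w *v v) \<le> \<bar>C\<bar> * K"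
      proof (rule onorm_le)
        fix v :: "real^'k"
        have "norm (jacobian_matrix P w) \<le> \<bar>C\<bar>" using order_trans[OF C[of w] abs_ge_self] w ball by blast
        then have "norm (jacobian_matrix P w) * K * norm v \<le> \<bar>C\<bar> * K * norm v"
          by (intro mult_right_mono K) auto
        with K(2) show "norm (jacobian_matrix P w *v v) \<le> \<bar>C\<bar> * K * norm v" by (rule order_trans)
      qed
    next
      show "z \<in> cball y (\<delta> / 2)" "y \<in> cball y (\<delta> / 2)" using z \<delta> by (auto simp: dist_norm norm_minus_commute)
    qed
    also have "\<dots> \<le> max C (\<bar>C\<bar> * K) * norm (z - y)" by (intro mult_right_mono) auto
    finally show "norm (P z - P y) \<le> max C (\<bar>C\<bar> * K) * norm (z - y)" .
  qed (use \<delta> in simp)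
qed

section \<open>Energies of bounded maps\<close>

lemma bounded_bilinear_matrix_mult:
  "bounded_bilinear (\<lambda>(A :: real^'l^'k) (B :: real^'d^'l). A ** B)"
  unfolding bilinear_conv_bounded_bilinear[symmetric] bilinear_def
  by (auto intro!: linearI simp: vec_eq_iff matrix_matrix_mult_def sum_distrib_left algebra_simps
      sum.distrib)

lemma borel_measurable_matrix_mult:
  fixes A :: "'a \<Rightarrow> real^'l^'k" and B :: "'a \<Rightarrow> real^'d^'l"
  assumes "A \<in> borel_measurable M" "B \<in> borel_measurable M"
  shows "(\<lambda>x. A x ** B x) \<in> borel_measurable M"
  by (rule borel_measurable_continuous_Pair[OF assms])
    (intro bounded_bilinear.continuous_on[OF bounded_bilinear_matrix_mult] continuous_intros)

text \<open>For continuous functions that are only meaningful on a subset, such as the projection and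
  the Lagrangian.\<close>

lemma borel_measurable_compose_continuous_on:
  fixes f :: "'b::topological_space \<Rightarrow> 'c::real_normed_vector"
  assumes "continuous_on S f" "S \<in> sets borel" and W: "W \<in> sets borel"
    and u: "u \<in> borel_measurable borel" "\<And>x. x \<in> W \<Longrightarrow> u x \<in> S"
  shows "(\<lambda>x. if x \<in> W then f (u x) else 0) \<in> borel_measurable borel"
proof -
  have f: "(\<lambda>y. if y \<in> S then f y else 0) \<in> borel_measurable borel"
    by (rule borel_measurable_continuous_on_if) (use assms in auto)
  have "(\<lambda>x. if x \<in> W then (if u x \<in> S then f (u x) else 0) else 0) \<in> borel_measurable borel"
    using measurable_compose[OF u(1) f] W by measurable
  also have "(\<lambda>x. if x \<in> W then (if u x \<in> S then f (u x) else 0) else 0) = (\<lambda>x. if x \<in> W then f (u x) else 0)"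
    using u(2) by auto
  finally show ?thesis .
qed

lemma lagrangian_measurable:
  fixes F :: "real^'d \<Rightarrow> real^'k \<Rightarrow> real^'d^'k \<Rightarrow> real"
  assumes F: "continuous_on (closure \<Omega> \<times> M \<times> UNIV) (\<lambda>(x, y, A). F x y A)"
    and W: "open \<Omega>" and M: "closed M"
    and u: "u \<in> borel_measurable borel" "\<And>x. x \<in> \<Omega> \<Longrightarrow> u x \<in> M" and G: "G \<in> borel_measurable borel"
  shows "(\<lambda>x. if x \<in> \<Omega> then F x (u x) (G x) else 0) \<in> borel_measurable borel"
proof -
  have "closed (closure \<Omega> \<times> M \<times> (UNIV :: (real^'d^'k) set))" using M by (intro closed_Times) auto
  then have S: "closure \<Omega> \<times> M \<times> (UNIV :: (real^'d^'k) set) \<in> sets borel" by (rule borel_closed)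
  have "(\<lambda>x. if x \<in> \<Omega> then (case (x, u x, G x) of (x, y, A) \<Rightarrow> F x y A) else 0) \<in> borel_measurable borel"
    by (rule borel_measurable_compose_continuous_on[OF F S])
      (use W u G closure_subset[of \<Omega>] in \<open>auto intro!: borel_measurable_Pair\<close>)
  then show ?thesis unfolding prod.case .
qed

lemma lagrangian_bounded:
  fixes F :: "real^'d \<Rightarrow> real^'k \<Rightarrow> real^'d^'k \<Rightarrow> real"
  assumes F: "continuous_on (closure \<Omega> \<times> M \<times> UNIV) (\<lambda>(x, y, A). F x y A)"
    and W: "bounded \<Omega>" and M: "compact M"
  obtains B where "\<And>x y A. x \<in> \<Omega> \<Longrightarrow> y \<in> M \<Longrightarrow> norm A \<le> C \<Longrightarrow> \<bar>F x y A\<bar> \<le> B"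
proof -
  let ?S = "closure \<Omega> \<times> M \<times> cball (0 :: real^'d^'k) C"
  have "compact ?S" using W M by (intro compact_Times) (auto simp: compact_closure)
  moreover have "continuous_on ?S (\<lambda>(x, y, A). F x y A)"
    by (rule continuous_on_subset[OF F]) auto
  ultimately have "bounded ((\<lambda>(x, y, A). F x y A) ` ?S)"
    by (intro compact_imp_bounded compact_continuous_image)
  then obtain B where B: "\<forall>z\<in>?S. norm (case z of (x, y, A) \<Rightarrow> F x y A) \<le> B" by (auto simp: bounded_iff)
  have "\<bar>F x y A\<bar> \<le> B" if "x \<in> \<Omega>" "y \<in> M" "norm A \<le> C" for x y A
    using B[rule_format, of "(x, y, A)"] that closure_subset[of \<Omega>] by auto
  then show ?thesis by (rule that)
qed

text \<open>For a bounded integrand the two parts of \<open>energy\<close> are finite, and the extended difference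
  is an ordinary integral.\<close>

lemma energy_eq:
  fixes F :: "real^'d \<Rightarrow> real^'k \<Rightarrow> real^'d^'k \<Rightarrow> real"
  assumes W: "open \<Omega>"
    and m: "(\<lambda>x. if x \<in> \<Omega> then F x (u' x) (G' x) else 0) \<in> borel_measurable borel" (is "?f \<in> _")
    and i: "integrable lborel (\<lambda>x. if x \<in> \<Omega> then F x (u' x) (G' x) else 0)"
    and u: "AE x in lebesgue_on \<Omega>. u x = u' x" and G: "AE x in lebesgue_on \<Omega>. weak_grad \<Omega> u x = G' x"
  shows "energy F \<Omega> u = ereal (LINT x|lborel. (if x \<in> \<Omega> then F x (u' x) (G' x) else 0))"
proof -
  have WB: "\<Omega> \<in> sets borel" using W by simp
  have eq: "(\<lambda>x. indicator \<Omega> x *\<^sub>R ?f x) = ?f" by (auto simp: indicator_def)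
  note L = LINT_lebesgue_on_borel[OF WB m, unfolded eq]
  have int: "integrable (lebesgue_on \<Omega>) ?f" using L(2) i by simp
  have ae: "AE x in lebesgue_on \<Omega>. F x (u x) (weak_grad \<Omega> u x) = ?f x"
    using u G AE_space by eventually_elim simp
  have p: "(\<integral>\<^sup>+x. ennreal (F x (u x) (weak_grad \<Omega> u x)) \<partial>lebesgue_on \<Omega>) = (\<integral>\<^sup>+x. ennreal (?f x) \<partial>lebesgue_on \<Omega>)"
    using ae by (intro nn_integral_cong_AE) (auto elim!: eventually_mono)
  have n: "(\<integral>\<^sup>+x. ennreal (- F x (u x) (weak_grad \<Omega> u x)) \<partial>lebesgue_on \<Omega>) = (\<integral>\<^sup>+x. ennreal (- ?f x) \<partial>lebesgue_on \<Omega>)"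
    using ae by (intro nn_integral_cong_AE) (auto elim!: eventually_mono)
  have fin: "(\<integral>\<^sup>+x. ennreal (?f x) \<partial>lebesgue_on \<Omega>) \<noteq> \<infinity>" "(\<integral>\<^sup>+x. ennreal (- ?f x) \<partial>lebesgue_on \<Omega>) \<noteq> \<infinity>"
    using int unfolding real_integrable_def by auto
  have e: "enn2ereal X = ereal (enn2real X)" if "X \<noteq> \<infinity>" for X :: ennreal
    using that by (cases X) (auto simp: enn2ereal_ennreal)
  show ?thesis
    unfolding energy_def p n e[OF fin(1)] e[OF fin(2)] using real_lebesgue_integral_def[OF int] L(1) by simp
qed

section \<open>Projected competitors\<close>

text \<open>A map \<open>n\<close> into a compact set \<open>M\<close> that has a projection \<open>P\<close> with uniform bounds in a tube of
  radius \<open>r\<close>, together with bounded Borel representatives \<open>n'\<close> and \<open>N'\<close> of \<open>n\<close> and of its weak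
  gradient \<open>N\<close>.\<close>

locale manifold_valued_map =
  fixes \<Omega> :: "(real^'d) set" and U M :: "(real^'k) set" and P :: "real^'k \<Rightarrow> real^'k" and r C :: real
    and n n' :: "real^'d \<Rightarrow> real^'k" and N N' :: "real^'d \<Rightarrow> real^'d^'k" and B L :: real
  assumes W: "open \<Omega>" "bounded \<Omega>" and U: "open U" "Ck_on 3 U P"
    and M: "compact M" "M \<subseteq> U" "\<And>y. y \<in> M \<Longrightarrow> P y = y" and PM: "\<And>y. y \<in> U \<Longrightarrow> P y \<in> M"
    and tube: "r > 0" "\<And>p y. p \<in> M \<Longrightarrow> norm (y - p) \<le> r \<Longrightarrow> y \<in> U"
      "\<And>p y. p \<in> M \<Longrightarrow> norm (y - p) \<le> r \<Longrightarrow> norm (jacobian_matrix P y) \<le> C"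
      "\<And>p y z. p \<in> M \<Longrightarrow> norm (y - p) \<le> r \<Longrightarrow> norm (z - y) \<le> r \<Longrightarrow>
        norm (P z - P y) \<le> C * norm (z - y)"
    and n: "AE x in lebesgue_on \<Omega>. n x = n' x"
    and N: "has_weak_grad \<Omega> n N" "AE x in lebesgue_on \<Omega>. N x = N' x"
    and n': "n' \<in> borel_measurable borel" "\<And>x. norm (n' x) \<le> B"
      "\<And>x. x \<in> \<Omega> \<Longrightarrow> n' x \<in> M" "\<And>x. x \<notin> \<Omega> \<Longrightarrow> n' x = 0"
    and N': "N' \<in> borel_measurable borel" "\<And>x. norm (N' x) \<le> L" "\<And>x. x \<notin> \<Omega> \<Longrightarrow> N' x = 0"
begin

lemma domain_borel: "\<Omega> \<in> sets borel"
  using W by simp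

lemma weak_grad_representative: "has_weak_grad \<Omega> n' N'"
  by (rule has_weak_grad_cong_AE[OF W(1) N(1) n'(1) n N'(1) N(2)])

lemma perturbation_in_tube:
  assumes "x \<in> \<Omega>" "norm v \<le> r"
  shows "n' x + v \<in> U"
  by (rule tube(2)[OF n'(3)[OF assms(1)]]) (simp add: assms(2))

text \<open>The chain rule for \<open>P \<circ> (n' + \<phi>)\<close>, with representatives defined on the whole space.\<close>

lemma projected_weak_grad:
  assumes wg\<phi>: "has_weak_grad UNIV \<phi> \<Phi>"
    and \<phi>: "\<phi> \<in> borel_measurable borel" "\<And>x. norm (\<phi> x) \<le> b" "b \<le> r"
    and \<Phi>: "\<Phi> \<in> borel_measurable borel" "\<And>x. norm (\<Phi> x) \<le> L'"
  obtains p H BH where "p \<in> borel_measurable borel" "\<And>x. x \<in> \<Omega> \<Longrightarrow> p x = P (n' x + \<phi> x)"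
    "\<And>x. x \<in> \<Omega> \<Longrightarrow> p x \<in> M" "\<And>x. x \<notin> \<Omega> \<Longrightarrow> p x = 0"
    "H \<in> borel_measurable borel" "\<And>x. norm (H x) \<le> BH"
    "\<And>x. x \<in> \<Omega> \<Longrightarrow> H x = jacobian_matrix P (n' x + \<phi> x) ** (N' x + \<Phi> x)"
    "has_weak_grad \<Omega> p H"
proof -
  obtain K0 where K0: "K0 > 0" "\<And>(A :: real^'k^'k) (B :: real^'d^'k). norm (A ** B) \<le> norm A * norm B * K0"
    using bounded_bilinear.pos_bounded[OF bounded_bilinear_matrix_mult] by metis
  define w where "w x = n' x + \<phi> x" for x
  have w_near: "norm (w x - n' x) \<le> r" for x using order_trans[OF \<phi>(2,3)] by (simp add: w_def)
  have wU: "w x \<in> U" if "x \<in> \<Omega>" for x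
    unfolding w_def by (rule perturbation_in_tube[OF that order_trans[OF \<phi>(2,3)]])
  define G where "G x = (if x \<in> \<Omega> then N' x + \<Phi> x else 0)" for x
  have wm: "w \<in> borel_measurable borel" unfolding w_def[abs_def] using n'(1) \<phi>(1) by measurable
  have wb: "norm (w x) \<le> B + b" for x
    unfolding w_def using norm_triangle_ineq[of "n' x" "\<phi> x"] n'(2)[of x] \<phi>(2)[of x] by linarith
  have Gm: "G \<in> borel_measurable borel" unfolding G_def[abs_def] using N'(1) \<Phi>(1) domain_borel by measurable
  have LL: "0 \<le> L + L'"
    using order_trans[OF norm_ge_zero N'(2)] order_trans[OF norm_ge_zero \<Phi>(2)] by linarith
  have Gb: "norm (G x) \<le> L + L'" for x
    unfolding G_def using norm_triangle_ineq[of "N' x" "\<Phi> x"] N'(2)[of x] \<Phi>(2)[of x] LL by simp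
  have IG: "integrable lborel G" by (rule bounded_integrable_borel[OF Gm Gb W(2)]) (simp add: G_def)
  have w0: "has_weak_grad \<Omega> w (\<lambda>x. N' x + \<Phi> x)"
    unfolding w_def[abs_def]
    by (rule has_weak_grad_add[OF W(1) weak_grad_representative
          has_weak_grad_subset[OF wg\<phi> W(1) open_UNIV subset_UNIV \<phi>(1,2) \<Phi>]])
  have "AE x in lebesgue_on \<Omega>. N' x + \<Phi> x = G x"
    using AE_space by eventually_elim (simp add: G_def)
  then have wgw: "has_weak_grad \<Omega> w G"
    by (intro has_weak_grad_cong_AE[OF W(1) w0 wm _ Gm]) simp_all
  obtain BM where BM: "\<And>y. y \<in> M \<Longrightarrow> norm y \<le> BM" "BM \<ge> 0"
    using compact_imp_bounded[OF M(1)] by (auto simp: bounded_pos intro: less_imp_le)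
  define p where "p x = (if x \<in> \<Omega> then P (w x) else 0)" for x
  have contP: "continuous_on U P"
    using Ck_on_3_regularity(1)[OF U] has_derivative_continuous
    by (blast intro: continuous_at_imp_continuous_on)
  have pm: "p \<in> borel_measurable borel"
    unfolding p_def[abs_def]
    by (rule borel_measurable_compose_continuous_on[OF contP _ domain_borel wm wU]) (use U in auto)
  have pb: "norm (p x) \<le> BM" for x using BM PM[OF wU] by (auto simp: p_def)
  define J where "J x = (if x \<in> \<Omega> then jacobian_matrix P (w x) else 0)" for x
  have Jm: "J \<in> borel_measurable borel"
    unfolding J_def[abs_def]
    by (rule borel_measurable_compose_continuous_on[OF Ck_on_3_regularity(2)[OF U] _ domain_borel wm wU])
      (use U in auto)
  have Jb: "norm (J x) \<le> \<bar>C\<bar>" for x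
    using order_trans[OF tube(3)[OF n'(3) w_near] abs_ge_self] by (auto simp: J_def)
  define H where "H x = J x ** G x" for x
  have Hm: "H \<in> borel_measurable borel" unfolding H_def[abs_def] by (rule borel_measurable_matrix_mult[OF Jm Gm])
  have Hb: "norm (H x) \<le> \<bar>C\<bar> * (L + L') * K0" for x
  proof -
    have "norm (J x) * norm (G x) * K0 \<le> \<bar>C\<bar> * (L + L') * K0"
      using Jb Gb K0(1) LL by (intro mult_mono) auto
    with K0(2) show ?thesis unfolding H_def by (rule order_trans)
  qed
  have chain: "has_weak_grad \<Omega> p H"
  proof (rule weak_chain_rule[OF W(1) wgw wm wb Gm Gb IG tube(1), where P = P and J = "jacobian_matrix P" and Lip = C])
    show "x \<in> \<Omega> \<Longrightarrow> norm (y - w x) \<le> r \<Longrightarrow> norm (P y - P (w x)) \<le> C * norm (y - w x)" for x y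
      by (rule tube(4)[OF n'(3) w_near])
    show "(P has_derivative (\<lambda>v. jacobian_matrix P (w x) *v v)) (at (w x))" if "x \<in> \<Omega>" for x
      by (rule Ck_on_3_regularity(1)[OF U wU[OF that]])
    show "p x = P (w x)" if "x \<in> \<Omega>" for x using that by (simp add: p_def)
    show "H x = jacobian_matrix P (w x) ** G x" if "x \<in> \<Omega>" for x using that by (simp add: H_def J_def)
  qed (use pm pb Hm Hb in auto)
  show ?thesis
    by (rule that[OF pm _ _ _ Hm Hb _ chain]) (simp_all add: p_def H_def J_def G_def PM[OF wU] flip: w_def)
qed

text \<open>The gradient of a map into \<open>M\<close> is tangential: apply the chain rule to \<open>P \<circ> n' = n'\<close> and use
  uniqueness of weak gradients.\<close>

lemma projection_jacobian_weak_grad: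
  "AE x in lebesgue_on \<Omega>. jacobian_matrix P (n' x) ** N' x = N' x"
proof -
  have z: "has_weak_grad UNIV (\<lambda>_. 0 :: real^'k) (\<lambda>_. 0 :: real^'d^'k)"
    by (simp add: has_weak_grad_def locally_integrable_def)
  obtain p H BH where p: "\<And>x. x \<in> \<Omega> \<Longrightarrow> p x = P (n' x + 0)" "has_weak_grad \<Omega> p H"
    and H: "H \<in> borel_measurable borel" "\<And>x. x \<in> \<Omega> \<Longrightarrow> H x = jacobian_matrix P (n' x + 0) ** (N' x + 0)"
    by (rule projected_weak_grad[OF z, where b = 0 and L' = 0]) (use tube(1) in auto)
  have "AE x in lebesgue_on \<Omega>. p x = n' x"
    using AE_space by eventually_elim (simp add: p(1) M(3)[OF n'(3)])
  then have "has_weak_grad \<Omega> n' H"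
    by (rule has_weak_grad_cong_AE[OF W(1) p(2) n'(1) _ H(1)]) simp
  from has_weak_grad_unique[OF W(1) this weak_grad_representative] AE_space show ?thesis
    by eventually_elim (simp add: H(2))
qed

text \<open>Adding a small perturbation that is supported in a compact subset \<open>K\<close> and projecting back to
  \<open>M\<close> yields an admissible map near \<open>n\<close>: the difference to \<open>n\<close> vanishes off \<open>K\<close> and has a bounded
  weak gradient, so the trace is that of \<open>n\<close>, and the Lipschitz bound for \<open>P\<close> controls the
  distance. The Borel representatives of the competitor and of its gradient are \<open>p\<close> and \<open>H\<close>.\<close>

lemma projected_competitor:
  assumes adm_n: "n \<in> admissible \<Omega> \<Gamma> M n0"
    and wg\<phi>: "has_weak_grad UNIV \<phi> \<Phi>"
    and \<phi>: "\<phi> \<in> borel_measurable borel" "\<And>x. norm (\<phi> x) \<le> b" "b \<le> r"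
    and \<Phi>: "\<Phi> \<in> borel_measurable borel" "\<And>x. norm (\<Phi> x) \<le> L'"
    and K: "compact K" "K \<subseteq> \<Omega>" and off: "\<And>x. x \<notin> K \<Longrightarrow> \<phi> x = 0" "\<And>x. x \<notin> K \<Longrightarrow> \<Phi> x = 0"
  obtains m p H BH where "m \<in> admissible \<Omega> \<Gamma> M n0" "Linf_norm \<Omega> (\<lambda>x. n x - m x) \<le> ereal (\<bar>C\<bar> * b)"
    "AE x in lebesgue_on \<Omega>. m x = p x" "AE x in lebesgue_on \<Omega>. weak_grad \<Omega> m x = H x"
    "p \<in> borel_measurable borel" "\<And>x. x \<in> \<Omega> \<Longrightarrow> p x = P (n' x + \<phi> x)" "\<And>x. x \<in> \<Omega> \<Longrightarrow> p x \<in> M"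
    "H \<in> borel_measurable borel" "\<And>x. norm (H x) \<le> BH"
    "\<And>x. x \<in> \<Omega> \<Longrightarrow> H x = jacobian_matrix P (n' x + \<phi> x) ** (N' x + \<Phi> x)"
proof -
  have b0: "b \<ge> 0" by (rule order_trans[OF norm_ge_zero \<phi>(2)])
  obtain p H BH where p: "p \<in> borel_measurable borel" "\<And>x. x \<in> \<Omega> \<Longrightarrow> p x = P (n' x + \<phi> x)"
    "\<And>x. x \<in> \<Omega> \<Longrightarrow> p x \<in> M" "\<And>x. x \<notin> \<Omega> \<Longrightarrow> p x = 0"
    and H: "H \<in> borel_measurable borel" "\<And>x. norm (H x) \<le> BH"
      "\<And>x. x \<in> \<Omega> \<Longrightarrow> H x = jacobian_matrix P (n' x + \<phi> x) ** (N' x + \<Phi> x)"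
    and chain: "has_weak_grad \<Omega> p H"
    by (rule projected_weak_grad[OF wg\<phi> \<phi> \<Phi>]) blast
  define f where "f x = p x - n' x" for x
  have foff: "f x = 0" if "x \<notin> K" for x
    using that n'(3,4)[of x] M(3) off(1)[of x] p(2,4)[of x] by (cases "x \<in> \<Omega>") (auto simp: f_def)
  have fm: "f \<in> borel_measurable borel" unfolding f_def[abs_def] using p(1) n'(1) by measurable
  have fb: "norm (f x) \<le> \<bar>C\<bar> * b" for x
  proof (cases "x \<in> \<Omega>")
    case True
    have "f x = P (n' x + \<phi> x) - P (n' x)" using True M(3)[OF n'(3)[OF True]] by (simp add: f_def p(2))
    also have "norm \<dots> \<le> C * norm (n' x + \<phi> x - n' x)"
      using tube(1) order_trans[OF \<phi>(2,3)] by (intro tube(4)[OF n'(3)[OF True]]) auto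
    also have "\<dots> \<le> \<bar>C\<bar> * b" using \<phi>(2)[of x] by (intro mult_mono) auto
    finally show ?thesis .
  next
    case False
    then have "x \<notin> K" using K(2) by blast
    then show ?thesis using b0 by (simp add: foff)
  qed
  have If: "integrable lborel f" by (rule bounded_integrable_borel[OF fm fb compact_imp_bounded[OF K(1)] foff])
  \<comment> \<open>Off \<open>K\<close> the gradients \<open>H\<close> and \<open>N'\<close> agree only almost everywhere; the extension by zero
    is applied to a representative of their difference that vanishes there everywhere.\<close>
  define E where "E x = (if x \<in> K then H x - N' x else 0)" for x
  have KB: "K \<in> sets borel" using compact_imp_closed[OF K(1)] by (rule borel_closed)
  have Em: "E \<in> borel_measurable borel" unfolding E_def[abs_def] using KB H(1) N'(1) by measurable
  have Eb: "norm (E x) \<le> BH + L" for x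
  proof -
    have "norm (H x - N' x) \<le> BH + L"
      using norm_triangle_ineq4[of "H x" "N' x"] H(2)[of x] N'(2)[of x] by linarith
    moreover have "0 \<le> BH + L"
      using order_trans[OF norm_ge_zero H(2)[of x]] order_trans[OF norm_ge_zero N'(2)[of x]] by linarith
    ultimately show ?thesis by (simp add: E_def)
  qed
  have Eoff: "E x = 0" if "x \<notin> K" for x using that by (simp add: E_def)
  have IE: "integrable lborel E" by (rule bounded_integrable_borel[OF Em Eb compact_imp_bounded[OF K(1)] Eoff])
  have HE: "AE x in lebesgue_on \<Omega>. H x - N' x = E x"
    using projection_jacobian_weak_grad AE_space
  proof eventually_elim
    case (elim x)
    then show ?case by (cases "x \<in> K") (simp_all add: E_def H(3) off)
  qed
  have wgf: "has_weak_grad \<Omega> f E"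
    by (rule has_weak_grad_cong_AE[OF W(1) has_weak_grad_diff[OF W(1) chain weak_grad_representative] fm _ Em HE])
      (simp add: f_def)
  have wgfU: "has_weak_grad UNIV f E"
    by (rule weak_grad_zero_extension[OF W(1) wgf fm fb Em Eb IE K foff Eoff])
  define m where "m x = n x + f x" for x
  have mp: "AE x in lebesgue_on \<Omega>. m x = p x"
    using n by eventually_elim (simp add: m_def f_def)
  have wgm: "has_weak_grad \<Omega> m (\<lambda>x. N x + E x)"
    unfolding m_def[abs_def] by (rule has_weak_grad_add[OF W(1) N(1) wgf])
  have gm: "AE x in lebesgue_on \<Omega>. weak_grad \<Omega> m x = H x"
    using weak_grad_AE[OF W(1) wgm] N(2) HE
  proof eventually_elim
    case (elim x)
    then have "weak_grad \<Omega> m x = N' x + (H x - N' x)" by simp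
    then show ?case by simp
  qed
  from adm_n obtain g h where gh: "has_trace \<Omega> n g" "has_trace \<Omega> n0 h"
    "AE x in restrict_space (hausdorff_measure (CARD('d) - 1)) \<Gamma>. g x = h x"
    by (auto simp: admissible_def traces_agree_on_def)
  have trm: "has_trace \<Omega> m g"
    unfolding m_def[abs_def] by (rule has_trace_add_compact_support[OF W(1) gh(1) wgfU fm fb If Em Eb IE K foff])
  have adm: "m \<in> admissible \<Omega> \<Gamma> M n0"
  proof -
    have "m \<in> W1p 1 \<Omega>" using trm by (simp add: has_trace_def)
    moreover have "AE x in lebesgue_on \<Omega>. m x \<in> M"
      using mp AE_space by eventually_elim (simp add: p(3))
    ultimately show ?thesis
      using trm gh by (auto simp: admissible_def W1p_into_def traces_agree_on_def)
  qed
  have "Linf_norm \<Omega> (\<lambda>x. n x - m x) \<le> ereal (\<bar>C\<bar> * b)"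
    unfolding Linf_norm_def
  proof (rule esssup_I)
    have "(\<lambda>x. ereal (norm (n x - m x))) = (\<lambda>x. ereal (norm (f x)))" by (simp add: m_def)
    moreover have "(\<lambda>x. ereal (norm (f x))) \<in> borel_measurable (lebesgue_on \<Omega>)"
      using fm by (intro borel_measurable_lebesgue_on) measurable
    ultimately show "(\<lambda>x. ereal (norm (n x - m x))) \<in> borel_measurable (lebesgue_on \<Omega>)" by simp
    show "AE x in lebesgue_on \<Omega>. ereal (norm (n x - m x)) \<le> ereal (\<bar>C\<bar> * b)"
      using fb by (simp add: m_def)
  qed
  from that[OF adm this mp gm p(1,2,3) H] show ?thesis .
qed

section \<open>Blow-up\<close>

text \<open>Compare the minimizer with the competitor that is perturbed by \<open>e *\<^sub>R \<phi> ((x - a) / e)\<close>. Outside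
  of \<open>a + e D\<close> the two integrands agree almost everywhere because the gradient of \<open>n\<close> is tangential,
  so that the comparison localises; the substitution \<open>x = a + e y\<close> rescales it to \<open>D\<close>.\<close>

lemma rescaled_energy_inequality:
  fixes \<phi> :: "real^'d \<Rightarrow> real^'k" and F :: "real^'d \<Rightarrow> real^'k \<Rightarrow> real^'d^'k \<Rightarrow> real"
  assumes F: "continuous_on (closure \<Omega> \<times> M \<times> UNIV) (\<lambda>(x, y, A). F x y A)"
    and adm_n: "n \<in> admissible \<Omega> \<Gamma> M n0"
    and minimal: "\<And>m. m \<in> admissible \<Omega> \<Gamma> M n0 \<Longrightarrow> Linf_norm \<Omega> (\<lambda>x. n x - m x) < ereal \<delta> \<Longrightarrow>
      energy F \<Omega> n \<le> energy F \<Omega> m"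
    and D: "D \<in> sets borel" "D \<subseteq> ball 0 R"
    and wg\<phi>: "has_weak_grad UNIV \<phi> \<Phi>"
    and \<phi>: "\<phi> \<in> borel_measurable borel" "\<And>x. norm (\<phi> x) \<le> b" "\<And>x. x \<notin> D \<Longrightarrow> \<phi> x = 0"
    and \<Phi>: "\<Phi> \<in> borel_measurable borel" "\<And>x. norm (\<Phi> x) \<le> L'" "\<And>x. x \<notin> D \<Longrightarrow> \<Phi> x = 0"
    and e: "e > 0" "cball a (e * R) \<subseteq> \<Omega>" "e * b \<le> r" "\<bar>C\<bar> * (e * b) < \<delta>"
  defines "before y \<equiv> indicator D y * F (a + e *\<^sub>R y) (n' (a + e *\<^sub>R y)) (N' (a + e *\<^sub>R y))"
    and "after y \<equiv> indicator D y * F (a + e *\<^sub>R y) (P (n' (a + e *\<^sub>R y) + e *\<^sub>R \<phi> y))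
          (jacobian_matrix P (n' (a + e *\<^sub>R y) + e *\<^sub>R \<phi> y) ** (N' (a + e *\<^sub>R y) + \<Phi> y))"
  shows "before \<in> borel_measurable borel" "after \<in> borel_measurable borel"
    and "(LINT y|lborel. before y) \<le> (LINT y|lborel. after y)"
proof -
  have Mc: "closed M" by (rule compact_imp_closed[OF M(1)])
  define \<psi> where "\<psi> x = e *\<^sub>R \<phi> ((1 / e) *\<^sub>R (x - a))" for x
  define \<Psi> where "\<Psi> x = \<Phi> ((1 / e) *\<^sub>R (x - a))" for x
  have unscale: "(1 / e) *\<^sub>R (a + e *\<^sub>R y - a) = y" for y using e(1) by simp
  have inD: "a + e *\<^sub>R y \<in> cball a (e * R)" if "y \<in> D" for y
    using that D(2) e(1) by (auto simp: dist_norm intro!: mult_left_mono less_imp_le)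
  have outK: "(1 / e) *\<^sub>R (x - a) \<notin> D" if "x \<notin> cball a (e * R)" for x
  proof
    assume "(1 / e) *\<^sub>R (x - a) \<in> D"
    from inD[OF this] have "x \<in> cball a (e * R)" using e(1) by simp
    with that show False by blast
  qed
  have wg\<psi>: "has_weak_grad UNIV \<psi> \<Psi>"
    unfolding \<psi>_def[abs_def] \<Psi>_def[abs_def] by (rule weak_grad_rescale[OF wg\<phi> e(1) \<phi>(1,2) \<Phi>(1,2)])
  have \<psi>m: "\<psi> \<in> borel_measurable borel" unfolding \<psi>_def[abs_def] using \<phi>(1) by measurable
  have \<Psi>m: "\<Psi> \<in> borel_measurable borel" unfolding \<Psi>_def[abs_def] using \<Phi>(1) by measurable
  have \<psi>b: "norm (\<psi> x) \<le> e * b" for x using e(1) \<phi>(2) by (simp add: \<psi>_def)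
  have \<Psi>b: "norm (\<Psi> x) \<le> L'" for x using \<Phi>(2) by (simp add: \<Psi>_def)
  have \<psi>off: "\<psi> x = 0" if "x \<notin> cball a (e * R)" for x using \<phi>(3)[OF outK[OF that]] by (simp add: \<psi>_def)
  have \<Psi>off: "\<Psi> x = 0" if "x \<notin> cball a (e * R)" for x using \<Phi>(3)[OF outK[OF that]] by (simp add: \<Psi>_def)
  obtain m p H BH where adm: "m \<in> admissible \<Omega> \<Gamma> M n0" and dist: "Linf_norm \<Omega> (\<lambda>x. n x - m x) \<le> ereal (\<bar>C\<bar> * (e * b))"
    and mp: "AE x in lebesgue_on \<Omega>. m x = p x" and mH: "AE x in lebesgue_on \<Omega>. weak_grad \<Omega> m x = H x"
    and p: "p \<in> borel_measurable borel" "\<And>x. x \<in> \<Omega> \<Longrightarrow> p x = P (n' x + \<psi> x)" "\<And>x. x \<in> \<Omega> \<Longrightarrow> p x \<in> M"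
    and H: "H \<in> borel_measurable borel" "\<And>x. norm (H x) \<le> BH"
      "\<And>x. x \<in> \<Omega> \<Longrightarrow> H x = jacobian_matrix P (n' x + \<psi> x) ** (N' x + \<Psi> x)"
    by (rule projected_competitor[OF adm_n wg\<psi> \<psi>m \<psi>b e(3) \<Psi>m \<Psi>b compact_cball e(2) \<psi>off \<Psi>off]) blast+
  have le: "energy F \<Omega> n \<le> energy F \<Omega> m"
  proof (rule minimal[OF adm])
    have "ereal (\<bar>C\<bar> * (e * b)) < ereal \<delta>" using e(4) by simp
    with dist show "Linf_norm \<Omega> (\<lambda>x. n x - m x) < ereal \<delta>" by (rule le_less_trans)
  qed
  define fn where "fn x = (if x \<in> \<Omega> then F x (n' x) (N' x) else 0)" for x
  define fm where "fm x = (if x \<in> \<Omega> then F x (p x) (H x) else 0)" for x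
  have fnm: "fn \<in> borel_measurable borel"
    unfolding fn_def[abs_def] by (rule lagrangian_measurable[OF F W(1) Mc n'(1,3) N'(1)])
  have fmm: "fm \<in> borel_measurable borel"
    unfolding fm_def[abs_def] by (rule lagrangian_measurable[OF F W(1) Mc p(1,3) H(1)])
  obtain B0 where B0: "\<And>x y A. x \<in> \<Omega> \<Longrightarrow> y \<in> M \<Longrightarrow> norm A \<le> max L BH \<Longrightarrow> \<bar>F x y A\<bar> \<le> B0"
    by (rule lagrangian_bounded[OF F W(2) M(1), where C = "max L BH"]) blast
  have fnb: "norm (fn x) \<le> \<bar>B0\<bar>" for x
    using order_trans[OF B0[of x "n' x" "N' x"] abs_ge_self] n'(3) N'(2)[of x] by (auto simp: fn_def)
  have fmb: "norm (fm x) \<le> \<bar>B0\<bar>" for x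
    using order_trans[OF B0[of x "p x" "H x"] abs_ge_self] p(3) H(2)[of x] by (auto simp: fm_def)
  have fni: "integrable lborel fn" by (rule bounded_integrable_borel[OF fnm fnb W(2)]) (simp add: fn_def)
  have fmi: "integrable lborel fm" by (rule bounded_integrable_borel[OF fmm fmb W(2)]) (simp add: fm_def)
  have wn: "AE x in lebesgue_on \<Omega>. weak_grad \<Omega> n x = N' x"
    using weak_grad_AE[OF W(1) N(1)] N(2) by eventually_elim simp
  have "(LINT x|lborel. fn x) \<le> (LINT x|lborel. fm x)"
    using le energy_eq[OF W(1), of F n' N', folded fn_def, OF fnm fni n wn]
      energy_eq[OF W(1), of F p H, folded fm_def, OF fmm fmi mp mH] by simp
  then have nonneg: "0 \<le> (LINT x|lborel. fm x - fn x)" using fni fmi by simp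
  define S where "S x = (indicator D ((1 / e) *\<^sub>R (x - a)) :: real)" for x
  have Sm: "S \<in> borel_measurable borel" unfolding S_def[abs_def] using D(1) by measurable
  \<comment> \<open>Only points of \<open>a + e D\<close> contribute, because the gradient of \<open>n\<close> is tangential.\<close>
  have "(LINT x|lborel. fm x - fn x) = (LINT x|lborel. S x * (fm x - fn x))"
  proof (rule integral_cong_AE)
    show "AE x in lborel. fm x - fn x = S x * (fm x - fn x)"
      using projection_jacobian_weak_grad unfolding AE_lebesgue_on_iff[OF domain_borel]
    proof eventually_elim
      case (elim x)
      show ?case
      proof (cases "x \<in> \<Omega> \<and> (1 / e) *\<^sub>R (x - a) \<notin> D")
        case True
        then have "\<psi> x = 0" "\<Psi> x = 0" using \<phi>(3) \<Phi>(3) by (auto simp: \<psi>_def \<Psi>_def)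
        then have "p x = n' x" "H x = N' x" using True elim p(2) H(3) M(3)[OF n'(3)] by simp_all
        then show ?thesis by (simp add: fm_def fn_def)
      qed (auto simp: S_def fm_def fn_def)
    qed
  qed (use fnm fmm Sm in measurable)
  also have "\<dots> = \<bar>e\<bar> ^ DIM(real^'d) *\<^sub>R (LINT y|lborel. S (a + e *\<^sub>R y) * (fm (a + e *\<^sub>R y) - fn (a + e *\<^sub>R y)))"
    using e(1) by (intro integral_lborel_affine borel_measurable_times borel_measurable_diff Sm fnm fmm) simp
  finally have "0 \<le> \<bar>e\<bar> ^ DIM(real^'d) * (LINT y|lborel. S (a + e *\<^sub>R y) * (fm (a + e *\<^sub>R y) - fn (a + e *\<^sub>R y)))"
    using nonneg by simp
  moreover have "0 < \<bar>e\<bar> ^ DIM(real^'d)" using e(1) by simp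
  ultimately have nn2: "0 \<le> (LINT y|lborel. S (a + e *\<^sub>R y) * (fm (a + e *\<^sub>R y) - fn (a + e *\<^sub>R y)))"
    using mult_le_cancel_left_pos[of "\<bar>e\<bar> ^ DIM(real^'d)" 0] by simp
  have b_eq: "before = (\<lambda>y. indicator D y * fn (a + e *\<^sub>R y))"
  proof
    fix y show "before y = indicator D y * fn (a + e *\<^sub>R y)"
      using subsetD[OF e(2) inD] by (auto simp: before_def fn_def indicator_def)
  qed
  have a_eq: "after = (\<lambda>y. indicator D y * fm (a + e *\<^sub>R y))"
  proof
    fix y show "after y = indicator D y * fm (a + e *\<^sub>R y)"
    proof (cases "y \<in> D")
      case True
      then have x: "a + e *\<^sub>R y \<in> \<Omega>" using subsetD[OF e(2) inD] by blast
      have "\<psi> (a + e *\<^sub>R y) = e *\<^sub>R \<phi> y" "\<Psi> (a + e *\<^sub>R y) = \<Phi> y"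
        by (simp_all only: \<psi>_def \<Psi>_def unscale)
      then show ?thesis
        using True x p(2)[OF x] H(3)[OF x] by (simp add: after_def fm_def)
    qed (simp add: after_def)
  qed
  have Dm: "(indicator D :: real^'d \<Rightarrow> real) \<in> borel_measurable borel" using D(1) by measurable
  show bm: "before \<in> borel_measurable borel" unfolding b_eq using Dm fnm by measurable
  show am: "after \<in> borel_measurable borel" unfolding a_eq using Dm fmm by measurable
  have bD: "bounded D" using D(2) by (rule bounded_subset[OF bounded_ball])
  have bi: "integrable lborel before"
    by (rule bounded_integrable_borel[OF bm _ bD, where B = "\<bar>B0\<bar>"]) (use fnb in \<open>auto simp: b_eq indicator_def\<close>)
  have ai: "integrable lborel after"
    by (rule bounded_integrable_borel[OF am _ bD, where B = "\<bar>B0\<bar>"]) (use fmb in \<open>auto simp: a_eq indicator_def\<close>)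
  have "(\<lambda>y. S (a + e *\<^sub>R y) * (fm (a + e *\<^sub>R y) - fn (a + e *\<^sub>R y))) = (\<lambda>y. after y - before y)"
    unfolding a_eq b_eq S_def unscale by (simp add: right_diff_distrib)
  with nn2 show "(LINT y|lborel. before y) \<le> (LINT y|lborel. after y)"
    using ai bi by simp
qed

text \<open>Both sides converge by dominated convergence, all arguments of \<open>F\<close> staying in a compact set. In
  the limit the perturbation disappears from \<open>n\<close>, but its gradient does not.\<close>

lemma blow_up_limit:
  fixes \<phi> :: "real^'d \<Rightarrow> real^'k" and F :: "real^'d \<Rightarrow> real^'k \<Rightarrow> real^'d^'k \<Rightarrow> real"
  assumes F: "continuous_on (closure \<Omega> \<times> M \<times> UNIV) (\<lambda>(x, y, A). F x y A)"
    and D: "D \<in> sets borel" "bounded D"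
    and \<phi>: "\<And>x. norm (\<phi> x) \<le> b" and \<Phi>: "\<Phi> \<in> borel_measurable borel" "\<And>x. norm (\<Phi> x) \<le> L'"
    and a: "a \<in> \<Omega>" and e: "e \<longlonglongrightarrow> 0" "\<And>k. e k > 0" "\<And>k. e k * b \<le> r" "\<And>k y. y \<in> D \<Longrightarrow> a + e k *\<^sub>R y \<in> \<Omega>"
    and lim: "AE y in lborel. y \<in> D \<longrightarrow> (\<lambda>k. (n' (a + e k *\<^sub>R y), N' (a + e k *\<^sub>R y))) \<longlonglongrightarrow> (n' a, N' a)"
    and fix_grad: "jacobian_matrix P (n' a) ** N' a = N' a"
  defines "before k y \<equiv> indicator D y * F (a + e k *\<^sub>R y) (n' (a + e k *\<^sub>R y)) (N' (a + e k *\<^sub>R y))"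
    and "after k y \<equiv> indicator D y * F (a + e k *\<^sub>R y) (P (n' (a + e k *\<^sub>R y) + e k *\<^sub>R \<phi> y))
          (jacobian_matrix P (n' (a + e k *\<^sub>R y) + e k *\<^sub>R \<phi> y) ** (N' (a + e k *\<^sub>R y) + \<Phi> y))"
  assumes m: "\<And>k. before k \<in> borel_measurable borel" "\<And>k. after k \<in> borel_measurable borel"
    and le: "\<And>k. (LINT y|lborel. before k y) \<le> (LINT y|lborel. after k y)"
  shows "measure lborel D * F a (n' a) (N' a)
    \<le> (LINT y|lborel. indicator D y * F a (n' a) (N' a + jacobian_matrix P (n' a) ** \<Phi> y))"
proof -
  obtain K0 where K0: "K0 > 0" "\<And>(A :: real^'k^'k) (B :: real^'d^'k). norm (A ** B) \<le> norm A * norm B * K0"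
    using bounded_bilinear.pos_bounded[OF bounded_bilinear_matrix_mult] by metis
  have LL: "L + L' \<ge> 0" using N'(2)[of 0] \<Phi>(2)[of 0] norm_ge_zero[of "N' 0"] norm_ge_zero[of "\<Phi> 0"] by linarith
  define C1 where "C1 = max L (\<bar>C\<bar> * (L + L') * K0)"
  obtain B0 where B0: "\<And>x y A. x \<in> \<Omega> \<Longrightarrow> y \<in> M \<Longrightarrow> norm A \<le> C1 \<Longrightarrow> \<bar>F x y A\<bar> \<le> B0"
    by (rule lagrangian_bounded[OF F W(2) M(1), where C = C1]) blast
  have near: "norm (n' (a + e k *\<^sub>R y) + e k *\<^sub>R \<phi> y - n' (a + e k *\<^sub>R y)) \<le> r" for k y
  proof -
    have "norm (e k *\<^sub>R \<phi> y) \<le> e k * b" using e(2)[of k] \<phi>[of y] by simp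
    then show ?thesis using e(3)[of k] by simp
  qed
  have wU: "n' (a + e k *\<^sub>R y) + e k *\<^sub>R \<phi> y \<in> U" if "y \<in> D" for k y
    using near[of k y] by (intro perturbation_in_tube e(4) that) simp
  have AB: "norm (jacobian_matrix P (n' (a + e k *\<^sub>R y) + e k *\<^sub>R \<phi> y) ** (N' (a + e k *\<^sub>R y) + \<Phi> y)) \<le> C1"
    if "y \<in> D" for k y
  proof -
    have "norm (jacobian_matrix P (n' (a + e k *\<^sub>R y) + e k *\<^sub>R \<phi> y)) \<le> \<bar>C\<bar>"
      by (rule order_trans[OF tube(3)[OF n'(3)[OF e(4)[OF that]] near] abs_ge_self])
    moreover have "norm (N' (a + e k *\<^sub>R y) + \<Phi> y) \<le> L + L'"
      by (rule norm_triangle_le) (intro add_mono N'(2) \<Phi>(2))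
    ultimately have "norm (jacobian_matrix P (n' (a + e k *\<^sub>R y) + e k *\<^sub>R \<phi> y)) * norm (N' (a + e k *\<^sub>R y) + \<Phi> y) * K0
        \<le> \<bar>C\<bar> * (L + L') * K0"
      using K0(1) LL by (intro mult_mono) auto
    with K0(2) have "norm (jacobian_matrix P (n' (a + e k *\<^sub>R y) + e k *\<^sub>R \<phi> y) ** (N' (a + e k *\<^sub>R y) + \<Phi> y))
        \<le> \<bar>C\<bar> * (L + L') * K0" by (rule order_trans)
    then show ?thesis by (simp add: C1_def)
  qed
  have na: "n' a \<in> M" "n' a \<in> U" using n'(3)[OF a] M(2) by auto
  have contP: "isCont P (n' a)"
    by (rule has_derivative_continuous[OF Ck_on_3_regularity(1)[OF U na(2)]])
  have contJ: "isCont (jacobian_matrix P) (n' a)"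
    using Ck_on_3_regularity(2)[OF U] na(2) by (simp add: continuous_on_eq_continuous_at[OF U(1)])
  have Flim: "(\<lambda>k. F (x k) (u k) (A k)) \<longlonglongrightarrow> F a (n' a) A0"
    if "x \<longlonglongrightarrow> a" "u \<longlonglongrightarrow> n' a" "A \<longlonglongrightarrow> A0" "\<And>k. x k \<in> \<Omega>" "\<And>k. u k \<in> M"
    for x :: "nat \<Rightarrow> real^'d" and u and A :: "nat \<Rightarrow> real^'d^'k" and A0
  proof -
    have "(\<lambda>k. case (x k, u k, A k) of (x, y, A) \<Rightarrow> F x y A) \<longlonglongrightarrow> (case (a, n' a, A0) of (x, y, A) \<Rightarrow> F x y A)"
    proof (rule continuous_on_tendsto_compose[OF F])
      show "(\<lambda>k. (x k, u k, A k)) \<longlonglongrightarrow> (a, n' a, A0)" by (intro tendsto_Pair that)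
      show "(a, n' a, A0) \<in> closure \<Omega> \<times> M \<times> UNIV" using a na closure_subset[of \<Omega>] by auto
      show "\<forall>\<^sub>F k in sequentially. (x k, u k, A k) \<in> closure \<Omega> \<times> M \<times> UNIV"
        by (intro always_eventually allI) (use that(4,5) subsetD[OF closure_subset[of \<Omega>]] in simp)
    qed
    then show ?thesis by simp
  qed
  have xlim: "(\<lambda>k. a + e k *\<^sub>R y) \<longlonglongrightarrow> a" for y
    using tendsto_add[OF tendsto_const tendsto_scaleR[OF e(1) tendsto_const], of a y] by simp
  have dom: "integrable lborel (\<lambda>y. \<bar>B0\<bar> * indicator D y :: real)"
    using D emeasure_bounded_finite[OF D(2)] by (simp add: less_top)
  have "(\<lambda>k. LINT y|lborel. before k y) \<longlonglongrightarrow> (LINT y|lborel. indicator D y * F a (n' a) (N' a))"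
  proof (rule integral_dominated_convergence[OF _ _ dom])
    show "AE y in lborel. (\<lambda>k. before k y) \<longlonglongrightarrow> indicator D y * F a (n' a) (N' a)"
      using lim
    proof eventually_elim
      case (elim y)
      show ?case
      proof (cases "y \<in> D")
        case True
        with elim have l: "(\<lambda>k. (n' (a + e k *\<^sub>R y), N' (a + e k *\<^sub>R y))) \<longlonglongrightarrow> (n' a, N' a)" by blast
        have "(\<lambda>k. F (a + e k *\<^sub>R y) (n' (a + e k *\<^sub>R y)) (N' (a + e k *\<^sub>R y))) \<longlonglongrightarrow> F a (n' a) (N' a)"
          using tendsto_fst[OF l] tendsto_snd[OF l] True by (intro Flim xlim e n'(3)) auto
        with True show ?thesis by (simp add: before_def)
      qed (simp add: before_def)
    qed
    show "AE y in lborel. norm (before k y) \<le> \<bar>B0\<bar> * indicator D y" for k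
    proof (intro AE_I2)
      fix y
      show "norm (before k y) \<le> \<bar>B0\<bar> * indicator D y"
      proof (cases "y \<in> D")
        case True
        have "norm (N' (a + e k *\<^sub>R y)) \<le> C1" using N'(2)[of "a + e k *\<^sub>R y"] by (simp add: C1_def)
        from order_trans[OF B0[OF e(4)[OF True] n'(3)[OF e(4)[OF True]] this] abs_ge_self] True
        show ?thesis by (simp add: before_def)
      qed (simp add: before_def)
    qed
  qed (use D m in auto)
  moreover have "(\<lambda>k. LINT y|lborel. after k y) \<longlonglongrightarrow>
      (LINT y|lborel. indicator D y * F a (n' a) (N' a + jacobian_matrix P (n' a) ** \<Phi> y))"
  proof (rule integral_dominated_convergence[OF _ _ dom])
    show "AE y in lborel. (\<lambda>k. after k y) \<longlonglongrightarrow> indicator D y * F a (n' a) (N' a + jacobian_matrix P (n' a) ** \<Phi> y)"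
      using lim
    proof eventually_elim
      case (elim y)
      show ?case
      proof (cases "y \<in> D")
        case True
        with elim have l: "(\<lambda>k. (n' (a + e k *\<^sub>R y), N' (a + e k *\<^sub>R y))) \<longlonglongrightarrow> (n' a, N' a)" by blast
        have ln: "(\<lambda>k. n' (a + e k *\<^sub>R y) + e k *\<^sub>R \<phi> y) \<longlonglongrightarrow> n' a"
          using tendsto_add[OF tendsto_fst[OF l] tendsto_scaleR[OF e(1) tendsto_const[of "\<phi> y"]]] by simp
        have lN: "(\<lambda>k. N' (a + e k *\<^sub>R y) + \<Phi> y) \<longlonglongrightarrow> N' a + \<Phi> y"
          using tendsto_add[OF tendsto_snd[OF l] tendsto_const] by simp
        have lP: "(\<lambda>k. P (n' (a + e k *\<^sub>R y) + e k *\<^sub>R \<phi> y)) \<longlonglongrightarrow> n' a"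
          using isCont_tendsto_compose[OF contP ln] M(3)[OF na(1)] by simp
        have lA: "(\<lambda>k. jacobian_matrix P (n' (a + e k *\<^sub>R y) + e k *\<^sub>R \<phi> y) ** (N' (a + e k *\<^sub>R y) + \<Phi> y))
            \<longlonglongrightarrow> N' a + jacobian_matrix P (n' a) ** \<Phi> y"
          using bounded_bilinear.tendsto[OF bounded_bilinear_matrix_mult isCont_tendsto_compose[OF contJ ln] lN]
          by (simp add: matrix_add_ldistrib fix_grad)
        have "(\<lambda>k. F (a + e k *\<^sub>R y) (P (n' (a + e k *\<^sub>R y) + e k *\<^sub>R \<phi> y))
          (jacobian_matrix P (n' (a + e k *\<^sub>R y) + e k *\<^sub>R \<phi> y) ** (N' (a + e k *\<^sub>R y) + \<Phi> y)))
            \<longlonglongrightarrow> F a (n' a) (N' a + jacobian_matrix P (n' a) ** \<Phi> y)"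
          by (rule Flim[OF xlim lP lA e(4)[OF True] PM[OF wU[OF True]]])
        with True show ?thesis by (simp add: after_def)
      qed (simp add: after_def)
    qed
    show "AE y in lborel. norm (after k y) \<le> \<bar>B0\<bar> * indicator D y" for k
    proof (intro AE_I2)
      fix y
      show "norm (after k y) \<le> \<bar>B0\<bar> * indicator D y"
      proof (cases "y \<in> D")
        case True
        from order_trans[OF B0[OF e(4)[OF True] PM[OF wU[OF True]] AB[OF True]] abs_ge_self] True
        show ?thesis by (simp add: after_def)
      qed (simp add: after_def)
    qed
    have J\<Phi>: "(\<lambda>y. N' a + jacobian_matrix P (n' a) ** \<Phi> y) \<in> borel_measurable borel"
      using borel_measurable_matrix_mult[OF borel_measurable_const \<Phi>(1)] by measurable
    have "continuous_on UNIV (\<lambda>A. case (a, n' a, A) of (x, y, A) \<Rightarrow> F x y A)"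
      by (rule continuous_on_compose2[OF F]) (use a na closure_subset[of \<Omega>] in \<open>auto intro!: continuous_intros\<close>)
    then have "(\<lambda>A. F a (n' a) A) \<in> borel_measurable borel" by (intro borel_measurable_continuous_onI) simp
    from measurable_compose[OF J\<Phi> this]
    show "(\<lambda>y. indicator D y * F a (n' a) (N' a + jacobian_matrix P (n' a) ** \<Phi> y)) \<in> borel_measurable lborel"
      using D(1) by simp
  qed (use m in auto)
  ultimately have "(LINT y|lborel. indicator D y * F a (n' a) (N' a))
      \<le> (LINT y|lborel. indicator D y * F a (n' a) (N' a + jacobian_matrix P (n' a) ** \<Phi> y))"
    using le by (intro LIMSEQ_le) auto
  then show ?thesis by simp
qed

end

section \<open>Quasiconvexity in the interior\<close>

theorem theorem13:
  fixes \<Omega> \<Gamma>1 \<Gamma>2 :: "(real^'d) set"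
    and M U :: "(real^'k) set"
    and P :: "real^'k \<Rightarrow> real^'k"
    and n0 n :: "real^'d \<Rightarrow> real^'k"
    and F :: "real^'d \<Rightarrow> real^'k \<Rightarrow> real^'d^'k \<Rightarrow> real"
  assumes "bounded \<Omega>" and "lipschitz_domain \<Omega>"
    and "openin (top_of_set (frontier \<Omega>)) \<Gamma>1" and "openin (top_of_set (frontier \<Omega>)) \<Gamma>2"
    and "\<Gamma>1 \<in> sets (hausdorff_measure (CARD('d) - 1))"
    and "\<Gamma>2 \<in> sets (hausdorff_measure (CARD('d) - 1))"
    and "\<Gamma>1 \<inter> \<Gamma>2 = {}" and "frontier \<Omega> = closure \<Gamma>1 \<union> closure \<Gamma>2"
    and "closed M" and "bounded M" and "Ck_submanifold 4 M"
    and "open U" and "M \<subseteq> U" and "nearest_point_projection U M P" and "Ck_on 3 U P"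
    and "n0 \<in> W1p_into 1 \<Omega> M"
    and "continuous_on (closure \<Omega> \<times> M \<times> UNIV) (\<lambda>(x, y, A). F x y A)"
    and "n \<in> admissible \<Omega> \<Gamma>1 M n0 \<inter> W1p_into \<infinity> \<Omega> M"
    and "strong_local_minimizer F \<Omega> (admissible \<Omega> \<Gamma>1 M n0) n"
  shows "AE x in lebesgue_on \<Omega>.
    \<forall>D :: (real^'d) set. \<forall>\<phi> :: real^'d \<Rightarrow> real^'k.
      open D \<and> bounded D \<and> D \<noteq> {} \<and> \<phi> \<in> W1inf_zero D \<longrightarrow>
      F x (n x) (weak_grad \<Omega> n x)
        \<le> 1 / measure lebesgue D *
          (LINT y|lebesgue_on D.
             F x (n x) (weak_grad \<Omega> n x + jacobian_matrix P (n x) ** weak_grad D \<phi> y))"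
proof (cases "M = {}")
  case True
  \<comment> \<open>No point has a value in the empty set, so that the domain is a null set.\<close>
  have "AE x in lebesgue_on \<Omega>. n x \<in> M" using assms(18) by (simp add: W1p_into_def)
  then show ?thesis by eventually_elim (simp add: True)
next
  case False
  then obtain p0 where p0: "p0 \<in> M" by blast
  have W: "open \<Omega>" "bounded \<Omega>" using assms(1,2) by (auto simp: lipschitz_domain_def)
  have WB: "\<Omega> \<in> sets borel" using W by simp
  have U: "open U" "Ck_on 3 U P" and MU: "M \<subseteq> U" by fact+
  have Mc: "compact M" using assms(9,10) by (simp add: compact_eq_bounded_closed)
  have PM: "P y \<in> M" if "y \<in> U" for y
    using assms(14) that by (simp add: nearest_point_projection_def)
  have Pfix: "P y = y" if "y \<in> M" for y
  proof -
    have "dist y (P y) = infdist y M"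
      using assms(14) that MU by (auto simp: nearest_point_projection_def)
    with that show ?thesis by simp
  qed
  obtain r C where tube: "r > 0" "\<And>p y. p \<in> M \<Longrightarrow> norm (y - p) \<le> r \<Longrightarrow> y \<in> U"
    "\<And>p y. p \<in> M \<Longrightarrow> norm (y - p) \<le> r \<Longrightarrow> norm (jacobian_matrix P y) \<le> C"
    "\<And>p y z. p \<in> M \<Longrightarrow> norm (y - p) \<le> r \<Longrightarrow> norm (z - y) \<le> r \<Longrightarrow> norm (P z - P y) \<le> C * norm (z - y)"
    by (rule uniform_tube_bounds[OF U Mc MU]) blast
  have n_adm: "n \<in> admissible \<Omega> \<Gamma>1 M n0" using assms(18) by simp
  have nM: "AE x in lebesgue_on \<Omega>. n x \<in> M" and nL: "n \<in> Lp \<infinity> \<Omega>"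
    using assms(18) by (auto simp: W1p_into_def W1p_def)
  obtain N where N0: "has_weak_grad \<Omega> n N" "N \<in> Lp \<infinity> \<Omega>"
    using assms(18) by (auto simp: W1p_into_def W1p_def)
  obtain \<delta> where \<delta>: "\<delta> > 0" "\<And>m. m \<in> admissible \<Omega> \<Gamma>1 M n0 \<Longrightarrow> Linf_norm \<Omega> (\<lambda>x. n x - m x) < ereal \<delta> \<Longrightarrow>
      energy F \<Omega> n \<le> energy F \<Omega> m"
    using assms(19) by (auto simp: strong_local_minimizer_def)
  obtain n1 B1 where n1: "n1 \<in> borel_measurable borel" "\<And>x. norm (n1 x) \<le> B1" "\<And>x. x \<notin> \<Omega> \<Longrightarrow> n1 x = 0"
    "AE x in lebesgue_on \<Omega>. n x = n1 x"
    by (rule Lp_infinity_representative[OF nL W(1)]) blast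
  obtain N' L where N': "N' \<in> borel_measurable borel" "\<And>x. norm (N' x) \<le> L" "\<And>x. x \<notin> \<Omega> \<Longrightarrow> N' x = 0"
    and NN: "AE x in lebesgue_on \<Omega>. N x = N' x"
    by (rule Lp_infinity_representative[OF N0(2) W(1)]) blast
  \<comment> \<open>Values in \<open>M\<close> at every point of the domain, because \<open>F\<close> is only controlled there; the value \<open>0\<close>
    outside makes the representative integrable.\<close>
  define n' where "n' x = (if x \<in> \<Omega> then (if n1 x \<in> M then n1 x else p0) else 0)" for x
  obtain BM where BM: "BM \<ge> 0" "\<And>y. y \<in> M \<Longrightarrow> norm y \<le> BM"
    using compact_imp_bounded[OF Mc] by (auto simp: bounded_pos intro: less_imp_le)
  have n'm: "n' \<in> borel_measurable borel"
    unfolding n'_def[abs_def] using n1(1) WB borel_closed[OF assms(9)] by measurable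
  have n'M: "n' x \<in> M" if "x \<in> \<Omega>" for x using that p0 by (simp add: n'_def)
  have n'0: "n' x = 0" if "x \<notin> \<Omega>" for x using that by (simp add: n'_def)
  have n'b: "norm (n' x) \<le> BM" for x using BM n'M[of x] n'0[of x] by (cases "x \<in> \<Omega>") auto
  have nn': "AE x in lebesgue_on \<Omega>. n x = n' x"
    using n1(4) nM AE_space by eventually_elim (auto simp: n'_def)
  have wn: "AE x in lebesgue_on \<Omega>. weak_grad \<Omega> n x = N' x"
    using weak_grad_AE[OF W(1) N0(1)] NN by eventually_elim simp
  interpret manifold_valued_map \<Omega> U M P r C n n' N N' BM L
    by unfold_locales (fact W U Mc MU Pfix PM tube nn' N0(1) NN n'm n'b n'M n'0 N')+
  note fix_grad = projection_jacobian_weak_grad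
  define h where "h k = inverse (real (Suc k))" for k
  have h: "h \<longlonglongrightarrow> 0" "\<And>k. h k > 0" using LIMSEQ_inverse_real_of_nat by (auto simp: h_def[abs_def])
  have Ig: "integrable lborel (\<lambda>x. (n' x, N' x))"
  proof (rule bounded_integrable_borel[OF _ _ W(2)])
    show "(\<lambda>x. (n' x, N' x)) \<in> borel_measurable borel" using n'm N'(1) by (rule borel_measurable_Pair)
    show "norm (n' x, N' x) \<le> BM + L" for x
      using norm_Pair_le[of "n' x" "N' x"] n'b[of x] N'(2)[of x] by linarith
    show "(n' x, N' x) = 0" if "x \<notin> \<Omega>" for x using n'0[OF that] N'(3)[OF that] by (simp add: zero_prod_def)
  qed
  \<comment> \<open>The scales depend on the radius \<open>R\<close> alone, so one null set serves all \<open>D\<close> and \<open>\<phi>\<close>.\<close>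
  have "AE x in lborel. \<exists>q. strict_mono q \<and> (AE y in lborel. y \<in> ball 0 (real R) \<longrightarrow>
      (\<lambda>k. (n' (x + h (q k) *\<^sub>R y), N' (x + h (q k) *\<^sub>R y))) \<longlonglongrightarrow> (n' x, N' x))" for R :: nat
  proof -
    let ?B = "restrict_space lborel (ball (0 :: real^'d) (real R))"
    have "finite_measure ?B"
      using emeasure_bounded_finite[of "ball (0 :: real^'d) (real R)"]
      by (intro finite_measureI) (simp add: emeasure_restrict_space space_restrict_space)
    moreover have "(\<lambda>y. y) \<in> borel_measurable ?B" by (rule measurable_restrict_space1) simp
    ultimately obtain q where "strict_mono q"
      "AE x in lborel. AE y in ?B. (\<lambda>k. (n' (x + h (q k) *\<^sub>R y), N' (x + h (q k) *\<^sub>R y))) \<longlonglongrightarrow> (n' x, N' x)"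
      by (rule shift_AE_subsequence[OF Ig _ _ h(1)]) blast
    then show ?thesis by (auto simp: AE_restrict_space_iff elim!: eventually_mono)
  qed
  then have "AE x in lborel. \<forall>R::nat. \<exists>q. strict_mono q \<and> (AE y in lborel. y \<in> ball 0 (real R) \<longrightarrow>
      (\<lambda>k. (n' (x + h (q k) *\<^sub>R y), N' (x + h (q k) *\<^sub>R y))) \<longlonglongrightarrow> (n' x, N' x))"
    unfolding AE_all_countable by blast
  then have lebesgue_points: "AE x in lebesgue_on \<Omega>. \<forall>R::nat. \<exists>q. strict_mono q \<and> (AE y in lborel. y \<in> ball 0 (real R) \<longrightarrow>
      (\<lambda>k. (n' (x + h (q k) *\<^sub>R y), N' (x + h (q k) *\<^sub>R y))) \<longlonglongrightarrow> (n' x, N' x))"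
    unfolding AE_lebesgue_on_iff[OF WB] by eventually_elim simp
  have "AE x in lebesgue_on \<Omega>. x \<in> \<Omega>" using AE_space by eventually_elim simp
  with nn' wn fix_grad lebesgue_points show ?thesis
  proof eventually_elim
    case (elim x)
    show ?case
    proof (intro allI impI, elim conjE)
      fix D :: "(real^'d) set" and \<phi> :: "real^'d \<Rightarrow> real^'k"
      assume D: "open D" "bounded D" "D \<noteq> {}" and \<phi>0: "\<phi> \<in> W1inf_zero D"
      have DB: "D \<in> sets borel" using D(1) by simp
      obtain b0 where b0: "\<And>y. y \<in> D \<Longrightarrow> norm y \<le> b0" using D(2) by (auto simp: bounded_iff)
      obtain R :: nat where R: "b0 < real R" using reals_Archimedean2 by blast
      have DR: "D \<subseteq> ball 0 (real R)" using le_less_trans[OF b0 R] by auto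
      obtain \<phi>' \<Phi> b L' where \<phi>: "\<phi>' \<in> borel_measurable borel" "\<And>x. norm (\<phi>' x) \<le> b" "\<And>x. x \<notin> D \<Longrightarrow> \<phi>' x = 0"
        and \<Phi>: "\<Phi> \<in> borel_measurable borel" "\<And>x. norm (\<Phi> x) \<le> L'" "\<And>x. x \<notin> D \<Longrightarrow> \<Phi> x = 0"
        and wg\<phi>: "has_weak_grad UNIV \<phi>' \<Phi>" and w\<phi>: "AE y in lebesgue_on D. weak_grad D \<phi> y = \<Phi> y"
        by (rule W1inf_zero_extension[OF D(1,2) \<phi>0]) blast
      obtain q where q: "strict_mono q" "AE y in lborel. y \<in> ball 0 (real R) \<longrightarrow>
          (\<lambda>k. (n' (x + h (q k) *\<^sub>R y), N' (x + h (q k) *\<^sub>R y))) \<longlonglongrightarrow> (n' x, N' x)"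
        using elim(4) by blast
      obtain \<rho> where \<rho>: "\<rho> > 0" "cball x \<rho> \<subseteq> \<Omega>" using W(1) elim(5) by (auto simp: open_contains_cball)
      have hq: "(\<lambda>k. h (q k)) \<longlonglongrightarrow> 0" using LIMSEQ_subseq_LIMSEQ[OF h(1) q(1)] by (simp add: o_def)
      have "eventually (\<lambda>k. h (q k) * real R < \<rho>) sequentially" "eventually (\<lambda>k. h (q k) * b < r) sequentially"
        "eventually (\<lambda>k. \<bar>C\<bar> * (h (q k) * b) < \<delta>) sequentially"
        by (rule order_tendstoD(2)[OF tendsto_mult_left_zero[OF hq]] order_tendstoD(2)[OF tendsto_mult_right_zero[OF tendsto_mult_left_zero[OF hq]]];
            fact)+
      then have "eventually (\<lambda>k. h (q k) * real R < \<rho> \<and> h (q k) * b < r \<and> \<bar>C\<bar> * (h (q k) * b) < \<delta>) sequentially"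
        by (intro eventually_conj)
      then obtain K where K: "\<And>k. k \<ge> K \<Longrightarrow> h (q k) * real R < \<rho> \<and> h (q k) * b < r \<and> \<bar>C\<bar> * (h (q k) * b) < \<delta>"
        by (auto simp: eventually_sequentially)
      \<comment> \<open>Dropping the first terms makes all scales small enough for the comparison of energies.\<close>
      define e where "e k = h (q (k + K))" for k
      have e: "e \<longlonglongrightarrow> 0" "\<And>k. e k > 0" "\<And>k. e k * b \<le> r" "\<And>k. \<bar>C\<bar> * (e k * b) < \<delta>"
        using LIMSEQ_ignore_initial_segment[OF hq, of K] h(2) K by (auto simp: e_def[abs_def] intro: less_imp_le)
      have eR: "cball x (e k * real R) \<subseteq> \<Omega>" for k
        using K[of "k + K"] \<rho>(2) by (auto simp: e_def)
      have eD: "x + e k *\<^sub>R y \<in> \<Omega>" if "y \<in> D" for k y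
      proof -
        have "norm y \<le> real R" using b0[OF that] R by simp
        then have "x + e k *\<^sub>R y \<in> cball x (e k * real R)"
          using e(2)[of k] by (simp add: dist_norm)
        then show ?thesis using eR by blast
      qed
      have lim: "AE y in lborel. y \<in> D \<longrightarrow> (\<lambda>k. (n' (x + e k *\<^sub>R y), N' (x + e k *\<^sub>R y))) \<longlonglongrightarrow> (n' x, N' x)"
        using q(2)
      proof eventually_elim
        case (elim y)
        show ?case
        proof
          assume "y \<in> D"
          then have "y \<in> ball 0 (real R)" using DR by blast
          from LIMSEQ_ignore_initial_segment[OF elim[rule_format, OF this], of K]
          show "(\<lambda>k. (n' (x + e k *\<^sub>R y), N' (x + e k *\<^sub>R y))) \<longlonglongrightarrow> (n' x, N' x)" unfolding e_def .
        qed
      qed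
      note ineq = rescaled_energy_inequality[where e = "e k" and a = x for k, OF assms(17) n_adm \<delta>(2) DB DR
          wg\<phi> \<phi> \<Phi> e(2) eR e(3,4)]
      have main: "measure lborel D * F x (n' x) (N' x)
          \<le> (LINT y|lborel. indicator D y * F x (n' x) (N' x + jacobian_matrix P (n' x) ** \<Phi> y))"
        by (rule blow_up_limit[OF assms(17) DB D(2) \<phi>(2) \<Phi>(1,2) elim(5) e(1-3) eD lim elim(3) ineq])
      let ?f = "\<lambda>y. F x (n' x) (N' x + jacobian_matrix P (n' x) ** \<Phi> y)"
      have fm: "?f \<in> borel_measurable borel"
      proof -
        have J\<Phi>: "(\<lambda>y. N' x + jacobian_matrix P (n' x) ** \<Phi> y) \<in> borel_measurable borel"
          using borel_measurable_matrix_mult[OF borel_measurable_const \<Phi>(1)] by measurable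
        have "continuous_on UNIV (\<lambda>A. case (x, n' x, A) of (x, y, A) \<Rightarrow> F x y A)"
          by (rule continuous_on_compose2[OF assms(17)])
            (use elim(5) n'M closure_subset[of \<Omega>] in \<open>auto intro!: continuous_intros\<close>)
        then have "(\<lambda>A. F x (n' x) A) \<in> borel_measurable borel" by (intro borel_measurable_continuous_onI) simp
        from measurable_compose[OF J\<Phi> this] show ?thesis .
      qed
      let ?g = "\<lambda>y. F x (n x) (weak_grad \<Omega> n x + jacobian_matrix P (n x) ** weak_grad D \<phi> y)"
      have fg: "AE y in lebesgue_on D. ?f y = ?g y"
        using w\<phi> by eventually_elim (simp add: elim(1,2))
      have fmD: "?f \<in> borel_measurable (lebesgue_on D)" by (rule borel_measurable_lebesgue_on[OF fm])
      have "(LINT y|lebesgue_on D. ?g y) = (LINT y|lebesgue_on D. ?f y)"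
        using fg fmD borel_measurable_lebesgue_on_AE[OF DB fmD fg] by (intro integral_cong_AE) auto
      also have "\<dots> = (LINT y|lborel. indicator D y * ?f y)"
        using LINT_lebesgue_on_borel(1)[OF DB fm] by simp
      finally have "measure lborel D * F x (n x) (weak_grad \<Omega> n x) \<le> (LINT y|lebesgue_on D. ?g y)"
        using main by (simp add: elim(1,2))
      moreover have "measure lebesgue D = measure lborel D" using DB by (simp add: measure_completion)
      moreover have "measure lebesgue D > 0"
      proof -
        have "D \<in> lmeasurable" using D by (simp add: lmeasurable_open)
        moreover have "\<not> negligible D" by (rule open_not_negligible[OF D(1,3)])
        ultimately have "measure lebesgue D \<noteq> 0" by (simp add: negligible_iff_measure0)
        then show ?thesis using measure_nonneg[of lebesgue D] by linarith
      qed
      ultimately show "F x (n x) (weak_grad \<Omega> n x) \<le> 1 / measure lebesgue D * (LINT y|lebesgue_on D. ?g y)"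
        by (simp add: field_simps)
    qed
  qed
qed

end
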